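(* Let $n\geq 3$. Then $\operatorname{sdepth}(S_{n,2}/I(\mathcal{C}_{n,2}))\geq\operatorname{depth}(S_{n,2}/I(\mathcal{C}_{n,2}))=\left\lceil\frac{n-1}{3}\right\rceil$.
   Context: $K$ is a field. For a finite simple graph $G$ whose vertices are the variables of a polynomial ring over $K$, the edge ideal $I(G)$ is the squarefree monomial ideal generated by all products $uv$ with $\{u,v\}\in E(G)$. $P_m$ is the path on $m$ vertices ($P_1$ is a single vertex with no edges) and $C_n$ ($n\ge 3$) is the cycle on $n$ vertices. The strong product $G_1\boxtimes G_2$ has vertex set $V(G_1)\times V(G_2)$, and two distinct vertices $(v_1,u_1),(v_2,u_2)$ are adjacent iff each coordinate pair is equal or adjacent ($v_1=v_2$ or $v_1v_2\in E(G_1)$, and $u_1=u_2$ or $u_1u_2\in E(G_2)$). Put $\mathcal{C}_{n,m}:=C_n\boxtimes P_m$, with vertices labelled by variables $x_{ij}$ ($1\le i\le n$, $1\le j\le m$), so that distinct $x_{ij},x_{kl}$ are adjacent iff $i-k\in\{-1,0,1\}$ modulo $n$ and $|j-l|\le 1$. $S_{n,m}:=K[x_{ij}:1\le i\le n,\ 1\le j\le m]$. Depth is taken with respect to the graded maximal ideal generated by all the variables. Stanley depth: let $S=K[x_1,\dots,x_N]$ and $M$ a finitely generated $\mathbb{Z}^N$-graded $S$-module. A Stanley decomposition $\mathcal{D}$ of $M$ is a finite direct sum of $K$-vector spaces $M=\bigoplus_{i=1}^r w_iK[A_i]$ with $w_i\in M$ homogeneous, $A_i\subseteq\{x_1,\dots,x_N\}$,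 where $w_iK[A_i]$ (the $K$-span of all $w_iu$, $u$ a monomial in $K[A_i]$) is a free $K[A_i]$-module. $\operatorname{sdepth}(\mathcal{D})=\min_i|A_i|$ and $\operatorname{sdepth}(M)$ is the maximum of $\operatorname{sdepth}(\mathcal{D})$ over all Stanley decompositions $\mathcal{D}$ of $M$. *)

theory Defs
  imports
    Complex_Main
    "HOL-Library.Poly_Mapping"
    "HOL-Library.Extended_Nat"
    "HOL-Library.FuncSet"
    "HOL-Algebra.QuotRing"
    "HOL-Algebra.Module"
begin

section \<open>Polynomial rings and their cyclic modules\<close>

text \<open>A polynomial is a finitely supported map from exponent vectors to coefficients. The type
  \<open>'v\<close> only supplies names for the variables; the polynomial ring on a set \<open>V\<close> of variables is
  carved out by its carrier.\<close>

type_synonym ('v, 'k) mpoly = "('v \<Rightarrow>\<^sub>0 nat) \<Rightarrow>\<^sub>0 'k"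

definition var :: "'v \<Rightarrow> ('v, 'k::field) mpoly" where
  "var v = Poly_Mapping.single (Poly_Mapping.single v 1) 1"

definition poly_ring :: "'v set \<Rightarrow> ('v, 'k::field) mpoly ring" where
  "poly_ring V =
    \<lparr>carrier = {p. \<forall>t\<in>Poly_Mapping.keys p. Poly_Mapping.keys t \<subseteq> V},
     mult = (*), one = 1, zero = 0, add = (+)\<rparr>"

definition max_graded_ideal :: "'v set \<Rightarrow> ('v, 'k::field) mpoly set" where
  "max_graded_ideal V = Idl\<^bsub>poly_ring V\<^esub> (var ` V)"

text \<open>\<open>R/I\<close> as a module over \<open>R\<close>. The ring multiplication of the record is part of the library's
  module record, but plays no role for modules.\<close>

definition quot_module :: "('a, 'b) ring_scheme \<Rightarrow> 'a set \<Rightarrow> ('a, 'a set) module" where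
  "quot_module R I =
    \<lparr>carrier = carrier (R Quot I), mult = mult (R Quot I), one = one (R Quot I),
     zero = zero (R Quot I), add = add (R Quot I),
     smult = (\<lambda>r x. (I +>\<^bsub>R\<^esub> r) \<otimes>\<^bsub>R Quot I\<^esub> x)\<rparr>"


section \<open>Depth\<close>

text \<open>The submodule \<open>(f\<^sub>1, \<dots>, f\<^sub>r)M\<close>.\<close>

definition mult_submodule :: "('a, 'm, 'c) module_scheme \<Rightarrow> 'a list \<Rightarrow> 'm set" where
  "mult_submodule M fs =
    {\<Oplus>\<^bsub>M\<^esub>i\<in>{..<length fs}. (fs ! i) \<odot>\<^bsub>M\<^esub> y i | y. y \<in> {..<length fs} \<rightarrow> carrier M}"

text \<open>\<open>f\<^sub>i\<close> is a nonzerodivisor on \<open>M/(f\<^sub>1, \<dots>, f\<^bsub>i-1\<^esub>)M\<close> for each \<open>i\<close>, and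
  \<open>M \<noteq> (f\<^sub>1, \<dots>, f\<^sub>r)M\<close>.\<close>

definition regular_sequence ::
    "('a, 'b) ring_scheme \<Rightarrow> ('a, 'm, 'c) module_scheme \<Rightarrow> 'a list \<Rightarrow> bool" where
  "regular_sequence R M fs \<longleftrightarrow>
    set fs \<subseteq> carrier R \<and>
    (\<forall>i<length fs. \<forall>m\<in>carrier M.
      (fs ! i) \<odot>\<^bsub>M\<^esub> m \<in> mult_submodule M (take i fs) \<longrightarrow> m \<in> mult_submodule M (take i fs)) \<and>
    mult_submodule M fs \<noteq> carrier M"

definition depth ::
    "('a, 'b) ring_scheme \<Rightarrow> 'a set \<Rightarrow> ('a, 'm, 'c) module_scheme \<Rightarrow> enat" where
  "depth R J M = Sup {enat (length fs) | fs. set fs \<subseteq> J \<and> regular_sequence R M fs}"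


section \<open>Stanley depth\<close>

text \<open>A \<open>\<int>\<^sup>V\<close>-grading of a module \<open>M\<close> over \<open>K[V]\<close> is given by the function \<open>gr\<close> mapping a degree
  to the corresponding homogeneous component. \<open>K[A]\<close> is \<open>poly_ring A\<close>, and the \<open>K\<close>-span of all
  \<open>w u\<close> with \<open>u\<close> a monomial in \<open>K[A]\<close> is the set of all \<open>f w\<close> with \<open>f \<in> K[A]\<close>.\<close>

definition stanley_space ::
    "(('v, 'k::field) mpoly, 'm, 'c) module_scheme \<Rightarrow> 'm \<Rightarrow> 'v set \<Rightarrow> 'm set" where
  "stanley_space M w A = (\<lambda>f. f \<odot>\<^bsub>M\<^esub> w) ` carrier (poly_ring A)"

definition stanley_decomposition ::
    "'v set \<Rightarrow> (('v, 'k::field) mpoly, 'm, 'c) module_scheme \<Rightarrow> (('v \<Rightarrow> int) \<Rightarrow> 'm set)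
      \<Rightarrow> ('m \<times> 'v set) list \<Rightarrow> bool" where
  "stanley_decomposition V M gr D \<longleftrightarrow>
    (\<forall>(w, A)\<in>set D. w \<in> carrier M \<and> (\<exists>a. w \<in> gr a) \<and> A \<subseteq> V \<and>
       (\<forall>f\<in>carrier (poly_ring A). f \<odot>\<^bsub>M\<^esub> w = \<zero>\<^bsub>M\<^esub> \<longrightarrow> f = 0)) \<and>
    (\<forall>m\<in>carrier M. \<exists>!y.
       y \<in> (\<Pi>\<^sub>E i\<in>{..<length D}. stanley_space M (fst (D ! i)) (snd (D ! i))) \<and>
       m = (\<Oplus>\<^bsub>M\<^esub>i\<in>{..<length D}. y i))"

text \<open>With values in \<open>enat\<close>, the empty decomposition (only possible for \<open>M = 0\<close>) has
  Stanley depth \<open>\<infinity>\<close>; for finite \<open>V\<close> and \<open>M \<noteq> 0\<close> the infimum is a minimum and the supremum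
  a maximum.\<close>

definition sdepth_decomposition :: "('m \<times> 'v set) list \<Rightarrow> enat" where
  "sdepth_decomposition D = (INF (w, A)\<in>set D. enat (card A))"

definition sdepth ::
    "'v set \<Rightarrow> (('v, 'k::field) mpoly, 'm, 'c) module_scheme \<Rightarrow> (('v \<Rightarrow> int) \<Rightarrow> 'm set) \<Rightarrow> enat" where
  "sdepth V M gr = Sup {sdepth_decomposition D | D. stanley_decomposition V M gr D}"

text \<open>The component of degree \<open>a\<close> of \<open>K[V]/I\<close>, for a monomial ideal \<open>I\<close>: the residue classes of
  the scalar multiples of the monomial with exponent vector \<open>a\<close>. It is zero if there is no such
  monomial in \<open>K[V]\<close>.\<close>

definition quot_grading ::
    "'v set \<Rightarrow> ('v, 'k::field) mpoly set \<Rightarrow> ('v \<Rightarrow> int) \<Rightarrow> ('v, 'k) mpoly set set" where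
  "quot_grading V I a = {I +>\<^bsub>poly_ring V\<^esub> p | p. p \<in> carrier (poly_ring V) \<and>
    (\<forall>t\<in>Poly_Mapping.keys p. \<forall>v. int (Poly_Mapping.lookup t v) = a v)}"

abbreviation depth_quot :: "'v set \<Rightarrow> ('v, 'k::field) mpoly set \<Rightarrow> enat" where
  "depth_quot V I \<equiv> depth (poly_ring V) (max_graded_ideal V) (quot_module (poly_ring V) I)"

abbreviation sdepth_quot :: "'v set \<Rightarrow> ('v, 'k::field) mpoly set \<Rightarrow> enat" where
  "sdepth_quot V I \<equiv> sdepth V (quot_module (poly_ring V) I) (quot_grading V I)"


section \<open>Graphs\<close>

record 'v graph =
  verts :: "'v set"
  edges :: "'v set set"

definition edge_ideal :: "'v graph \<Rightarrow> ('v, 'k::field) mpoly set" where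
  "edge_ideal G = Idl\<^bsub>poly_ring (verts G)\<^esub> {var u * var v | u v. {u, v} \<in> edges G}"

definition path_graph :: "nat \<Rightarrow> nat graph" where
  "path_graph m = \<lparr>verts = {1..m}, edges = {{i, i + 1} | i. 1 \<le> i \<and> i < m}\<rparr>"

text \<open>To be used for \<open>n \<ge> 3\<close> only.\<close>

definition cycle_graph :: "nat \<Rightarrow> nat graph" where
  "cycle_graph n =
    \<lparr>verts = {1..n}, edges = insert {n, 1} {{i, i + 1} | i. 1 \<le> i \<and> i < n}\<rparr>"

definition strong_product :: "'a graph \<Rightarrow> 'b graph \<Rightarrow> ('a \<times> 'b) graph" where
  "strong_product G H =
    \<lparr>verts = verts G \<times> verts H,
     edges = {{(v1, u1), (v2, u2)} | v1 u1 v2 u2.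
       v1 \<in> verts G \<and> v2 \<in> verts G \<and> u1 \<in> verts H \<and> u2 \<in> verts H \<and>
       (v1, u1) \<noteq> (v2, u2) \<and>
       (v1 = v2 \<or> {v1, v2} \<in> edges G) \<and> (u1 = u2 \<or> {u1, u2} \<in> edges H)}\<rparr>"

definition strong_cycle_path :: "nat \<Rightarrow> nat \<Rightarrow> (nat \<times> nat) graph" where
  "strong_cycle_path n m = strong_product (cycle_graph n) (path_graph m)"


section \<open>Consistency of the definitions\<close>

lemma cring_poly_ring: "cring (poly_ring V :: ('v, 'k::field) mpoly ring)"
proof -
  have m: "p * q \<in> carrier (poly_ring V)"
    if "p \<in> carrier (poly_ring V)" "q \<in> carrier (poly_ring V)" for p q :: "('v, 'k) mpoly"
  proof -
    have "Poly_Mapping.keys t \<subseteq> V" if t: "t \<in> Poly_Mapping.keys (p * q)" for t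
    proof -
      obtain a b where ab: "t = a + b" "a \<in> Poly_Mapping.keys p" "b \<in> Poly_Mapping.keys q"
        using t keys_mult[of p q] by blast
      then show ?thesis
        using that \<open>p \<in> _\<close> \<open>q \<in> _\<close> keys_add[of a b] unfolding poly_ring_def by fastforce
    qed
    then show ?thesis by (simp add: poly_ring_def)
  qed
  have a: "p + q \<in> carrier (poly_ring V)"
    if "p \<in> carrier (poly_ring V)" "q \<in> carrier (poly_ring V)" for p q :: "('v, 'k) mpoly"
    using that keys_add[of p q] by (auto simp: poly_ring_def)
  have n: "- p \<in> carrier (poly_ring V)"
    if "p \<in> carrier (poly_ring V)" for p :: "('v, 'k) mpoly"
    using that by (auto simp: poly_ring_def)
  have ops: "x \<otimes>\<^bsub>poly_ring V\<^esub> y = x * y" "x \<oplus>\<^bsub>poly_ring V\<^esub> y = x + y"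
    "\<one>\<^bsub>poly_ring V\<^esub> = (1 :: ('v, 'k) mpoly)" "\<zero>\<^bsub>poly_ring V\<^esub> = (0 :: ('v, 'k) mpoly)"
    for x y :: "('v, 'k) mpoly"
    by (simp_all add: poly_ring_def)
  have z: "0 \<in> carrier (poly_ring V :: ('v, 'k) mpoly ring)"
    "1 \<in> carrier (poly_ring V :: ('v, 'k) mpoly ring)"
    by (simp_all add: poly_ring_def)
  show ?thesis
  proof (rule cringI)
    show "abelian_group (poly_ring V :: ('v, 'k) mpoly ring)"
    proof (rule abelian_groupI)
      fix x :: "('v, 'k) mpoly"
      assume "x \<in> carrier (poly_ring V)"
      then show "\<exists>y\<in>carrier (poly_ring V). y \<oplus>\<^bsub>poly_ring V\<^esub> x = \<zero>\<^bsub>poly_ring V\<^esub>"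
        using n[of x] by (intro bexI[of _ "- x"]) (simp_all add: ops)
    qed (simp_all add: ops a z add_ac)
    show "comm_monoid (poly_ring V :: ('v, 'k) mpoly ring)"
      by (rule comm_monoidI) (simp_all add: ops m z mult_ac)
  qed (simp add: ops distrib_right)
qed

lemma module_quot_module:
  assumes "cring R" "ideal I R"
  shows "Module.module R (quot_module R I)"
proof -
  interpret R: cring R by fact
  interpret I: ideal I R by fact
  interpret Q: cring "R Quot I" by (rule I.quotient_is_cring[OF assms(1)])
  interpret h: ring_hom_ring R "R Quot I" "(+>\<^bsub>R\<^esub>) I" by (rule I.rcos_ring_hom_ring)
  have 1: "abelian_group (quot_module R I)"
    by (rule abelian_groupI)
      (auto simp: quot_module_def Q.a_ac intro: bexI[of _ "\<ominus>\<^bsub>R Quot I\<^esub> x" for x] Q.l_neg)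
  show ?thesis
    by (rule module.intro[OF assms(1) 1], unfold_locales)
      (auto simp: quot_module_def Q.l_distr Q.r_distr Q.m_assoc)
qed

text \<open>The library's \<^const>\<open>genideal\<close> is only meaningful for generators in the carrier.\<close>

lemma edge_ideal_generators:
  assumes "\<forall>e\<in>edges G. e \<subseteq> verts G"
  shows "{var u * var v | u v. {u, v} \<in> edges G}
    \<subseteq> (carrier (poly_ring (verts G)) :: ('v, 'k::field) mpoly set)"
proof -
  interpret cring "poly_ring (verts G) :: ('v, 'k) mpoly ring" by (rule cring_poly_ring)
  have 1: "(var v :: ('v, 'k) mpoly) \<in> carrier (poly_ring (verts G))" if "v \<in> verts G" for v
    using that by (auto simp: poly_ring_def var_def)
  have "(var u * var v :: ('v, 'k) mpoly) \<in> carrier (poly_ring (verts G))"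
    if "{u, v} \<in> edges G" for u v
  proof -
    have "u \<in> verts G" "v \<in> verts G" using assms that by auto
    then show ?thesis using m_closed[OF 1 1, of u v] by (simp add: poly_ring_def)
  qed
  then show ?thesis by blast
qed

text \<open>The adjacency relation of \<open>C\<^sub>n \<boxtimes> P\<^sub>m\<close> in coordinates.\<close>

lemma strong_cycle_path_adj:
  assumes n: "n \<ge> 3" and ik: "i \<in> {1..n}" "k \<in> {1..n}" and jl: "j \<in> {1..m}" "l \<in> {1..m}"
    and ne: "(i, j) \<noteq> (k, l)"
  shows "{(i, j), (k, l)} \<in> edges (strong_cycle_path n m) \<longleftrightarrow>
    (\<exists>d\<in>{-1, 0, 1}. (int i - int k) mod int n = d mod int n) \<and> \<bar>int j - int l\<bar> \<le> 1"
proof -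
  have "(int i - int k) mod int n = d mod int n \<longleftrightarrow>
      int i - int k - d \<in> {0, int n, - int n}" if "d \<in> {-1, 0, 1}" for d
  proof -
    have b: "\<bar>int i - int k - d\<bar> \<le> int n" using ik that by auto
    have "int n dvd x \<longleftrightarrow> x \<in> {0, int n, - int n}" if "\<bar>x\<bar> \<le> int n" for x
    proof
      assume "int n dvd x"
      then obtain q where q: "x = int n * q" by (auto elim: dvdE)
      have "\<bar>q\<bar> \<le> 1" using that n by (simp add: q abs_mult)
      then have "q = -1 \<or> q = 0 \<or> q = 1" by linarith
      then show "x \<in> {0, int n, - int n}" using q by auto
    qed auto
    from this[OF b] show ?thesis by (simp add: mod_eq_dvd_iff)
  qed
  then have A: "(\<exists>d\<in>{-1, 0, 1}. (int i - int k) mod int n = d mod int n) \<longleftrightarrow>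
      (\<exists>d\<in>{-1, 0, 1}. int i - int k - d \<in> {0, int n, - int n})"
    by blast
  also have "\<dots> \<longleftrightarrow> i = k \<or> k = i + 1 \<or> i = k + 1 \<or> (i = n \<and> k = 1) \<or> (i = 1 \<and> k = n)"
    using n ik by simp presburger
  also have "\<dots> \<longleftrightarrow> i = k \<or> {i, k} \<in> edges (cycle_graph n)"
    using n ik by (auto simp: cycle_graph_def doubleton_eq_iff)
  finally have c: "(\<exists>d\<in>{-1, 0, 1}. (int i - int k) mod int n = d mod int n) \<longleftrightarrow>
      i = k \<or> {i, k} \<in> edges (cycle_graph n)" .
  have p: "\<bar>int j - int l\<bar> \<le> 1 \<longleftrightarrow> j = l \<or> {j, l} \<in> edges (path_graph m)"
  proof -
    have "\<bar>int j - int l\<bar> \<le> 1 \<longleftrightarrow> j = l \<or> l = j + 1 \<or> j = l + 1" by linarith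
    also have "\<dots> \<longleftrightarrow> j = l \<or> {j, l} \<in> edges (path_graph m)"
      using jl by (auto simp: path_graph_def doubleton_eq_iff)
    finally show ?thesis .
  qed
  have v: "i \<in> verts (cycle_graph n)" "k \<in> verts (cycle_graph n)"
    "j \<in> verts (path_graph m)" "l \<in> verts (path_graph m)"
    using ik jl by (simp_all add: cycle_graph_def path_graph_def)
  have "{(i, j), (k, l)} \<in> edges (strong_cycle_path n m) \<longleftrightarrow>
      (i = k \<or> {i, k} \<in> edges (cycle_graph n)) \<and> (j = l \<or> {j, l} \<in> edges (path_graph m))"
    (is "?L \<longleftrightarrow> ?R")
  proof
    assume ?L
    then show ?R
      unfolding strong_cycle_path_def strong_product_def
      by (auto simp: doubleton_eq_iff insert_commute)
  next
    assume ?R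
    then show ?L
      unfolding strong_cycle_path_def strong_product_def using v ne
      by simp blast
  qed
  then show ?thesis using c p by simp
qed

end

theory Submission
  imports Defs "HOL-Library.Product_Lexorder"
begin

text \<open>
  Write \<open>n = 3k + r\<close> with \<open>r \<in> {0, 1, 2}\<close>. The target value
  \<open>\<lceil>(n - 1)/3\<rceil>\<close> is \<open>k\<close> for \<open>r \<le> 1\<close> and
  \<open>k + 1\<close> for \<open>r = 2\<close>. The vertices form \<open>n\<close> columns of
  two adjacent twins, and the first \<open>3k\<close> columns are cut into \<open>k\<close>
  blocks of three; a block is the closed neighbourhood of either vertex of its middle column.

  Both lower bounds come from one decomposition. For a set \<open>U\<close> of vertices let
  \<open>J U\<close> be the edge ideal of the subgraph induced on \<open>U\<close>, together
  with all variables outside \<open>U\<close>. For \<open>v \<in> U\<close>, \<open>J U :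
  x\<^sub>v = J (U - N(v))\<close> and \<open>J U + (x\<^sub>v) = J (U - {v})\<close>, so
  multiplication by \<open>x\<^sub>v\<close> gives \<open>0 \<rightarrow> S/J(U - N(v))
  \<rightarrow> S/J(U) \<rightarrow> S/J(U - {v}) \<rightarrow> 0\<close>. Repeating this
  (predicate \<open>resolvable\<close>) ends at independent sets \<open>U\<close>, where
  \<open>S/J U\<close> is the polynomial ring \<open>K[U]\<close>. As vector spaces these
  sequences split along monomials, so the leaves of the branching form a Stanley decomposition,
  and the Stanley depth is at least the least size of a leaf (\<open>sdepth_quot_ge\<close>). A
  sequence of polynomials that is regular on both ends of such a sequence is regular in the
  middle (\<open>weakly_regular_colon_adjoin\<close>), so a sequence that is regular on every
  leaf is regular on \<open>S/I\<close>. The sequence consists of the sums of the variables over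
  the blocks and, for \<open>r = 2\<close>, one further sum of variables. The order of branching
  is arranged so that every leaf meets every block (\<open>resolvable_guards\<close>) and, for
  \<open>r = 2\<close>, also satisfies the condition \<open>wide_leaf\<close> that makes the
  last linear form independent of the others.

  For the upper bound, no regular sequence is longer than one that ends in a socle element: if
  \<open>f\<^sub>1, \<dots>, f\<^sub>d\<close> is regular and some \<open>w \<notin> I +
  (f\<^sub>1, \<dots>, f\<^sub>d)\<close> is multiplied into \<open>I + (f\<^sub>1, \<dots>,
  f\<^sub>d)\<close> by every variable, then the Koszul cohomology of \<open>S/I\<close> is
  nonzero in degree \<open>d\<close>, whereas a regular sequence of length greater than
  \<open>d\<close> would make it vanish there (\<open>weakly_regular_length_le\<close>). The
  witness \<open>w\<close> is a product over a set of centres: of column sums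
  \<open>x\<^bsub>c1\<^esub> + x\<^bsub>c2\<^esub>\<close> over the middle columns
  \<open>c\<close> of the blocks if \<open>r \<le> 1\<close>, and of variables
  \<open>x\<^bsub>c1\<^esub>\<close> over the middle columns and the column \<open>n\<close> if
  \<open>r = 2\<close>. That \<open>w\<close> lies outside the ideal is seen by a substitution
  that kills the linear forms, sends every edge to a multiple of a square, and sends
  \<open>w\<close> to a squarefree monomial (\<open>not_in_by_subst\<close>).
\<close>

section \<open>Regular sequences on residue class rings of a subring\<close>

text \<open>Polynomials in the variables of a given set form a subring \<open>C\<close> of a
  ring given by a type. Working with ideals of \<open>C\<close> as sets of ring elements turns
  statements about \<open>C/L\<close> into membership statements with the ordinary ring
  operations.\<close>

locale subring_of =
  fixes C :: "'a::comm_ring_1 set"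
  assumes one_closed [simp]: "1 \<in> C"
    and diff_closed [simp]: "a \<in> C \<Longrightarrow> b \<in> C \<Longrightarrow> a - b \<in> C"
    and mult_closed [simp]: "a \<in> C \<Longrightarrow> b \<in> C \<Longrightarrow> a * b \<in> C"
begin

lemma zero_closed [simp]: "0 \<in> C"
  using diff_closed[OF one_closed one_closed] by simp

lemma uminus_closed [simp]: "a \<in> C \<Longrightarrow> - a \<in> C"
  using diff_closed[of 0 a] by simp

lemma add_closed [simp]: "a \<in> C \<Longrightarrow> b \<in> C \<Longrightarrow> a + b \<in> C"
  using diff_closed[of a "- b"] by simp

lemma sum_closed: "(\<And>x. x \<in> X \<Longrightarrow> f x \<in> C) \<Longrightarrow> sum f X \<in> C"
  by (induction X rule: infinite_finite_induct) auto

lemma prod_closed: "(\<And>x. x \<in> X \<Longrightarrow> f x \<in> C) \<Longrightarrow> prod f X \<in> C"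
  by (induction X rule: infinite_finite_induct) auto

definition is_ideal :: "'a set \<Rightarrow> bool" where
  "is_ideal L \<longleftrightarrow> L \<subseteq> C \<and> 0 \<in> L \<and> (\<forall>a\<in>L. \<forall>b\<in>L. a - b \<in> L) \<and> (\<forall>c\<in>C. \<forall>a\<in>L. c * a \<in> L)"

lemma
  assumes "is_ideal L"
  shows ideal_subset: "a \<in> L \<Longrightarrow> a \<in> C"
    and ideal_zero: "0 \<in> L"
    and ideal_diff: "a \<in> L \<Longrightarrow> b \<in> L \<Longrightarrow> a - b \<in> L"
    and ideal_mult: "c \<in> C \<Longrightarrow> a \<in> L \<Longrightarrow> c * a \<in> L"
  using assms by (auto simp: is_ideal_def)

lemma ideal_uminus: "is_ideal L \<Longrightarrow> a \<in> L \<Longrightarrow> - a \<in> L"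
  using ideal_diff[of L 0 a] ideal_zero by simp

lemma ideal_add: "is_ideal L \<Longrightarrow> a \<in> L \<Longrightarrow> b \<in> L \<Longrightarrow> a + b \<in> L"
  using ideal_diff[of L a "- b"] ideal_uminus by simp

lemma ideal_sum: "is_ideal L \<Longrightarrow> (\<And>x. x \<in> X \<Longrightarrow> f x \<in> L) \<Longrightarrow> sum f X \<in> L"
  by (induction X rule: infinite_finite_induct) (auto simp: ideal_zero ideal_add)

definition adjoin :: "'a set \<Rightarrow> 'a \<Rightarrow> 'a set" where
  "adjoin L f = {a + f * q | a q. a \<in> L \<and> q \<in> C}"

lemma adjoinI: "a \<in> L \<Longrightarrow> q \<in> C \<Longrightarrow> a + f * q \<in> adjoin L f"
  by (auto simp: adjoin_def)

lemma adjoinI': "q \<in> C \<Longrightarrow> a - f * q \<in> L \<Longrightarrow> a \<in> adjoin L f"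
  using adjoinI[of "a - f * q" L q f] by simp

lemma adjoinE: "p \<in> adjoin L f \<Longrightarrow> (\<And>a q. p = a + f * q \<Longrightarrow> a \<in> L \<Longrightarrow> q \<in> C \<Longrightarrow> P) \<Longrightarrow> P"
  by (auto simp: adjoin_def)

lemma adjoin_ideal: assumes "is_ideal L" "f \<in> C" shows "is_ideal (adjoin L f)"
proof -
  have "a + f * q - (b + f * r) \<in> adjoin L f" if "a \<in> L" "b \<in> L" "q \<in> C" "r \<in> C" for a b q r
    using adjoinI[of "a - b" L "q - r" f] that ideal_diff[OF assms(1)] by (simp add: algebra_simps)
  moreover have "c * (a + f * q) \<in> adjoin L f" if "a \<in> L" "q \<in> C" "c \<in> C" for a q c
    using adjoinI[OF ideal_mult[OF assms(1) that(3,1)] mult_closed[OF that(3,2)], of f]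
    by (simp add: algebra_simps)
  moreover have "0 \<in> adjoin L f" using adjoinI[of 0 L 0 f] ideal_zero[OF assms(1)] by simp
  ultimately show ?thesis
    using assms ideal_subset[OF assms(1)] unfolding is_ideal_def adjoin_def
    by (safe; fastforce)
qed

lemma adjoin_superset: "a \<in> L \<Longrightarrow> a \<in> adjoin L f"
  using adjoinI[of a L 0 f] by simp

lemma adjoin_member: "is_ideal L \<Longrightarrow> q \<in> C \<Longrightarrow> f * q \<in> adjoin L f"
  using adjoinI[of 0 L q f] ideal_zero by simp

lemma adjoin_commute: "adjoin (adjoin L f) g = adjoin (adjoin L g) f"
proof -
  have "adjoin (adjoin L f) g \<subseteq> adjoin (adjoin L g) f" for f g
  proof
    fix p assume "p \<in> adjoin (adjoin L f) g"
    then obtain a q r where p: "p = (a + f * q) + g * r" "a \<in> L" "q \<in> C" "r \<in> C"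
      by (auto simp: adjoin_def)
    have "(a + g * r) + f * q \<in> adjoin (adjoin L g) f" using p by (intro adjoinI)
    then show "p \<in> adjoin (adjoin L g) f" using p(1) by (simp add: add_ac)
  qed
  then show ?thesis by blast
qed

lemma foldl_adjoin_ideal: "is_ideal L \<Longrightarrow> set fs \<subseteq> C \<Longrightarrow> is_ideal (foldl adjoin L fs)"
  by (induction fs arbitrary: L) (auto simp: adjoin_ideal)

lemma foldl_adjoin_superset: "a \<in> L \<Longrightarrow> a \<in> foldl adjoin L fs"
  by (induction fs arbitrary: L) (auto simp: adjoin_superset)

lemma foldl_adjoin_member: "is_ideal L \<Longrightarrow> set fs \<subseteq> C \<Longrightarrow> f \<in> set fs \<Longrightarrow> f \<in> foldl adjoin L fs"
proof (induction fs arbitrary: L)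
  case (Cons g fs)
  show ?case
  proof (cases "f = g")
    case True
    then show ?thesis
      using foldl_adjoin_superset[OF adjoin_member[of L 1 g]] Cons.prems by simp
  next
    case False
    then show ?thesis using Cons adjoin_ideal by simp
  qed
qed simp

text \<open>Regularity on \<open>C/L\<close> without the requirement that the final quotient be
  nonzero.\<close>

fun weakly_regular :: "'a set \<Rightarrow> 'a list \<Rightarrow> bool" where
  "weakly_regular L [] \<longleftrightarrow> True"
| "weakly_regular L (f # fs) \<longleftrightarrow> (\<forall>p\<in>C. f * p \<in> L \<longrightarrow> p \<in> L) \<and> weakly_regular (adjoin L f) fs"

lemma weakly_regular_iff_nth:
  "weakly_regular L fs \<longleftrightarrow>
    (\<forall>i<length fs. \<forall>p\<in>C. fs ! i * p \<in> foldl adjoin L (take i fs) \<longrightarrow> p \<in> foldl adjoin L (take i fs))"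
proof (induction fs arbitrary: L)
  case (Cons f fs)
  show ?case
    unfolding weakly_regular.simps Cons length_Cons All_less_Suc2 by simp
qed simp

lemma weakly_regular_append: "weakly_regular L (fs @ gs) \<longleftrightarrow> weakly_regular L fs \<and> weakly_regular (foldl adjoin L fs) gs"
  by (induction fs arbitrary: L) auto

text \<open>Multiplication by \<open>u\<close> gives an exact sequence \<open>0 \<rightarrow>
  C/(L : u) \<rightarrow> C/L \<rightarrow> C/(L + u C) \<rightarrow> 0\<close>. If
  \<open>f\<close> is a nonzerodivisor on both ends, then it is one in the middle, and the
  sequence stays exact after reduction modulo \<open>f\<close>: the only obstruction is the
  \<open>f\<close>-torsion of the right end. In terms of ideals, \<open>(L + f C) : u = (L : u)
  + f C\<close>. Induction on the length of the sequence does the rest.\<close>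

lemma weakly_regular_colon_adjoin:
  assumes "is_ideal L" "u \<in> C" "set fs \<subseteq> C"
    and "A = {p \<in> C. u * p \<in> L}"
    and "weakly_regular A fs" "weakly_regular (adjoin L u) fs"
  shows "weakly_regular L fs"
  using assms
proof (induction fs arbitrary: A L)
  case (Cons f fs)
  have f: "f \<in> C" and u: "u \<in> C" using Cons.prems by auto
  have idL: "is_ideal L" by fact
  have A: "A = {p \<in> C. u * p \<in> L}" by fact
  have regA: "p \<in> A" if "p \<in> C" "f * p \<in> A" for p using Cons.prems(5) that by auto
  have regB: "p \<in> adjoin L u" if "p \<in> C" "f * p \<in> adjoin L u" for p using Cons.prems(6) that by auto
  have "p \<in> L" if p: "p \<in> C" "f * p \<in> L" for p
  proof -
    have "p \<in> adjoin L u" using regB[OF p(1)] adjoin_superset[OF p(2)] by simp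
    then obtain a q where q: "p = a + u * q" "a \<in> L" "q \<in> C" by (rule adjoinE)
    have "u * (f * q) = f * p - f * a" using q(1) by (simp add: algebra_simps)
    then have "u * (f * q) \<in> L"
      using ideal_diff[OF idL p(2) ideal_mult[OF idL f q(2)]] by simp
    then have "q \<in> A" using regA[OF q(3)] A f q(3) by simp
    then show ?thesis using q A ideal_add[OF idL] by simp
  qed
  moreover have "weakly_regular (adjoin L f) fs"
  proof (rule Cons.IH[OF adjoin_ideal[OF idL f] u _ _ _])
    show "set fs \<subseteq> C" using Cons.prems by simp
    show "weakly_regular (adjoin A f) fs" using Cons.prems by simp
    show "weakly_regular (adjoin (adjoin L f) u) fs" using Cons.prems by (simp add: adjoin_commute[of L f])
    show "adjoin A f = {p \<in> C. u * p \<in> adjoin L f}"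
    proof (intro subset_antisym subsetI)
      fix p assume "p \<in> adjoin A f"
      then obtain a q where q: "p = a + f * q" "a \<in> A" "q \<in> C" by (rule adjoinE)
      have "u * a + f * (u * q) \<in> adjoin L f" by (rule adjoinI) (use q A u in auto)
      then show "p \<in> {p \<in> C. u * p \<in> adjoin L f}" using q A f u by (simp add: algebra_simps)
    next
      fix p assume "p \<in> {p \<in> C. u * p \<in> adjoin L f}"
      then have p: "p \<in> C" "u * p \<in> adjoin L f" by auto
      obtain l q where q: "u * p = l + f * q" "l \<in> L" "q \<in> C" using p(2) by (rule adjoinE)
      have "f * q = - l + u * p" using q(1) by simp
      then have "f * q \<in> adjoin L u" using adjoinI[OF ideal_uminus[OF idL q(2)] p(1), of u] by metis
      then have "q \<in> adjoin L u" using regB[OF q(3)] by simp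
      then obtain l' r where r: "q = l' + u * r" "l' \<in> L" "r \<in> C" by (rule adjoinE)
      have "u * (p - f * r) = l + f * l'" using q r by (simp add: algebra_simps)
      then have "u * (p - f * r) \<in> L"
        using ideal_add[OF idL q(2) ideal_mult[OF idL f r(2)]] by simp
      then show "p \<in> adjoin A f" using A p(1) f r(3) by (intro adjoinI'[of r]) auto
    qed
  qed
  ultimately show ?case by simp
qed simp

end

section \<open>Koszul cohomology and the length of regular sequences\<close>

locale koszul = subring_of C for C :: "'a::comm_ring_1 set" +
  fixes x :: "'v \<Rightarrow> 'a" and V :: "'v set"
  assumes x_closed: "x v \<in> C" and fin: "finite V"
begin

text \<open>The Koszul complex in a form without signs of permutations: a cochain of degree
  \<open>k\<close> is an arbitrary function on lists of \<open>k\<close> indices, and \<open>(d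
  c)(v\<^sub>0 \<dots> v\<^sub>k) = \<Sum>\<^sub>i (-1)\<^sup>i x(v\<^sub>i) c(v\<^sub>0 \<dots>
  v\<^bsub>i-1\<^esub> v\<^bsub>i+1\<^esub> \<dots> v\<^sub>k)\<close>. Peeling off the first
  index gives a recursion that treats all degrees at once. The properties that matter, \<open>d
  d = 0\<close> and that every \<open>x\<^sub>v\<close> acts as zero on cohomology, hold as for
  alternating cochains.\<close>

primrec koszul_d :: "('v list \<Rightarrow> 'a) \<Rightarrow> 'v list \<Rightarrow> 'a" where
  "koszul_d c [] = 0"
| "koszul_d c (v # l) = x v * c l - koszul_d (\<lambda>l. c (v # l)) l"

lemma koszul_d_diff: "koszul_d (\<lambda>l. b l - c l) l = koszul_d b l - koszul_d c l"
  by (induction l arbitrary: b c) (simp_all add: algebra_simps)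

lemma koszul_d_scale: "koszul_d (\<lambda>l. r * c l) l = r * koszul_d c l"
  by (induction l arbitrary: c) (simp_all add: algebra_simps)

lemma koszul_d_closed: "(\<And>l. c l \<in> C) \<Longrightarrow> koszul_d c l \<in> C"
  by (induction l arbitrary: c) (simp_all add: x_closed)

lemma koszul_d_koszul_d: "koszul_d (koszul_d c) l = 0"
proof (induction l arbitrary: c)
  case (Cons v l)
  have "koszul_d (\<lambda>l. koszul_d c (v # l)) l = x v * koszul_d c l - koszul_d (koszul_d (\<lambda>l. c (v # l))) l"
    by (simp add: koszul_d_diff koszul_d_scale)
  then show ?case by (simp add: Cons)
qed simp

lemma koszul_d_in_ideal:
  "is_ideal L \<Longrightarrow> (\<And>l'. Suc (length l') = length l \<Longrightarrow> c l' \<in> L) \<Longrightarrow> koszul_d c l \<in> L"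
  by (induction l arbitrary: c) (simp_all add: ideal_zero ideal_diff ideal_mult x_closed)

text \<open>The cohomology of \<open>C/L\<close> in degree \<open>k\<close> is zero. Only the
  values of the cochains \<open>b\<close> and \<open>c\<close> on lists of the relevant length
  enter; for \<open>k = 0\<close> the conclusion says \<open>c [] \<in> L\<close>, because
  \<open>koszul_d b [] = 0\<close>.\<close>

definition koszul_vanishes :: "nat \<Rightarrow> 'a set \<Rightarrow> bool" where
  "koszul_vanishes k L \<longleftrightarrow>
    (\<forall>c. (\<forall>l. c l \<in> C) \<and> (\<forall>l. length l = Suc k \<longrightarrow> koszul_d c l \<in> L) \<longrightarrow>
      (\<exists>b. (\<forall>l. b l \<in> C) \<and> (\<forall>l. length l = k \<longrightarrow> c l - koszul_d b l \<in> L)))"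

definition var_ideal :: "'a set" where
  "var_ideal = {\<Sum>v\<in>V. a v * x v | a. \<forall>v. a v \<in> C}"

lemma var_ideal_closed: "var_ideal \<subseteq> C"
  by (auto simp: var_ideal_def x_closed intro!: sum_closed)

text \<open>The homotopy behind the fact that \<open>g = \<Sum> a\<^sub>v x\<^sub>v\<close>
  annihilates the cohomology: contracting with \<open>a\<close> in the first argument satisfies
  \<open>d h + h d = g\<close>.\<close>

definition contract :: "('v \<Rightarrow> 'a) \<Rightarrow> ('v list \<Rightarrow> 'a) \<Rightarrow> 'v list \<Rightarrow> 'a" where
  "contract a c l = (\<Sum>v\<in>V. a v * c (v # l))"

lemma koszul_d_sum: "koszul_d (\<lambda>l. \<Sum>v\<in>X. f v l) l = (\<Sum>v\<in>X. koszul_d (f v) l)"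
  by (induction l arbitrary: f) (simp_all add: sum_subtractf sum_distrib_left)

lemma koszul_d_contract:
  "koszul_d (contract a c) l = (\<Sum>v\<in>V. a v * x v) * c l - contract a (koszul_d c) l"
proof -
  have "koszul_d (contract a c) l = (\<Sum>v\<in>V. a v * koszul_d (\<lambda>l. c (v # l)) l)"
    unfolding contract_def by (simp add: koszul_d_sum koszul_d_scale)
  moreover have "contract a (koszul_d c) l =
      (\<Sum>v\<in>V. a v * x v) * c l - (\<Sum>v\<in>V. a v * koszul_d (\<lambda>l. c (v # l)) l)"
    by (simp add: contract_def sum_subtractf sum_distrib_right right_diff_distrib mult.assoc)
  ultimately show ?thesis by simp
qed

lemma contract_closed: "(\<And>v. a v \<in> C) \<Longrightarrow> (\<And>l. c l \<in> C) \<Longrightarrow> contract a c l \<in> C"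
  unfolding contract_def by (intro sum_closed mult_closed)

text \<open>If \<open>c\<close> is a cocycle and \<open>h\<close> the homotopy for the first
  element \<open>g\<close>, then \<open>g c = d (h c)\<close>. Modulo \<open>g\<close> the
  cochain \<open>h c\<close> is therefore a cocycle of degree one less, hence by induction a
  coboundary: \<open>h c = d e + g q\<close>. Applying \<open>d\<close> gives \<open>g c = g d
  q\<close>, and \<open>g\<close> can be cancelled.\<close>

lemma vanish_below_weakly_regular:
  assumes "is_ideal L" "set gs \<subseteq> var_ideal" "weakly_regular L gs" "k < length gs"
  shows "koszul_vanishes k L"
  using assms
proof (induction gs arbitrary: L k)
  case (Cons g gs)
  have idL: "is_ideal L" by fact
  obtain a where a: "\<And>v. a v \<in> C" and g: "g = (\<Sum>v\<in>V. a v * x v)"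
    using Cons.prems(2) by (auto simp: var_ideal_def)
  have gC: "g \<in> C" using Cons.prems(2) var_ideal_closed by auto
  have reg: "p \<in> L" if "p \<in> C" "g * p \<in> L" for p using Cons.prems(3) that by auto
  show ?case
    unfolding koszul_vanishes_def
  proof (intro allI impI, elim conjE)
    fix c
    assume c: "\<forall>l. c l \<in> C" and cocycle: "\<forall>l. length l = Suc k \<longrightarrow> koszul_d c l \<in> L"
    define b where "b = contract a c"
    have b: "b l \<in> C" for l unfolding b_def using a c by (intro contract_closed) auto
    have db: "g * c l - koszul_d b l \<in> L" if "length l = k" for l
    proof -
      have "g * c l - koszul_d b l = contract a (koszul_d c) l"
        by (simp add: b_def koszul_d_contract g)
      also have "\<dots> \<in> L"
        unfolding contract_def using cocycle that a
        by (intro ideal_sum[OF idL] ideal_mult[OF idL]) (auto simp del: koszul_d.simps)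
      finally show ?thesis .
    qed
    show "\<exists>b. (\<forall>l. b l \<in> C) \<and> (\<forall>l. length l = k \<longrightarrow> c l - koszul_d b l \<in> L)"
    proof (cases k)
      case 0
      then have "c [] \<in> L" using db[of "[]"] reg c by simp
      then show ?thesis using 0 by (intro exI[of _ "\<lambda>_. 0"]) simp
    next
      case (Suc k')
      have "koszul_d b l \<in> adjoin L g" if "length l = Suc k'" for l
        using ideal_uminus[OF idL db[of l]] that Suc c by (intro adjoinI'[of "c l"]) auto
      moreover have "koszul_vanishes k' (adjoin L g)"
        using Cons.prems Suc gC adjoin_ideal by (intro Cons.IH) auto
      ultimately obtain e where e: "\<And>l. e l \<in> C"
        and be: "\<And>l. length l = k' \<Longrightarrow> b l - koszul_d e l \<in> adjoin L g"
        using b unfolding koszul_vanishes_def by metis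
      have "\<exists>q. q \<in> C \<and> (length l = k' \<longrightarrow> b l - koszul_d e l - g * q \<in> L)" for l
        using be[of l] adjoinE[of "b l - koszul_d e l" L g]
        by (metis add_diff_cancel_right' zero_closed)
      then obtain q where q: "\<And>l. q l \<in> C"
        and bq: "\<And>l. length l = k' \<Longrightarrow> b l - koszul_d e l - g * q l \<in> L" by metis
      have "c l - koszul_d q l \<in> L" if l: "length l = k" for l
      proof -
        have "koszul_d (\<lambda>l. b l - koszul_d e l - g * q l) l \<in> L"
          using l Suc bq by (intro koszul_d_in_ideal[OF idL]) auto
        then have "koszul_d b l - g * koszul_d q l \<in> L"
          using koszul_d_koszul_d[of e l] by (simp add: koszul_d_diff koszul_d_scale)
        from ideal_add[OF idL db[OF l] this] have "g * (c l - koszul_d q l) \<in> L"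
          by (simp add: algebra_simps)
        then show ?thesis using reg c q koszul_d_closed by simp
      qed
      then show ?thesis using q by auto
    qed
  qed
qed simp

text \<open>The element \<open>w\<close> is a nonzero class of degree \<open>0\<close> modulo
  the whole sequence, and the connecting maps of \<open>0 \<rightarrow> C/L \<rightarrow> C/L
  \<rightarrow> C/(L + f C) \<rightarrow> 0\<close> lift it degree by degree: they are injective
  because the cohomology of \<open>C/L\<close> vanishes in every degree below the length of the
  sequence.\<close>

lemma not_vanish_socle:
  assumes "is_ideal L" "set fs \<subseteq> var_ideal" "weakly_regular L fs"
    and "w \<in> C" "w \<notin> foldl adjoin L fs" "\<And>v. x v * w \<in> foldl adjoin L fs"
  shows "\<not> koszul_vanishes (length fs) L"
  using assms
proof (induction fs arbitrary: L)
  case Nil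
  show ?case
  proof
    assume "koszul_vanishes (length []) L"
    moreover have "koszul_d (\<lambda>_. w) l \<in> L" if "length l = 1" for l
      using that Nil by (cases l) auto
    ultimately show False
      using Nil unfolding koszul_vanishes_def by (auto dest: spec[of _ "\<lambda>_. w"])
  qed
next
  case (Cons f fs)
  have idL: "is_ideal L" by fact
  have fC: "f \<in> C" using Cons.prems(2) var_ideal_closed by auto
  have reg: "p \<in> L" if "p \<in> C" "f * p \<in> L" for p using Cons.prems(3) that by auto
  have "\<not> koszul_vanishes (length fs) (adjoin L f)"
    using Cons.prems fC adjoin_ideal by (intro Cons.IH) auto
  moreover have "koszul_vanishes (length fs) (adjoin L f)" if van: "koszul_vanishes (Suc (length fs)) L"
    unfolding koszul_vanishes_def
  proof (intro allI impI, elim conjE)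
    fix b
    assume b: "\<forall>l. b l \<in> C" and cocycle: "\<forall>l. length l = Suc (length fs) \<longrightarrow> koszul_d b l \<in> adjoin L f"
    have "\<exists>q. q \<in> C \<and> (length l = Suc (length fs) \<longrightarrow> koszul_d b l - f * q \<in> L)" for l
      using cocycle adjoinE[of "koszul_d b l" L f] by (metis add_diff_cancel_right' zero_closed)
    then obtain c where c: "\<And>l. c l \<in> C"
      and bc: "\<And>l. length l = Suc (length fs) \<Longrightarrow> koszul_d b l - f * c l \<in> L" by metis
    have "koszul_d c l \<in> L" if "length l = Suc (Suc (length fs))" for l
    proof -
      have "koszul_d (\<lambda>l. koszul_d b l - f * c l) l \<in> L"
        using that bc by (intro koszul_d_in_ideal[OF idL]) auto
      then have "- (f * koszul_d c l) \<in> L" using koszul_d_koszul_d[of b l] by (simp add: koszul_d_diff koszul_d_scale)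
      then have "f * koszul_d c l \<in> L" using ideal_uminus[OF idL] by fastforce
      then show ?thesis using reg koszul_d_closed c by blast
    qed
    then obtain b' where b': "\<And>l. b' l \<in> C"
      and cb': "\<And>l. length l = Suc (length fs) \<Longrightarrow> c l - koszul_d b' l \<in> L"
      using van c unfolding koszul_vanishes_def by metis
    have "koszul_d (\<lambda>l. b l - f * b' l) l \<in> L" if l: "length l = Suc (length fs)" for l
    proof -
      have "koszul_d b l - f * c l + f * (c l - koszul_d b' l) \<in> L"
        by (intro ideal_add[OF idL] ideal_mult[OF idL fC] bc cb' l)
      then show ?thesis by (simp add: koszul_d_diff koszul_d_scale algebra_simps)
    qed
    moreover have "koszul_vanishes (length fs) L"
      using Cons.prems by (intro vanish_below_weakly_regular[of L "f # fs"]) auto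
    ultimately obtain e where e: "\<And>l. e l \<in> C"
      and be: "\<And>l. length l = length fs \<Longrightarrow> (b l - f * b' l) - koszul_d e l \<in> L"
      unfolding koszul_vanishes_def using b b' fC
      by (metis (no_types, lifting) diff_closed mult_closed)
    have "b l - koszul_d e l \<in> adjoin L f" if "length l = length fs" for l
      using be[OF that] b'[of l] by (intro adjoinI'[of "b' l"]) (auto simp: algebra_simps)
    then show "\<exists>e. (\<forall>l. e l \<in> C) \<and> (\<forall>l. length l = length fs \<longrightarrow> b l - koszul_d e l \<in> adjoin L f)"
      using e by blast
  qed
  ultimately show ?case by auto
qed

text \<open>A regular sequence that ends in a quotient with a nonzero element annihilated by all
  \<open>x\<^sub>v\<close> has maximal length: it makes the Koszul cohomology nonzero in the
  degree given by its length, and a longer regular sequence would make it vanish there.\<close>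

theorem weakly_regular_length_le:
  assumes "is_ideal L" "set fs \<subseteq> var_ideal" "weakly_regular L fs"
    and "w \<in> C" "w \<notin> foldl adjoin L fs" "\<And>v. x v * w \<in> foldl adjoin L fs"
    and "set gs \<subseteq> var_ideal" "weakly_regular L gs"
  shows "length gs \<le> length fs"
  using not_vanish_socle[OF assms(1-6)] vanish_below_weakly_regular[OF assms(1,7,8)] not_le_imp_less by blast

end

section \<open>Monomials, divisibility and substitution\<close>

lemma poly_as_sum:
  fixes p :: "'a \<Rightarrow>\<^sub>0 'b::comm_monoid_add"
  assumes "finite T" "Poly_Mapping.keys p \<subseteq> T"
  shows "p = (\<Sum>t\<in>T. Poly_Mapping.single t (Poly_Mapping.lookup p t))"
proof (rule poly_mapping_eqI)
  fix k
  show "Poly_Mapping.lookup p k =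
      Poly_Mapping.lookup (\<Sum>t\<in>T. Poly_Mapping.single t (Poly_Mapping.lookup p t)) k"
    using assms by (auto simp: lookup_sum lookup_single when_def in_keys_iff)
qed

lemma lookup_single_times:
  fixes p :: "('v \<Rightarrow>\<^sub>0 nat) \<Rightarrow>\<^sub>0 'k::field"
  shows "Poly_Mapping.lookup (Poly_Mapping.single t c * p) (t + s) = c * Poly_Mapping.lookup p s"
proof -
  have "Poly_Mapping.single t c * p =
      (\<Sum>r\<in>Poly_Mapping.keys p. Poly_Mapping.single (t + r) (c * Poly_Mapping.lookup p r))"
    by (subst poly_as_sum[of "Poly_Mapping.keys p" p])
      (simp_all add: sum_distrib_left mult_single)
  then show ?thesis
    by (auto simp: lookup_sum lookup_single when_def in_keys_iff)
qed

lemma keys_single_times: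
  fixes p :: "('v \<Rightarrow>\<^sub>0 nat) \<Rightarrow>\<^sub>0 'k::field"
  assumes "c \<noteq> 0"
  shows "Poly_Mapping.keys (Poly_Mapping.single t c * p) = (+) t ` Poly_Mapping.keys p"
proof (intro subset_antisym subsetI)
  fix s assume "s \<in> Poly_Mapping.keys (Poly_Mapping.single t c * p)"
  then show "s \<in> (+) t ` Poly_Mapping.keys p"
    using keys_mult[of "Poly_Mapping.single t c" p] assms by auto
next
  fix s assume "s \<in> (+) t ` Poly_Mapping.keys p"
  then show "s \<in> Poly_Mapping.keys (Poly_Mapping.single t c * p)"
    using assms by (auto simp: in_keys_iff lookup_single_times)
qed

lemma keys_add_nat:
  fixes s t :: "'v \<Rightarrow>\<^sub>0 nat"
  shows "Poly_Mapping.keys (s + t) = Poly_Mapping.keys s \<union> Poly_Mapping.keys t"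
  by (auto simp: in_keys_iff lookup_add)

lemma monomial_quotient:
  fixes p :: "('v \<Rightarrow>\<^sub>0 nat) \<Rightarrow>\<^sub>0 'k::field"
  assumes "\<forall>s\<in>Poly_Mapping.keys p. \<exists>r. s = t + r"
  obtains q where "p = Poly_Mapping.single t 1 * q"
    and "Poly_Mapping.keys q = {r. t + r \<in> Poly_Mapping.keys p}"
proof
  define q where "q = Poly_Mapping.map_key ((+) t) p"
  have inj: "inj ((+) t)" by (simp add: inj_on_def)
  have q: "Poly_Mapping.lookup q r = Poly_Mapping.lookup p (t + r)" for r
    unfolding q_def using inj by (simp add: map_key.rep_eq)
  show keys: "Poly_Mapping.keys q = {r. t + r \<in> Poly_Mapping.keys p}"
    by (auto simp: in_keys_iff q)
  show "p = Poly_Mapping.single t 1 * q"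
  proof (rule poly_mapping_eqI)
    fix s
    show "Poly_Mapping.lookup p s = Poly_Mapping.lookup (Poly_Mapping.single t 1 * q) s"
    proof (cases "\<exists>r. s = t + r")
      case True
      then show ?thesis by (auto simp: lookup_single_times q)
    next
      case False
      then have "s \<notin> Poly_Mapping.keys p" "s \<notin> Poly_Mapping.keys (Poly_Mapping.single t 1 * q)"
        using assms by (auto simp: keys_single_times)
      then show ?thesis by (simp add: in_keys_iff)
    qed
  qed
qed

definition restrict_keys :: "'a set \<Rightarrow> ('a \<Rightarrow>\<^sub>0 'b::zero) \<Rightarrow> 'a \<Rightarrow>\<^sub>0 'b" where
  "restrict_keys X p = Poly_Mapping.mapp (\<lambda>t c. if t \<in> X then c else 0) p"

lemma lookup_restrict_keys:
  "Poly_Mapping.lookup (restrict_keys X p) t = (if t \<in> X then Poly_Mapping.lookup p t else 0)"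
  by (auto simp: restrict_keys_def lookup_mapp when_def in_keys_iff)

lemma keys_restrict_keys: "Poly_Mapping.keys (restrict_keys X p) = Poly_Mapping.keys p \<inter> X"
  by (auto simp: in_keys_iff lookup_restrict_keys split: if_splits)

lemma dvd_monomial: "v \<in> Poly_Mapping.keys s \<Longrightarrow> \<exists>r. s = Poly_Mapping.single v (1::nat) + r"
  by (intro exI[of _ "s - Poly_Mapping.single v 1"] poly_mapping_eqI)
    (auto simp: lookup_add lookup_minus lookup_single when_def in_keys_iff)

definition monomial_value :: "('v \<Rightarrow> ('v, 'k::field) mpoly) \<Rightarrow> ('v \<Rightarrow>\<^sub>0 nat) \<Rightarrow> ('v, 'k) mpoly" where
  "monomial_value \<sigma> t = (\<Prod>v\<in>Poly_Mapping.keys t. \<sigma> v ^ Poly_Mapping.lookup t v)"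

lemma monomial_value_superset:
  "finite X \<Longrightarrow> Poly_Mapping.keys t \<subseteq> X \<Longrightarrow>
    monomial_value \<sigma> t = (\<Prod>v\<in>X. \<sigma> v ^ Poly_Mapping.lookup t v)"
  unfolding monomial_value_def by (rule prod.mono_neutral_left) (auto simp: in_keys_iff)

lemma monomial_value_add: "monomial_value \<sigma> (s + t) = monomial_value \<sigma> s * monomial_value \<sigma> t"
  by (simp add: monomial_value_superset[of "Poly_Mapping.keys s \<union> Poly_Mapping.keys t"]
      keys_add_nat lookup_add power_add prod.distrib)

text \<open>The \<open>K\<close>-algebra homomorphism that sends each variable \<open>v\<close>
  to \<open>\<sigma> v\<close>.\<close>

definition subst :: "('v \<Rightarrow> ('v, 'k::field) mpoly) \<Rightarrow> ('v, 'k) mpoly \<Rightarrow> ('v, 'k) mpoly" where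
  "subst \<sigma> p = (\<Sum>t\<in>Poly_Mapping.keys p.
    Poly_Mapping.single 0 (Poly_Mapping.lookup p t) * monomial_value \<sigma> t)"

lemma subst_superset:
  "finite T \<Longrightarrow> Poly_Mapping.keys p \<subseteq> T \<Longrightarrow> subst \<sigma> p =
    (\<Sum>t\<in>T. Poly_Mapping.single 0 (Poly_Mapping.lookup p t) * monomial_value \<sigma> t)"
  unfolding subst_def by (rule sum.mono_neutral_left) (auto simp: in_keys_iff)

lemma subst_zero [simp]: "subst \<sigma> 0 = 0"
  by (simp add: subst_def)

lemma subst_add: "subst \<sigma> (p + q) = subst \<sigma> p + subst \<sigma> q"
  using keys_add[of p q]
  by (simp add: subst_superset[of "Poly_Mapping.keys p \<union> Poly_Mapping.keys q"]
      lookup_add single_add distrib_right sum.distrib)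

lemma subst_sum: "subst \<sigma> (sum f X) = (\<Sum>x\<in>X. subst \<sigma> (f x))"
  by (induction X rule: infinite_finite_induct) (simp_all add: subst_add)

lemma subst_single: "subst \<sigma> (Poly_Mapping.single t c) = Poly_Mapping.single 0 c * monomial_value \<sigma> t"
  by (subst subst_superset[of "{t}"]) auto

lemma subst_mult: "subst \<sigma> (p * q) = subst \<sigma> p * subst \<sigma> q"
proof -
  let ?m = "\<lambda>p t. Poly_Mapping.single t (Poly_Mapping.lookup p t)"
  have "subst \<sigma> (p * q) =
      subst \<sigma> ((\<Sum>s\<in>Poly_Mapping.keys p. ?m p s) * (\<Sum>t\<in>Poly_Mapping.keys q. ?m q t))"
    by (intro arg_cong[of _ _ "subst \<sigma>"] arg_cong2[of _ _ _ _ "(*)"] poly_as_sum) auto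
  also have "\<dots> = (\<Sum>s\<in>Poly_Mapping.keys p. \<Sum>t\<in>Poly_Mapping.keys q.
      (Poly_Mapping.single 0 (Poly_Mapping.lookup p s) * monomial_value \<sigma> s) *
      (Poly_Mapping.single 0 (Poly_Mapping.lookup q t) * monomial_value \<sigma> t))"
  proof -
    have "subst \<sigma> (Poly_Mapping.single s a * Poly_Mapping.single t b) =
        (Poly_Mapping.single 0 a * monomial_value \<sigma> s) * (Poly_Mapping.single 0 b * monomial_value \<sigma> t)"
      for s t a b
    proof -
      have e: "Poly_Mapping.single 0 (a * b) =
          Poly_Mapping.single (0 :: 'a \<Rightarrow>\<^sub>0 nat) a * Poly_Mapping.single 0 b"
        by (simp add: mult_single)
      show ?thesis
        unfolding mult_single[of s a t b] subst_single monomial_value_add e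
        by (simp only: mult_ac)
    qed
    then show ?thesis by (simp only: sum_product subst_sum)
  qed
  also have "\<dots> = subst \<sigma> p * subst \<sigma> q"
    by (simp add: subst_def sum_product)
  finally show ?thesis .
qed

lemma subst_var: "subst \<sigma> (var v) = \<sigma> v"
  by (simp add: var_def subst_single monomial_value_def)

lemma monomial_value_var: "monomial_value var t = (Poly_Mapping.single t 1 :: ('v, 'k::field) mpoly)"
proof -
  have pow: "(var v :: ('v, 'k) mpoly) ^ e = Poly_Mapping.single (Poly_Mapping.single v e) 1" for v e
  proof (induction e)
    case (Suc e)
    have "Poly_Mapping.single v (1::nat) + Poly_Mapping.single v e = Poly_Mapping.single v (Suc e)"
      by (simp flip: single_add)
    then show ?case using Suc by (simp add: var_def mult_single)
  qed simp
  have prod: "(\<Prod>v\<in>X. Poly_Mapping.single (e v) (1::'k)) = Poly_Mapping.single (\<Sum>v\<in>X. e v) 1"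
    for X :: "'v set" and e :: "'v \<Rightarrow> 'v \<Rightarrow>\<^sub>0 nat"
    by (induction X rule: infinite_finite_induct) (simp_all add: mult_single)
  show ?thesis
    unfolding monomial_value_def pow prod
    by (simp flip: poly_as_sum[OF finite_keys order_refl])
qed

lemma subst_var_id: "subst var p = p"
  by (simp add: subst_def monomial_value_var mult_single flip: poly_as_sum[OF finite_keys order_refl])

lemma carrier_poly_ring: "p \<in> carrier (poly_ring V) \<longleftrightarrow> (\<forall>t\<in>Poly_Mapping.keys p. Poly_Mapping.keys t \<subseteq> V)"
  by (simp add: poly_ring_def)

lemma var_carrier: "v \<in> V \<Longrightarrow> var v \<in> carrier (poly_ring V)"
  by (simp add: carrier_poly_ring var_def)

lemma subring_of_poly_ring: "subring_of (carrier (poly_ring V) :: ('v, 'k::field) mpoly set)"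
proof -
  interpret cring "poly_ring V :: ('v, 'k) mpoly ring" by (rule cring_poly_ring)
  show ?thesis
  proof
    show "p * q \<in> carrier (poly_ring V)" if "p \<in> carrier (poly_ring V)" "q \<in> carrier (poly_ring V)"
      for p q :: "('v, 'k) mpoly"
      using m_closed[OF that] by (simp add: poly_ring_def)
    show "p - q \<in> carrier (poly_ring V)" if "p \<in> carrier (poly_ring V)" "q \<in> carrier (poly_ring V)"
      for p q :: "('v, 'k) mpoly"
    proof -
      have "Poly_Mapping.keys (p - q) \<subseteq> Poly_Mapping.keys p \<union> Poly_Mapping.keys q"
        by (auto simp: in_keys_iff lookup_minus)
      then show ?thesis using that unfolding carrier_poly_ring by blast
    qed
  qed (simp add: carrier_poly_ring)
qed

text \<open>The linear order on the variables induces an order on exponent vectors, and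
  comparing leading terms shows that the polynomials form a domain. The type argument names the
  coefficient field.\<close>

locale polynomial_ring =
  fixes V :: "'v::linorder set" and K :: "'k::field itself"
  assumes fin: "finite V"
begin

abbreviation C :: "('v, 'k) mpoly set" where "C \<equiv> carrier (poly_ring V)"

abbreviation x :: "'v \<Rightarrow> ('v, 'k) mpoly" where "x v \<equiv> if v \<in> V then var v else 0"

sublocale koszul C x V
proof -
  interpret subring_of C by (rule subring_of_poly_ring)
  show "koszul C x V" by unfold_locales (auto simp: var_carrier fin)
qed

lemma const_closed [simp]: "Poly_Mapping.single 0 c \<in> C"
  by (simp add: carrier_poly_ring)

lemma power_closed: "a \<in> C \<Longrightarrow> a ^ e \<in> C"
  by (induction e) auto

lemma ideal_prod_congruence:
  assumes L: "is_ideal L" and ab: "\<And>i. i \<in> X \<Longrightarrow> a i \<in> C \<and> b i \<in> C \<and> a i - b i \<in> L"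
  shows "prod a X - prod b X \<in> L"
  using ab
proof (induction X rule: infinite_finite_induct)
  case (insert i X)
  have "prod a (insert i X) - prod b (insert i X) =
      prod a X * (a i - b i) + b i * (prod a X - prod b X)"
    using insert by (simp add: algebra_simps)
  also have "\<dots> \<in> L"
    using insert by (intro ideal_add[OF L] ideal_mult[OF L] prod_closed) auto
  finally show ?case .
qed (simp_all add: ideal_zero[OF L])

lemma ideal_power_congruence:
  assumes "is_ideal L" "a \<in> C" "b \<in> C" "a - b \<in> L"
  shows "a ^ e - b ^ e \<in> L"
  using ideal_prod_congruence[of L "{..<e}" "\<lambda>_. a" "\<lambda>_. b"] assms by simp

lemma subst_congruence:
  assumes L: "is_ideal L" and \<sigma>: "\<And>v. v \<in> V \<Longrightarrow> \<sigma> v \<in> C \<and> var v - \<sigma> v \<in> L" and p: "p \<in> C"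
  shows "p - subst \<sigma> p \<in> L"
proof -
  have "p - subst \<sigma> p = subst var p - subst \<sigma> p" by (simp add: subst_var_id)
  also have "\<dots> = (\<Sum>t\<in>Poly_Mapping.keys p. Poly_Mapping.single 0 (Poly_Mapping.lookup p t) *
      (monomial_value var t - monomial_value \<sigma> t))"
    by (simp add: subst_def sum_subtractf right_diff_distrib)
  also have "\<dots> \<in> L"
    unfolding monomial_value_def using p \<sigma>
    by (intro ideal_sum[OF L] ideal_mult[OF L] ideal_prod_congruence[OF L] conjI power_closed
        ideal_power_congruence[OF L] var_carrier const_closed) (auto simp: carrier_poly_ring)
  finally show ?thesis .
qed

text \<open>Since \<open>subst\<close> is a homomorphism, a target set closed under sums and
  multiples only has to contain the images of \<open>L\<close> and of the adjoined
  elements.\<close>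

lemma subst_foldl_adjoin:
  assumes "\<And>p. p \<in> L \<Longrightarrow> subst \<sigma> p \<in> Z" "\<And>f. f \<in> set fs \<Longrightarrow> subst \<sigma> f \<in> Z"
    and "\<And>a b. a \<in> Z \<Longrightarrow> b \<in> Z \<Longrightarrow> a + b \<in> Z" "\<And>a b. a \<in> Z \<Longrightarrow> a * b \<in> Z"
    and "p \<in> foldl adjoin L fs"
  shows "subst \<sigma> p \<in> Z"
  using assms(1,2,5)
proof (induction fs arbitrary: L p)
  case (Cons f fs)
  show ?case
  proof (rule Cons.IH)
    show "subst \<sigma> p \<in> Z" if "p \<in> adjoin L f" for p
      using that Cons.prems(1,2) assms(3,4) by (auto simp: adjoin_def subst_add subst_mult)
  qed (use Cons.prems in auto)
qed simp

text \<open>A substitution that is the identity modulo \<open>L\<close> and maps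
  \<open>L\<close> to zero has kernel \<open>L\<close>. Its image lies in a domain, so
  \<open>L\<close> is prime.\<close>

lemma nonzerodivisor_mod_kernel:
  assumes L: "is_ideal L" and \<sigma>: "\<And>v. v \<in> V \<Longrightarrow> \<sigma> v \<in> C \<and> var v - \<sigma> v \<in> L"
    and kernel: "\<And>p. p \<in> L \<Longrightarrow> subst \<sigma> p = 0"
    and f: "subst \<sigma> f \<noteq> 0" and p: "p \<in> C" "f * p \<in> L"
  shows "p \<in> L"
proof -
  have "subst \<sigma> f * subst \<sigma> p = 0" using kernel[OF p(2)] by (simp add: subst_mult)
  then have "subst \<sigma> p = 0" using f by simp
  then show ?thesis using subst_congruence[OF L \<sigma> p(1)] by simp
qed

definition form :: "'v set \<Rightarrow> ('v, 'k) mpoly" where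
  "form B = (\<Sum>v\<in>B. var v)"

lemma form_closed: "B \<subseteq> V \<Longrightarrow> form B \<in> C"
  unfolding form_def by (intro sum_closed var_carrier) auto

lemma form_var_ideal: "B \<subseteq> V \<Longrightarrow> form B \<in> var_ideal"
proof -
  assume B: "B \<subseteq> V"
  have "form B = (\<Sum>v\<in>V. (if v \<in> B then 1 else 0) * x v)"
    unfolding form_def using B fin by (intro sum.mono_neutral_cong_left) auto
  then show ?thesis
    unfolding var_ideal_def by (auto intro!: exI[of _ "\<lambda>v. if v \<in> B then 1 else 0"])
qed

lemma subst_form: "subst \<sigma> (form B) = (\<Sum>v\<in>B. \<sigma> v)"
  by (simp add: form_def subst_sum subst_var)

end

section \<open>Induced subgraphs, branching and leaves\<close>

locale edge_ring = polynomial_ring V K for V :: "'v::linorder set" and K :: "'k::field itself" +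
  fixes E :: "'v \<Rightarrow> 'v \<Rightarrow> bool"
  assumes E_sym: "E u v \<Longrightarrow> E v u" and E_irrefl: "\<not> E v v"
begin

definition indep :: "'v set \<Rightarrow> bool" where
  "indep S \<longleftrightarrow> (\<forall>u\<in>S. \<forall>v\<in>S. \<not> E u v)"

definition nbhd :: "'v \<Rightarrow> 'v set" where
  "nbhd v = {u. E v u}"

lemma indep_subset: "indep S \<Longrightarrow> T \<subseteq> S \<Longrightarrow> indep T"
  by (auto simp: indep_def)

text \<open>The squarefree monomial ideal whose quotient has as basis the monomials with
  independent support inside \<open>U\<close>: the edge ideal of the subgraph induced on
  \<open>U\<close> together with the variables outside \<open>U\<close>.\<close>

definition J :: "'v set \<Rightarrow> ('v, 'k) mpoly set" where
  "J U = {p \<in> C. \<forall>t\<in>Poly_Mapping.keys p. \<not> (Poly_Mapping.keys t \<subseteq> U \<and> indep (Poly_Mapping.keys t))}"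

lemma J_ideal: "is_ideal (J U)"
proof -
  have "a - b \<in> J U" if "a \<in> J U" "b \<in> J U" for a b
  proof -
    have "Poly_Mapping.keys (a - b) \<subseteq> Poly_Mapping.keys a \<union> Poly_Mapping.keys b"
      by (auto simp: in_keys_iff lookup_minus)
    moreover have "a - b \<in> C" using that by (simp add: J_def)
    ultimately show ?thesis using that unfolding J_def by blast
  qed
  moreover have "c * a \<in> J U" if c: "c \<in> C" and a: "a \<in> J U" for c a
  proof -
    have "\<not> (Poly_Mapping.keys t \<subseteq> U \<and> indep (Poly_Mapping.keys t))"
      if tk: "t \<in> Poly_Mapping.keys (c * a)" for t
    proof -
      obtain r s where t: "t = r + s" "s \<in> Poly_Mapping.keys a"
        using tk keys_mult[of c a] by blast
      then have "Poly_Mapping.keys s \<subseteq> Poly_Mapping.keys t" by (auto simp: keys_add_nat)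
      then show ?thesis using a t(2) indep_subset unfolding J_def by blast
    qed
    then show ?thesis using c a by (simp add: J_def)
  qed
  moreover have "0 \<in> J U" "J U \<subseteq> C" by (auto simp: J_def)
  ultimately show ?thesis unfolding is_ideal_def by blast
qed

lemma keys_var_times:
  "Poly_Mapping.keys (var v * p :: ('v, 'k) mpoly) =
    (+) (Poly_Mapping.single v 1) ` Poly_Mapping.keys p"
  unfolding var_def by (rule keys_single_times) simp

lemma indep_insert: "indep (insert v S) \<longleftrightarrow> indep S \<and> S \<inter> nbhd v = {}"
  using E_sym E_irrefl by (auto simp: indep_def nbhd_def)

text \<open>A monomial \<open>x\<^sub>v t\<close> survives modulo \<open>J U\<close> exactly
  when \<open>t\<close> is supported on an independent set that avoids the neighbours of
  \<open>v\<close>. A repeated \<open>v\<close> does no harm, because supports ignore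
  multiplicities.\<close>

lemma J_colon:
  assumes "v \<in> U" "U \<subseteq> V"
  shows "J (U - nbhd v) = {p \<in> C. x v * p \<in> J U}"
proof -
  have standard: "Poly_Mapping.keys (Poly_Mapping.single v 1 + t) \<subseteq> U \<and>
      indep (Poly_Mapping.keys (Poly_Mapping.single v 1 + t)) \<longleftrightarrow>
    Poly_Mapping.keys t \<subseteq> U - nbhd v \<and> indep (Poly_Mapping.keys t)" for t :: "'v \<Rightarrow>\<^sub>0 nat"
    using assms by (auto simp: keys_add_nat indep_insert)
  have v: "v \<in> V" using assms by auto
  show ?thesis
    unfolding J_def mem_Collect_eq if_P[OF v] keys_var_times ball_simps standard
    using mult_closed[OF var_carrier[OF v]] by blast
qed

lemma J_antimono: "U' \<subseteq> U \<Longrightarrow> J U \<subseteq> J U'"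
  by (auto simp: J_def)

lemma var_J: "v \<in> V \<Longrightarrow> v \<notin> U \<Longrightarrow> var v \<in> J U"
  by (simp add: J_def var_carrier) (simp add: var_def)

lemma J_adjoin:
  assumes "v \<in> U" "U \<subseteq> V"
  shows "adjoin (J U) (x v) = J (U - {v})"
proof
  have v: "v \<in> V" using assms by auto
  show "adjoin (J U) (x v) \<subseteq> J (U - {v})"
  proof
    fix p assume "p \<in> adjoin (J U) (x v)"
    then obtain a q where p: "p = a + x v * q" "a \<in> J U" "q \<in> C" by (rule adjoinE)
    have "a \<in> J (U - {v})" using p(2) J_antimono[of "U - {v}" U] by auto
    moreover have "q * var v \<in> J (U - {v})"
      by (rule ideal_mult[OF J_ideal p(3)]) (use v var_J in auto)
    ultimately show "p \<in> J (U - {v})"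
      using p(1) v ideal_add[OF J_ideal] by (simp add: mult.commute)
  qed
  show "J (U - {v}) \<subseteq> adjoin (J U) (x v)"
  proof
    fix p assume p: "p \<in> J (U - {v})"
    define p1 where "p1 = restrict_keys {t. v \<notin> Poly_Mapping.keys t} p"
    define p2 where "p2 = restrict_keys {t. v \<in> Poly_Mapping.keys t} p"
    have "p = p1 + p2"
      by (rule poly_mapping_eqI) (simp add: p1_def p2_def lookup_add lookup_restrict_keys)
    moreover have "p1 \<in> J U"
      using p by (auto simp: p1_def J_def keys_restrict_keys carrier_poly_ring)
    moreover obtain q where q: "p2 = Poly_Mapping.single (Poly_Mapping.single v 1) 1 * q"
      "Poly_Mapping.keys q = {r. Poly_Mapping.single v 1 + r \<in> Poly_Mapping.keys p2}"
      by (rule monomial_quotient[of p2 "Poly_Mapping.single v 1"])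
        (use dvd_monomial in \<open>auto simp: p2_def keys_restrict_keys\<close>)
    moreover have "q \<in> C"
      unfolding carrier_poly_ring q(2)
    proof
      fix r assume "r \<in> {r. Poly_Mapping.single v 1 + r \<in> Poly_Mapping.keys p2}"
      then have "Poly_Mapping.keys (Poly_Mapping.single v 1 + r) \<subseteq> V"
        using p by (auto simp: p2_def keys_restrict_keys J_def carrier_poly_ring)
      then show "Poly_Mapping.keys r \<subseteq> V" by (simp add: keys_add_nat)
    qed
    ultimately show "p \<in> adjoin (J U) (x v)"
      using v adjoinI[of p1 "J U" q "x v"] by (simp add: var_def)
  qed
qed

text \<open>Repeated use of \<open>J_colon\<close> and \<open>J_adjoin\<close> reduces
  \<open>S/J U\<close> to polynomial rings \<open>K[U']\<close> for independent sets
  \<open>U'\<close>; the predicate says that this can be done with \<open>P\<close> holding at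
  every leaf.\<close>

inductive resolvable :: "('v set \<Rightarrow> bool) \<Rightarrow> 'v set \<Rightarrow> bool" for P where
  leaf: "indep U \<Longrightarrow> P U \<Longrightarrow> resolvable P U"
| branch: "v \<in> U \<Longrightarrow> resolvable P (U - nbhd v) \<Longrightarrow> resolvable P (U - {v}) \<Longrightarrow> resolvable P U"

lemma resolvable_mono: "resolvable P U \<Longrightarrow> (\<And>U. P U \<Longrightarrow> Q U) \<Longrightarrow> resolvable Q U"
  by (induction rule: resolvable.induct) (auto intro: resolvable.intros)

lemma resolvable_weakly_regular:
  assumes "resolvable P U" "U \<subseteq> V" "set fs \<subseteq> C"
    and "\<And>U. U \<subseteq> V \<Longrightarrow> indep U \<Longrightarrow> P U \<Longrightarrow> weakly_regular (J U) fs"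
  shows "weakly_regular (J U) fs"
  using assms(1,2)
proof (induction rule: resolvable.induct)
  case (leaf U)
  then show ?case using assms(4) by blast
next
  case (branch v U)
  show ?case
  proof (rule weakly_regular_colon_adjoin[OF J_ideal x_closed assms(3)])
    show "J (U - nbhd v) = {p \<in> C. x v * p \<in> J U}" using branch J_colon by blast
    show "weakly_regular (J (U - nbhd v)) fs" using branch by blast
    show "weakly_regular (adjoin (J U) (x v)) fs" using J_adjoin branch by auto
  qed
qed

text \<open>A vertex \<open>a \<in> U\<close> whose closed neighbourhood in \<open>U\<close>
  lies in \<open>T i\<close> guards \<open>T i\<close>. Branching only on vertices that are not
  guards and have a neighbour left keeps every \<open>T i\<close> guarded: deleting the vertex
  \<open>v\<close> leaves the guards alone, and if deleting the neighbours of \<open>v\<close>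
  removes the guard of \<open>T i\<close>, then \<open>v\<close> lies in \<open>T i\<close>, has
  become isolated and is the new guard. When the branching stops, the set is independent,
  because two adjacent guards would lie in each other's sets, which are disjoint; and every
  \<open>T i\<close> still contains its guard.\<close>

lemma resolvable_guards:
  assumes "finite U"
    and "\<And>i j. i \<in> I \<Longrightarrow> j \<in> I \<Longrightarrow> i \<noteq> j \<Longrightarrow> T i \<inter> T j = {}"
    and "\<And>i. i \<in> I \<Longrightarrow> \<exists>a\<in>U. insert a (nbhd a \<inter> U) \<subseteq> T i"
  shows "resolvable (\<lambda>U'. U' \<subseteq> U \<and> (\<forall>i\<in>I. U' \<inter> T i \<noteq> {})) U"
proof -
  have "resolvable (\<lambda>U'. U' \<subseteq> U \<and> (\<forall>i\<in>I. U' \<inter> T i \<noteq> {})) W"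
    if "W \<subseteq> U" "\<And>i. i \<in> I \<Longrightarrow> \<exists>a\<in>W. insert a (nbhd a \<inter> W) \<subseteq> T i" for W
    using finite_subset[OF that(1) assms(1)] that
  proof (induction "card W + card {(u, v) \<in> W \<times> W. E u v}" arbitrary: W rule: less_induct)
    case less
    obtain a where a: "\<And>i. i \<in> I \<Longrightarrow> a i \<in> W \<and> insert (a i) (nbhd (a i) \<inter> W) \<subseteq> T i"
      using less.prems(3) by metis
    show ?case
    proof (cases "\<exists>v\<in>W. v \<notin> a ` I \<and> nbhd v \<inter> W \<noteq> {}")
      case False
      have "indep W"
      proof (rule ccontr)
        assume "\<not> indep W"
        then obtain u v where uv: "u \<in> W" "v \<in> W" "E u v" by (auto simp: indep_def)
        then have "v \<in> nbhd u \<inter> W" "u \<in> nbhd v \<inter> W" using E_sym by (auto simp: nbhd_def)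
        then have "u \<in> a ` I" "v \<in> a ` I" using False uv by blast+
        then obtain i j where ij: "u = a i" "v = a j" "i \<in> I" "j \<in> I" by auto
        have "v \<in> T i" "v \<in> T j" using a[OF ij(3)] a[OF ij(4)] ij uv by (auto simp: nbhd_def)
        then have "i = j" using assms(2) ij by blast
        then show False using ij uv E_irrefl by simp
      qed
      then show ?thesis using a less.prems(2) by (intro leaf) auto
    next
      case True
      then obtain v where v: "v \<in> W" "v \<notin> a ` I" "nbhd v \<inter> W \<noteq> {}" by auto
      let ?e = "\<lambda>W. {(u, v) \<in> W \<times> W. E u v}"
      have smaller: "card W' + card (?e W') < card W + card (?e W)" if "W' \<subset> W" for W'
      proof -
        have "card W' < card W" using that less.prems(1) by (rule psubset_card_mono[rotated])
        moreover have "card (?e W') \<le> card (?e W)"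
          using that less.prems(1) by (intro card_mono finite_subset[of "?e W" "W \<times> W"]) auto
        ultimately show ?thesis by simp
      qed
      have v': "v \<notin> nbhd v" using E_irrefl by (simp add: nbhd_def)
      show ?thesis
      proof (rule branch[OF v(1)])
        show "resolvable (\<lambda>U'. U' \<subseteq> U \<and> (\<forall>i\<in>I. U' \<inter> T i \<noteq> {})) (W - nbhd v)"
        proof (rule less.hyps[OF smaller])
          show "\<exists>b\<in>W - nbhd v. insert b (nbhd b \<inter> (W - nbhd v)) \<subseteq> T i" if i: "i \<in> I" for i
          proof (cases "E v (a i)")
            case True
            then have "v \<in> T i" using a[OF i] E_sym v(1) by (auto simp: nbhd_def)
            then show ?thesis using v(1) v' by (intro bexI[of _ v]) auto
          next
            case False
            then show ?thesis using a[OF i] by (intro bexI[of _ "a i"]) (auto simp: nbhd_def)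
          qed
        qed (use v less.prems in auto)
        show "resolvable (\<lambda>U'. U' \<subseteq> U \<and> (\<forall>i\<in>I. U' \<inter> T i \<noteq> {})) (W - {v})"
        proof (rule less.hyps[OF smaller])
          show "\<exists>b\<in>W - {v}. insert b (nbhd b \<inter> (W - {v})) \<subseteq> T i" if i: "i \<in> I" for i
            using a[OF i] v(2) i by (intro bexI[of _ "a i"]) auto
        qed (use v less.prems in auto)
      qed
    qed
  qed
  then show ?thesis using assms(3) by blast
qed

subsection \<open>Linear forms on a leaf\<close>

lemma sum_var_lookup:
  assumes "finite X"
  shows "Poly_Mapping.lookup (\<Sum>w\<in>X. var w :: ('v, 'k) mpoly) (Poly_Mapping.single z 1) =
    (if z \<in> X then 1 else 0)"
proof -
  have "Poly_Mapping.lookup (var w :: ('v, 'k) mpoly) (Poly_Mapping.single z 1) =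
      (if w = z then 1 else 0)" for w
    by (auto simp: var_def lookup_single when_def dest: arg_cong[where f = Poly_Mapping.keys])
  then show ?thesis using assms by (simp add: lookup_sum)
qed

text \<open>Modulo the forms of the disjoint sets \<open>B j\<close>, each pivot \<open>u
  j\<close> can be eliminated: it is replaced by minus the sum of the other variables of
  \<open>B j\<close> in \<open>U\<close>. The substitution \<open>\<sigma>\<close> does this and
  sends the variables outside \<open>U\<close> to zero, so the ideal is its kernel. The
  conditions on \<open>z\<close> say that the variable \<open>z\<close> has coefficient
  \<open>1\<close> in the image of \<open>form D\<close>: no pivot that occurs in
  \<open>D\<close> is replaced by an expression in which \<open>z\<close> occurs.\<close>

lemma leaf_nonzerodivisor:
  assumes U: "indep U" "U \<subseteq> V"
    and B: "\<And>j. j < m \<Longrightarrow> B j \<subseteq> V" and u: "\<And>j. j < m \<Longrightarrow> u j \<in> B j \<inter> U"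
    and disj: "\<And>i j. i < m \<Longrightarrow> j < m \<Longrightarrow> i \<noteq> j \<Longrightarrow> B i \<inter> B j = {}"
    and D: "D \<subseteq> V" and z: "z \<in> U \<inter> D" "z \<notin> u ` {..<m}"
    and zB: "\<And>j. j < m \<Longrightarrow> u j \<in> D \<Longrightarrow> z \<notin> B j"
    and p: "p \<in> C" "form D * p \<in> foldl adjoin (J U) (map (\<lambda>j. form (B j)) [0..<m])"
  shows "p \<in> foldl adjoin (J U) (map (\<lambda>j. form (B j)) [0..<m])"
proof -
  define L where "L = foldl adjoin (J U) (map (\<lambda>j. form (B j)) [0..<m])"
  have fs: "set (map (\<lambda>j. form (B j)) [0..<m]) \<subseteq> C" using B form_closed by auto
  have L: "is_ideal L" unfolding L_def by (rule foldl_adjoin_ideal[OF J_ideal fs])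
  define \<sigma> :: "'v \<Rightarrow> ('v, 'k) mpoly" where "\<sigma> = (\<lambda>v. if v \<notin> U then 0
    else if v \<in> u ` {..<m} then - (\<Sum>w\<in>B (inv_into {..<m} u v) \<inter> U - {v}. var w) else var v)"
  have inj: "inj_on u {..<m}" using u disj by (fastforce simp: inj_on_def)
  have \<sigma>_out: "\<sigma> v = 0" if "v \<notin> U" for v using that by (simp add: \<sigma>_def)
  have \<sigma>_pivot: "\<sigma> (u j) = - (\<Sum>w\<in>B j \<inter> U - {u j}. var w)" if "j < m" for j
    using that u[OF that] inj by (simp add: \<sigma>_def)
  have \<sigma>_id: "\<sigma> v = var v" if "v \<in> U" "v \<notin> u ` {..<m}" for v using that by (simp add: \<sigma>_def)
  have finB: "finite (B j)" if "j < m" for j using B[OF that] fin finite_subset by blast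
  have split_B: "(\<Sum>v\<in>B j. f v) = f (u j) + (\<Sum>v\<in>B j \<inter> U - {u j}. f v) + (\<Sum>v\<in>B j - U. f v)"
    if "j < m" for f :: "'v \<Rightarrow> ('v, 'k) mpoly" and j
  proof -
    have "(\<Sum>v\<in>B j. f v) = (\<Sum>v\<in>B j \<inter> U. f v) + (\<Sum>v\<in>B j - U. f v)"
      using finB[OF that] by (subst sum.union_disjoint[symmetric]) (auto intro: sum.cong)
    then show ?thesis
      using finB[OF that] u[OF that] by (simp add: sum.remove[of "B j \<inter> U" "u j"])
  qed
  have pivot_J: "var (u j) - \<sigma> (u j) \<in> L" if j: "j < m" for j
  proof -
    have "form (B j) \<in> L"
      unfolding L_def using j by (intro foldl_adjoin_member[OF J_ideal fs]) auto
    moreover have "(\<Sum>v\<in>B j - U. var v) \<in> L"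
      unfolding L_def using B[OF j]
      by (intro foldl_adjoin_superset ideal_sum[OF J_ideal] var_J) auto
    ultimately have "form (B j) - (\<Sum>v\<in>B j - U. var v) \<in> L" by (rule ideal_diff[OF L])
    then show ?thesis by (simp add: form_def split_B[OF j] \<sigma>_pivot[OF j])
  qed
  have "p \<in> L"
  proof (rule nonzerodivisor_mod_kernel[OF L _ _ _ p(1), of \<sigma> "form D"])
    show "form D * p \<in> L" using p(2) by (simp add: L_def)
    show "\<sigma> v \<in> C \<and> var v - \<sigma> v \<in> L" if v: "v \<in> V" for v
    proof (cases "v \<in> U")
      case False
      then show ?thesis
        using v var_J[OF v False] foldl_adjoin_superset by (simp add: \<sigma>_out L_def)
    next
      case True
      show ?thesis
      proof (cases "v \<in> u ` {..<m}")
        case False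
        then show ?thesis using True v var_carrier ideal_zero[OF L] by (simp add: \<sigma>_id)
      next
        case piv: True
        then obtain j where j: "v = u j" "j < m" by auto
        have "\<sigma> (u j) \<in> C"
          unfolding \<sigma>_pivot[OF j(2)] using B[OF j(2)]
          by (intro uminus_closed sum_closed var_carrier) auto
        then show ?thesis using pivot_J j by simp
      qed
    qed
    show "subst \<sigma> q = 0" if q: "q \<in> L" for q
    proof -
      have "subst \<sigma> q \<in> {0}"
      proof (rule subst_foldl_adjoin[of "J U" \<sigma> "{0}"])
        show "q \<in> foldl adjoin (J U) (map (\<lambda>j. form (B j)) [0..<m])" using q by (simp add: L_def)
        show "subst \<sigma> r \<in> {0}" if r: "r \<in> J U" for r
        proof -
          have "monomial_value \<sigma> t = 0" if t: "t \<in> Poly_Mapping.keys r" for t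
          proof -
            obtain v where v: "v \<in> Poly_Mapping.keys t" "v \<notin> U"
              using r t U(1) indep_subset unfolding J_def by blast
            then show ?thesis
              unfolding monomial_value_def
              by (intro prod_zero bexI[of _ v]) (auto simp: \<sigma>_out in_keys_iff)
          qed
          then show ?thesis by (simp add: subst_def)
        qed
        show "subst \<sigma> f \<in> {0}" if f: "f \<in> set (map (\<lambda>j. form (B j)) [0..<m])" for f
        proof -
          obtain j where j: "f = form (B j)" "j < m" using f by auto
          have "\<sigma> v = var v" if v: "v \<in> B j \<inter> U - {u j}" for v
          proof (rule \<sigma>_id)
            show "v \<notin> u ` {..<m}" using v u disj j(2) by (metis DiffE IntE disjoint_iff imageE
                insertI1 lessThan_iff)
          qed (use v in auto)
          then show ?thesis
            by (simp add: j(1) subst_form split_B[OF j(2)] \<sigma>_pivot[OF j(2)] \<sigma>_out)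
        qed
      qed auto
      then show ?thesis by simp
    qed
    show "subst \<sigma> (form D) \<noteq> 0"
    proof -
      have "Poly_Mapping.lookup (\<sigma> v) (Poly_Mapping.single z 1) = (if v = z then 1 else 0)"
        if v: "v \<in> D" for v
      proof -
        consider "v \<notin> U" | "v \<in> U" "v \<notin> u ` {..<m}" | j where "v = u j" "j < m" by auto
        then show ?thesis
        proof cases
          case 1
          then show ?thesis using z by (auto simp: \<sigma>_out)
        next
          case 2
          then show ?thesis using sum_var_lookup[of "{v}" z] by (auto simp: \<sigma>_id)
        next
          case 3
          have "z \<notin> B j" using zB[OF 3(2)] v 3 by auto
          then show ?thesis
            using 3 z finB[OF 3(2)] by (auto simp: \<sigma>_pivot[OF 3(2)] sum_var_lookup simp del: One_nat_def)
        qed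
      qed
      then have "Poly_Mapping.lookup (subst \<sigma> (form D)) (Poly_Mapping.single z 1) = (1::'k)"
        using z D fin finite_subset[OF D fin] by (simp add: subst_form lookup_sum)
      then show ?thesis by auto
    qed
  qed
  then show ?thesis by (simp add: L_def)
qed

lemma leaf_weakly_regular:
  assumes U: "indep U" "U \<subseteq> V"
    and B: "\<And>j. j < m \<Longrightarrow> B j \<subseteq> V" and u: "\<And>j. j < m \<Longrightarrow> u j \<in> B j \<inter> U"
    and disj: "\<And>i j. i < m \<Longrightarrow> j < m \<Longrightarrow> i \<noteq> j \<Longrightarrow> B i \<inter> B j = {}"
  shows "weakly_regular (J U) (map (\<lambda>j. form (B j)) [0..<m])"
  using B u disj
proof (induction m)
  case (Suc m)
  have "p \<in> foldl adjoin (J U) (map (\<lambda>j. form (B j)) [0..<m])"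
    if p: "p \<in> C" "form (B m) * p \<in> foldl adjoin (J U) (map (\<lambda>j. form (B j)) [0..<m])" for p
  proof (rule leaf_nonzerodivisor[OF U _ _ _ _ _ _ _ p, where u = u and z = "u m"])
    show "u m \<notin> u ` {..<m}"
    proof
      assume "u m \<in> u ` {..<m}"
      then obtain j where "u m = u j" "j < m" by auto
      then show False using Suc.prems(2)[of m] Suc.prems(2)[of j] Suc.prems(3)[of j m] by auto
    qed
    show "u m \<notin> B j" if "j < m" for j
      using that Suc.prems(2)[of m] Suc.prems(3)[of j m] by auto
  qed (use Suc.prems less_Suc_eq in auto)
  moreover have "weakly_regular (J U) (map (\<lambda>j. form (B j)) [0..<m])"
    using Suc.prems by (intro Suc.IH) auto
  ultimately show ?case by (simp add: weakly_regular_append)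
qed simp

end

section \<open>Depth of a residue class ring\<close>

context subring_of
begin

lemma foldl_adjoin_iff:
  assumes L: "is_ideal L" and fs: "set fs \<subseteq> C"
  shows "p \<in> foldl adjoin L fs \<longleftrightarrow>
    (\<exists>a\<in>L. \<exists>q. (\<forall>i. q i \<in> C) \<and> p = a + (\<Sum>i<length fs. fs ! i * q i))"
  using fs
proof (induction fs arbitrary: p rule: rev_induct)
  case Nil
  then show ?case by (auto intro: exI[of _ "\<lambda>_. 0"])
next
  case (snoc f fs)
  have nth: "(\<Sum>i<length (fs @ [f]). (fs @ [f]) ! i * q i) =
      (\<Sum>i<length fs. fs ! i * q i) + f * q (length fs)" for q
    by (simp add: nth_append)
  show ?case
  proof
    assume "p \<in> foldl adjoin L (fs @ [f])"
    then obtain b r where p: "p = b + f * r" "b \<in> foldl adjoin L fs" "r \<in> C"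
      by (auto elim: adjoinE)
    then obtain a q where q: "a \<in> L" "\<forall>i. q i \<in> C" "b = a + (\<Sum>i<length fs. fs ! i * q i)"
      using snoc by auto
    show "\<exists>a\<in>L. \<exists>q. (\<forall>i. q i \<in> C) \<and> p = a + (\<Sum>i<length (fs @ [f]). (fs @ [f]) ! i * q i)"
      unfolding nth using p q
      by (intro bexI[of _ a] exI[of _ "q(length fs := r)"]) (auto simp: add.assoc)
  next
    assume "\<exists>a\<in>L. \<exists>q. (\<forall>i. q i \<in> C) \<and> p = a + (\<Sum>i<length (fs @ [f]). (fs @ [f]) ! i * q i)"
    then obtain a q where q: "a \<in> L" "\<forall>i. q i \<in> C"
      "p = (a + (\<Sum>i<length fs. fs ! i * q i)) + f * q (length fs)"
      unfolding nth by (auto simp: add.assoc)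
    have "a + (\<Sum>i<length fs. fs ! i * q i) \<in> foldl adjoin L fs" using snoc q by auto
    then show "p \<in> foldl adjoin L (fs @ [f])" using q(2,3) adjoinI by simp
  qed
qed

end

context polynomial_ring
begin

abbreviation R :: "('v, 'k) mpoly ring" where "R \<equiv> poly_ring V"

lemma R_ops:
  "a \<otimes>\<^bsub>R\<^esub> b = a * b" "a \<oplus>\<^bsub>R\<^esub> b = a + b" "\<zero>\<^bsub>R\<^esub> = 0"
  by (simp_all add: poly_ring_def)

lemma ideal_iff: "ideal L R \<longleftrightarrow> is_ideal L"
proof -
  interpret R: cring R by (rule cring_poly_ring)
  have neg: "\<ominus>\<^bsub>R\<^esub> a = - a" if "a \<in> C" for a
    using that by (intro R.minus_equality) (auto simp: R_ops)
  show ?thesis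
  proof
    assume "ideal L R"
    then interpret ideal L R .
    have sub: "L \<subseteq> C" using Icarr by blast
    moreover have "0 \<in> L" using zero_closed by (simp add: R_ops)
    moreover have "a - b \<in> L" if "a \<in> L" "b \<in> L" for a b
      using a_closed[OF that(1) a_inv_closed[OF that(2)]] that sub neg[of b] by (auto simp: R_ops)
    moreover have "c * a \<in> L" if "c \<in> C" "a \<in> L" for c a
      using I_l_closed[OF that(2,1)] by (simp add: R_ops)
    ultimately show "is_ideal L" unfolding is_ideal_def by blast
  next
    assume L: "is_ideal L"
    show "ideal L R"
    proof (rule idealI)
      show "ring R" by (rule R.ring_axioms)
      show "subgroup L (add_monoid R)"
      proof (rule R.add.subgroupI)
        show "L \<subseteq> C" using ideal_subset[OF L] by auto
        show "L \<noteq> {}" using ideal_zero[OF L] by auto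
        show "\<ominus>\<^bsub>R\<^esub> a \<in> L" if "a \<in> L" for a
          using that neg[of a] ideal_subset[OF L that] ideal_uminus[OF L that]
          by simp
        show "a \<oplus>\<^bsub>R\<^esub> b \<in> L" if "a \<in> L" "b \<in> L" for a b
          using ideal_add[OF L that] by (simp add: R_ops)
      qed
      show "c \<otimes>\<^bsub>R\<^esub> a \<in> L" "a \<otimes>\<^bsub>R\<^esub> c \<in> L" if "a \<in> L" "c \<in> C" for a c
        using ideal_mult[OF L that(2,1)] by (simp_all add: R_ops mult.commute)
    qed
  qed
qed

lemma var_ideal_is_ideal: "is_ideal var_ideal"
proof -
  have "var_ideal \<subseteq> C" by (rule var_ideal_closed)
  moreover have "0 \<in> var_ideal"
    unfolding var_ideal_def by (auto intro!: exI[of _ "\<lambda>_. 0"])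
  moreover have "p - q \<in> var_ideal" if "p \<in> var_ideal" "q \<in> var_ideal" for p q
  proof -
    obtain a b where "p = (\<Sum>v\<in>V. a v * x v)" "q = (\<Sum>v\<in>V. b v * x v)"
      "\<forall>v. a v \<in> C" "\<forall>v. b v \<in> C"
      using \<open>p \<in> var_ideal\<close> \<open>q \<in> var_ideal\<close> unfolding var_ideal_def by blast
    then have "p - q = (\<Sum>v\<in>V. (a v - b v) * x v)"
      by (simp only: sum_subtractf left_diff_distrib)
    moreover have "\<forall>v. a v - b v \<in> C"
      using \<open>\<forall>v. a v \<in> C\<close> \<open>\<forall>v. b v \<in> C\<close> by simp
    ultimately show ?thesis
      unfolding var_ideal_def by (intro CollectI exI[of _ "\<lambda>v. a v - b v"] conjI)
  qed
  moreover have "c * p \<in> var_ideal" if c: "c \<in> C" and p: "p \<in> var_ideal" for c p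
  proof -
    obtain a where a: "p = (\<Sum>v\<in>V. a v * x v)" "\<forall>v. a v \<in> C"
      using p unfolding var_ideal_def by blast
    have "c * p = (\<Sum>v\<in>V. (c * a v) * x v)"
      unfolding a(1) sum_distrib_left by (simp only: mult.assoc)
    moreover have "\<forall>v. c * a v \<in> C" using a(2) c by simp
    ultimately show ?thesis
      unfolding var_ideal_def by (intro CollectI exI[of _ "\<lambda>v. c * a v"] conjI)
  qed
  ultimately show ?thesis unfolding is_ideal_def by blast
qed

lemma max_graded_ideal_eq: "max_graded_ideal V = var_ideal"
proof -
  interpret R: cring R by (rule cring_poly_ring)
  have gen: "var ` V \<subseteq> C" using var_carrier by auto
  have "is_ideal (Idl\<^bsub>R\<^esub> (var ` V))" using R.genideal_ideal[OF gen] ideal_iff by simp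
  note idl = this
  show ?thesis
    unfolding max_graded_ideal_def
  proof
    have "var v \<in> var_ideal" if "v \<in> V" for v
      using form_var_ideal[of "{v}"] that by (simp add: form_def)
    then show "Idl\<^bsub>R\<^esub> (var ` V) \<subseteq> var_ideal"
      using var_ideal_is_ideal by (intro R.genideal_minimal) (auto simp: ideal_iff)
    show "var_ideal \<subseteq> Idl\<^bsub>R\<^esub> (var ` V)"
    proof
      fix p assume "p \<in> var_ideal"
      then obtain a where a: "p = (\<Sum>v\<in>V. a v * x v)" "\<forall>v. a v \<in> C"
        unfolding var_ideal_def by blast
      have "a v * x v \<in> Idl\<^bsub>R\<^esub> (var ` V)" if "v \<in> V" for v
        using R.genideal_self[OF gen] that a(2) by (intro ideal_mult[OF idl]) auto
      then show "p \<in> Idl\<^bsub>R\<^esub> (var ` V)" unfolding a(1) by (rule ideal_sum[OF idl])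
    qed
  qed
qed

end

locale poly_quotient = polynomial_ring V K for V :: "'v::linorder set" and K :: "'k::field itself" +
  fixes I :: "('v, 'k) mpoly set"
  assumes I: "is_ideal I"
begin

abbreviation residue :: "('v, 'k) mpoly \<Rightarrow> ('v, 'k) mpoly set" where "residue p \<equiv> I +>\<^bsub>R\<^esub> p"

abbreviation M :: "(('v, 'k) mpoly, ('v, 'k) mpoly set) module" where "M \<equiv> quot_module R I"

lemma residue_eq: "residue p = residue q \<longleftrightarrow> p - q \<in> I"
proof -
  have residue: "residue p = (\<lambda>a. a + p) ` I" for p
    by (auto simp: a_r_coset_def' poly_ring_def)
  show ?thesis
  proof
    assume "residue p = residue q"
    moreover have "p \<in> residue p" unfolding residue using ideal_zero[OF I] by force
    ultimately have "p \<in> (\<lambda>a. a + q) ` I" by (simp add: residue)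
    then show "p - q \<in> I" by auto
  next
    assume pq: "p - q \<in> I"
    have "residue p \<subseteq> residue q" if "p - q \<in> I" for p q
    proof
      fix s assume "s \<in> residue p"
      then obtain a where a: "s = a + p" "a \<in> I" by (auto simp: residue)
      have "s = (a + (p - q)) + q" by (simp add: a(1))
      then show "s \<in> residue q" unfolding residue using ideal_add[OF I a(2) that] by blast
    qed
    from this[OF pq] this[of q p] pq ideal_uminus[OF I pq] show "residue p = residue q" by simp
  qed
qed

lemma carrier_M: "carrier M = residue ` C"
  by (auto simp: quot_module_def FactRing_def A_RCOSETS_def')

lemma
  assumes "p \<in> C" "q \<in> C"
  shows add_M: "residue p \<oplus>\<^bsub>M\<^esub> residue q = residue (p + q)"
    and smult_M: "p \<odot>\<^bsub>M\<^esub> residue q = residue (p * q)"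
proof -
  interpret R: cring R by (rule cring_poly_ring)
  interpret I: ideal I R using I by (simp add: ideal_iff)
  interpret h: ring_hom_ring R "R Quot I" "(+>\<^bsub>R\<^esub>) I" by (rule I.rcos_ring_hom_ring)
  show "residue p \<oplus>\<^bsub>M\<^esub> residue q = residue (p + q)"
    using h.hom_add[OF assms] unfolding R_ops by (simp add: quot_module_def)
  show "p \<odot>\<^bsub>M\<^esub> residue q = residue (p * q)"
    using h.hom_mult[OF assms] unfolding R_ops by (simp add: quot_module_def)
qed

lemma zero_M: "\<zero>\<^bsub>M\<^esub> = residue 0"
proof -
  interpret R: cring R by (rule cring_poly_ring)
  interpret I: ideal I R using I by (simp add: ideal_iff)
  interpret h: ring_hom_ring R "R Quot I" "(+>\<^bsub>R\<^esub>) I" by (rule I.rcos_ring_hom_ring)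
  show ?thesis using h.hom_zero unfolding R_ops by (simp add: quot_module_def)
qed

lemma finsum_M:
  assumes "finite X" "\<And>i. i \<in> X \<Longrightarrow> p i \<in> C" "\<And>i. i \<in> X \<Longrightarrow> y i = residue (p i)"
  shows "(\<Oplus>\<^bsub>M\<^esub>i\<in>X. y i) = residue (\<Sum>i\<in>X. p i)"
proof -
  interpret M: module R M
    by (rule module_quot_module[OF cring_poly_ring]) (use I ideal_iff in auto)
  show ?thesis
    using assms
  proof (induction X rule: finite_induct)
    case empty
    then show ?case using zero_M by simp
  next
    case (insert i X)
    have "y \<in> X \<rightarrow> carrier M" "y i \<in> carrier M" using insert by (auto simp: carrier_M)
    then show ?case
      using insert by (simp add: M.finsum_insert add_M sum_closed)
  qed
qed

text \<open>The image of the ideal generated by \<open>I\<close> and \<open>fs\<close> in the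
  residue class module.\<close>

lemma mult_submodule_M:
  assumes fs: "set fs \<subseteq> C"
  shows "mult_submodule M fs = residue ` foldl adjoin I fs"
proof -
  have nth: "fs ! i \<in> C" if "i < length fs" for i using fs that by auto
  have sum: "(\<Oplus>\<^bsub>M\<^esub>i\<in>{..<length fs}. (fs ! i) \<odot>\<^bsub>M\<^esub> y i) = residue (\<Sum>i<length fs. fs ! i * q i)"
    if "\<And>i. i < length fs \<Longrightarrow> q i \<in> C \<and> y i = residue (q i)" for y q
    by (rule finsum_M) (use that nth smult_M in auto)
  show ?thesis
  proof
    show "mult_submodule M fs \<subseteq> residue ` foldl adjoin I fs"
    proof
      fix m assume "m \<in> mult_submodule M fs"
      then obtain y where y: "y \<in> {..<length fs} \<rightarrow> carrier M"
        "m = (\<Oplus>\<^bsub>M\<^esub>i\<in>{..<length fs}. (fs ! i) \<odot>\<^bsub>M\<^esub> y i)"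
        by (auto simp: mult_submodule_def)
      have "\<exists>q. q \<in> C \<and> (i < length fs \<longrightarrow> y i = residue q)" for i
      proof (cases "i < length fs")
        case True
        then have "y i \<in> residue ` C" using y(1) by (auto simp: carrier_M)
        then show ?thesis by blast
      qed (use zero_closed in blast)
      then obtain q where q: "\<And>i. q i \<in> C" "\<And>i. i < length fs \<Longrightarrow> y i = residue (q i)" by metis
      have "(\<Sum>i<length fs. fs ! i * q i) \<in> foldl adjoin I fs"
        unfolding foldl_adjoin_iff[OF I fs] using q ideal_zero[OF I]
        by (intro bexI[of _ 0] exI[of _ q]) auto
      then show "m \<in> residue ` foldl adjoin I fs" using y(2) sum[of q y] q by auto
    qed
    show "residue ` foldl adjoin I fs \<subseteq> mult_submodule M fs"
    proof
      fix m assume "m \<in> residue ` foldl adjoin I fs"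
      then obtain a q where q: "a \<in> I" "\<And>i. q i \<in> C"
        "m = residue (a + (\<Sum>i<length fs. fs ! i * q i))"
        unfolding image_iff Bex_def foldl_adjoin_iff[OF I fs] by blast
      have "m = residue (\<Sum>i<length fs. fs ! i * q i)" using q by (simp add: residue_eq)
      also have "\<dots> = (\<Oplus>\<^bsub>M\<^esub>i\<in>{..<length fs}. (fs ! i) \<odot>\<^bsub>M\<^esub> residue (q i))"
        using q by (intro sum[symmetric]) auto
      finally show "m \<in> mult_submodule M fs"
        unfolding mult_submodule_def using q(2) carrier_M
        by (intro CollectI exI[of _ "\<lambda>i. residue (q i)"]) auto
    qed
  qed
qed

lemma residue_in_mult_submodule:
  assumes fs: "set fs \<subseteq> C"
  shows "residue p \<in> mult_submodule M fs \<longleftrightarrow> p \<in> foldl adjoin I fs"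
proof
  assume "residue p \<in> mult_submodule M fs"
  then obtain q where q: "q \<in> foldl adjoin I fs" "p - q \<in> I"
    unfolding mult_submodule_M[OF fs] by (auto simp: residue_eq)
  then show "p \<in> foldl adjoin I fs"
    using ideal_add[OF foldl_adjoin_ideal[OF I fs] q(1) foldl_adjoin_superset[OF q(2)]] by simp
qed (simp add: mult_submodule_M[OF fs])

lemma regular_sequence_M:
  "regular_sequence R M fs \<longleftrightarrow> set fs \<subseteq> C \<and> weakly_regular I fs \<and> foldl adjoin I fs \<noteq> C"
proof (cases "set fs \<subseteq> C")
  case True
  have sub: "set (take i fs) \<subseteq> C" for i using True set_take_subset by fastforce
  have "(\<forall>m\<in>carrier M. (fs ! i) \<odot>\<^bsub>M\<^esub> m \<in> mult_submodule M (take i fs) \<longrightarrow>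
      m \<in> mult_submodule M (take i fs)) \<longleftrightarrow>
    (\<forall>p\<in>C. fs ! i * p \<in> foldl adjoin I (take i fs) \<longrightarrow> p \<in> foldl adjoin I (take i fs))"
    if "i < length fs" for i
  proof -
    have "fs ! i \<in> C" using True that by auto
    then have "(fs ! i) \<odot>\<^bsub>M\<^esub> residue p \<in> mult_submodule M (take i fs) \<longleftrightarrow>
        fs ! i * p \<in> foldl adjoin I (take i fs)" if "p \<in> C" for p
      using that by (simp add: smult_M residue_in_mult_submodule[OF sub])
    then show ?thesis by (simp add: carrier_M residue_in_mult_submodule[OF sub])
  qed
  moreover have "mult_submodule M fs = carrier M \<longleftrightarrow> foldl adjoin I fs = C"
  proof
    assume eq: "mult_submodule M fs = carrier M"
    have "p \<in> foldl adjoin I fs" if "p \<in> C" for p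
      using that residue_in_mult_submodule[OF True, of p] eq by (auto simp: carrier_M)
    then show "foldl adjoin I fs = C" using ideal_subset[OF foldl_adjoin_ideal[OF I True]] by blast
  qed (simp add: mult_submodule_M[OF True] carrier_M)
  ultimately show ?thesis
    unfolding regular_sequence_def weakly_regular_iff_nth by auto
qed (simp add: regular_sequence_def)

theorem depth_quot_eq:
  assumes "set fs \<subseteq> var_ideal" "weakly_regular I fs"
    and w: "w \<in> C" "w \<notin> foldl adjoin I fs" "\<And>v. v \<in> V \<Longrightarrow> var v * w \<in> foldl adjoin I fs"
  shows "depth_quot V I = enat (length fs)"
proof -
  have fs: "set fs \<subseteq> C" using assms(1) var_ideal_closed by auto
  have "x v * w \<in> foldl adjoin I fs" for v
    using w(3) ideal_zero[OF foldl_adjoin_ideal[OF I fs]] by auto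
  then have "length gs \<le> length fs" if "set gs \<subseteq> var_ideal" "regular_sequence R M gs" for gs
    using that weakly_regular_length_le[OF I assms(1,2) w(1,2)] by (auto simp: regular_sequence_M)
  moreover have "regular_sequence R M fs"
    using fs assms by (auto simp: regular_sequence_M)
  ultimately show ?thesis
    unfolding depth_def max_graded_ideal_eq using assms(1)
    by (intro antisym Sup_least Sup_upper) auto
qed

end

context edge_ring
begin

text \<open>To see that \<open>w\<close> lies outside an ideal, it suffices to map it by a
  substitution to a polynomial with a squarefree monomial, while the ideal goes to the set of
  polynomials all of whose monomials have a repeated variable.\<close>

definition nonsquarefree :: "('v, 'k) mpoly set" where
  "nonsquarefree = {p. \<forall>t\<in>Poly_Mapping.keys p. \<exists>v. 2 \<le> Poly_Mapping.lookup t v}"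

lemma nonsquarefree_add: "p \<in> nonsquarefree \<Longrightarrow> q \<in> nonsquarefree \<Longrightarrow> p + q \<in> nonsquarefree"
  using keys_add[of p q] by (auto simp: nonsquarefree_def)

lemma nonsquarefree_mult: assumes "p \<in> nonsquarefree" shows "p * q \<in> nonsquarefree"
proof -
  have "\<exists>v. 2 \<le> Poly_Mapping.lookup t v" if t: "t \<in> Poly_Mapping.keys (p * q)" for t
  proof -
    obtain r s where "t = r + s" "r \<in> Poly_Mapping.keys p" using t keys_mult[of p q] by blast
    then show ?thesis using assms by (force simp: nonsquarefree_def lookup_add intro: trans_le_add1)
  qed
  then show ?thesis by (simp add: nonsquarefree_def)
qed

lemma subst_J_nonsquarefree:
  assumes \<psi>: "\<And>u v. u \<in> V \<Longrightarrow> v \<in> V \<Longrightarrow> E u v \<Longrightarrow> \<psi> u * \<psi> v \<in> nonsquarefree"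
    and p: "p \<in> J V"
  shows "subst \<psi> p \<in> nonsquarefree"
proof -
  have mon: "monomial_value \<psi> t * Poly_Mapping.single 0 c \<in> nonsquarefree"
    if t: "t \<in> Poly_Mapping.keys p" for t c
  proof -
    obtain u v where uv: "u \<in> Poly_Mapping.keys t" "v \<in> Poly_Mapping.keys t" "E u v"
    proof -
      have "Poly_Mapping.keys t \<subseteq> V" "\<not> indep (Poly_Mapping.keys t)"
        using p t by (auto simp: J_def carrier_poly_ring)
      then show ?thesis using that unfolding indep_def by blast
    qed
    obtain r where r: "t = Poly_Mapping.single u 1 + r" using dvd_monomial[OF uv(1)] by auto
    have v: "v \<in> Poly_Mapping.keys r" using uv r E_irrefl by (auto simp: keys_add_nat)
    obtain s where "r = Poly_Mapping.single v 1 + s" using dvd_monomial[OF v] ..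
    moreover have "monomial_value \<psi> (Poly_Mapping.single v 1) = \<psi> v" for v
      by (simp add: monomial_value_def)
    ultimately have "monomial_value \<psi> t = (\<psi> u * \<psi> v) * monomial_value \<psi> s"
      by (simp add: r monomial_value_add mult.assoc)
    moreover have "u \<in> V" "v \<in> V" using uv p t by (auto simp: J_def carrier_poly_ring)
    ultimately show ?thesis using \<psi> uv(3) by (simp add: nonsquarefree_mult)
  qed
  have "0 \<in> nonsquarefree" by (simp add: nonsquarefree_def)
  have sum: "sum f X \<in> nonsquarefree" if "\<And>t. t \<in> X \<Longrightarrow> f t \<in> nonsquarefree" for f :: "_ \<Rightarrow> ('v, 'k) mpoly" and X
    using that \<open>0 \<in> nonsquarefree\<close>
    by (induction X rule: infinite_finite_induct) (auto simp: nonsquarefree_add)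
  show ?thesis
    unfolding subst_def mult.commute[of "Poly_Mapping.single _ _"] by (intro sum mon)
qed

lemma not_in_by_subst:
  assumes "\<And>u v. u \<in> V \<Longrightarrow> v \<in> V \<Longrightarrow> E u v \<Longrightarrow> \<psi> u * \<psi> v \<in> nonsquarefree"
    and "\<And>f. f \<in> set fs \<Longrightarrow> subst \<psi> f = 0" and "subst \<psi> w \<notin> nonsquarefree"
  shows "w \<notin> foldl adjoin (J V) fs"
proof
  assume "w \<in> foldl adjoin (J V) fs"
  then have "subst \<psi> w \<in> nonsquarefree"
  proof (rule subst_foldl_adjoin[rotated -1])
    show "subst \<psi> p \<in> nonsquarefree" if "p \<in> J V" for p
      using assms(1) that by (rule subst_J_nonsquarefree)
    show "subst \<psi> f \<in> nonsquarefree" if "f \<in> set fs" for f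
      using assms(2)[OF that] by (simp add: nonsquarefree_def)
  qed (simp_all add: nonsquarefree_add nonsquarefree_mult)
  then show False using assms(3) by simp
qed

lemma prod_vars_not_nonsquarefree:
  assumes "inj_on a X"
  shows "(\<Prod>i\<in>X. var (a i)) \<notin> nonsquarefree"
proof -
  have prod: "(\<Prod>i\<in>X. var (a i)) = (Poly_Mapping.single (\<Sum>i\<in>X. Poly_Mapping.single (a i) 1) 1 :: ('v, 'k) mpoly)"
    by (induction X rule: infinite_finite_induct) (simp_all add: var_def mult_single)
  have "Poly_Mapping.lookup (\<Sum>i\<in>X. Poly_Mapping.single (a i) (1::nat)) v < 2" for v
  proof (cases "finite X")
    case True
    have "Poly_Mapping.lookup (\<Sum>i\<in>X. Poly_Mapping.single (a i) (1::nat)) v = card {i \<in> X. a i = v}"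
      using True by (simp add: lookup_sum lookup_single when_def sum.If_cases Int_def)
    also have "\<dots> \<le> card {v}"
      using assms by (intro card_inj_on_le[of a]) (auto simp: inj_on_def)
    finally show ?thesis by simp
  qed simp
  then show ?thesis by (simp add: prod nonsquarefree_def not_le)
qed

section \<open>Stanley decompositions\<close>

definition standard :: "'v set \<Rightarrow> ('v \<Rightarrow>\<^sub>0 nat) set" where
  "standard U = {t. Poly_Mapping.keys t \<subseteq> U \<and> indep (Poly_Mapping.keys t)}"

definition block :: "('v \<Rightarrow>\<^sub>0 nat) \<times> 'v set \<Rightarrow> ('v \<Rightarrow>\<^sub>0 nat) set" where
  "block d = {fst d + r | r. Poly_Mapping.keys r \<subseteq> snd d}"

definition standard_partition ::
    "('v set \<Rightarrow> bool) \<Rightarrow> 'v set \<Rightarrow> (('v \<Rightarrow>\<^sub>0 nat) \<times> 'v set) set \<Rightarrow> bool" where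
  "standard_partition P U \<D> \<longleftrightarrow> finite \<D> \<and> (\<forall>d\<in>\<D>. P (snd d) \<and> snd d \<subseteq> U) \<and>
    (\<Union>d\<in>\<D>. block d) = standard U \<and> (\<forall>d\<in>\<D>. \<forall>d'\<in>\<D>. d \<noteq> d' \<longrightarrow> block d \<inter> block d' = {})"

text \<open>Branching on \<open>v\<close> splits the monomials with independent support in
  \<open>U\<close> into those divisible by \<open>x\<^sub>v\<close>, which are
  \<open>x\<^sub>v\<close> times the monomials for \<open>U - N(v)\<close>, and those for
  \<open>U - {v}\<close>. At a leaf all monomials in the variables of \<open>U\<close> form a
  single block with base \<open>1\<close>. The second component of each block is a leaf, so
  \<open>P\<close> is inherited.\<close>

lemma resolvable_partition:
  assumes "resolvable P U"
  shows "\<exists>\<D>. standard_partition P U \<D>"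
  using assms
proof (induction rule: resolvable.induct)
  case (leaf U)
  have "block (0, U) = standard U"
    using leaf(1) indep_subset by (auto simp: block_def standard_def)
  then have "standard_partition P U {(0, U)}" using leaf(2) by (simp add: standard_partition_def)
  then show ?case ..
next
  case (branch v U)
  let ?v = "Poly_Mapping.single v (1::nat)"
  obtain \<D>1 where "standard_partition P (U - nbhd v) \<D>1" using branch by blast
  note \<D>1 = this[unfolded standard_partition_def, THEN conjunct1]
    this[unfolded standard_partition_def, THEN conjunct2, THEN conjunct1]
    this[unfolded standard_partition_def, THEN conjunct2, THEN conjunct2, THEN conjunct1]
    this[unfolded standard_partition_def, THEN conjunct2, THEN conjunct2, THEN conjunct2]
  obtain \<D>2 where "standard_partition P (U - {v}) \<D>2" using branch by blast
  note \<D>2 = this[unfolded standard_partition_def, THEN conjunct1]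
    this[unfolded standard_partition_def, THEN conjunct2, THEN conjunct1]
    this[unfolded standard_partition_def, THEN conjunct2, THEN conjunct2, THEN conjunct1]
    this[unfolded standard_partition_def, THEN conjunct2, THEN conjunct2, THEN conjunct2]
  let ?s = "\<lambda>d. (?v + fst d, snd d)"
  have shift: "block (?s d) = (+) ?v ` block d" for d :: "('v \<Rightarrow>\<^sub>0 nat) \<times> 'v set"
    by (auto simp: block_def add.assoc image_iff)
  have standard_v: "?v + t \<in> standard U \<longleftrightarrow> t \<in> standard (U - nbhd v)" for t
    using branch(1) by (auto simp: standard_def keys_add_nat indep_insert)
  have "standard U = (+) ?v ` standard (U - nbhd v) \<union> standard (U - {v})"
  proof (intro subset_antisym subsetI)
    fix t assume t: "t \<in> standard U"
    show "t \<in> (+) ?v ` standard (U - nbhd v) \<union> standard (U - {v})"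
    proof (cases "v \<in> Poly_Mapping.keys t")
      case True
      obtain r where r: "t = ?v + r" using dvd_monomial[OF True] ..
      have "r \<in> standard (U - nbhd v)" using t standard_v[of r] r by simp
      then show ?thesis using r by blast
    next
      case False
      then show ?thesis using t by (auto simp: standard_def)
    qed
  next
    fix t assume "t \<in> (+) ?v ` standard (U - nbhd v) \<union> standard (U - {v})"
    moreover have "standard (U - {v}) \<subseteq> standard U" by (auto simp: standard_def)
    ultimately show "t \<in> standard U" using standard_v by blast
  qed
  moreover have "(\<Union>d\<in>?s ` \<D>1. block d) = (+) ?v ` (\<Union>d\<in>\<D>1. block d)"
    unfolding image_UN image_image shift ..
  ultimately have union: "(\<Union>d\<in>?s ` \<D>1 \<union> \<D>2. block d) = standard U"
    using \<D>1(3) \<D>2(3) by (simp only: UN_Un)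
  have cross: "block (?s d) \<inter> block d' = {}" if "d' \<in> \<D>2" for d d'
  proof -
    have "v \<notin> Poly_Mapping.keys t" if "t \<in> block d'" for t
      using \<open>d' \<in> \<D>2\<close> that \<D>2(3) by (auto simp: standard_def)
    moreover have "v \<in> Poly_Mapping.keys t" if "t \<in> block (?s d)" for t
      using that unfolding shift by (auto simp: keys_add_nat)
    ultimately show ?thesis by blast
  qed
  have disj1: "block (?s d) \<inter> block (?s d') = {}" if "d \<in> \<D>1" "d' \<in> \<D>1" "?s d \<noteq> ?s d'" for d d'
  proof -
    have "d \<noteq> d'" using that(3) by auto
    then have "block d \<inter> block d' = {}" by (rule \<D>1(4)[rule_format, OF that(1,2)])
    then show ?thesis unfolding shift by auto
  qed
  show ?case
    unfolding standard_partition_def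
  proof (intro exI[of _ "?s ` \<D>1 \<union> \<D>2"] conjI)
    show "finite (?s ` \<D>1 \<union> \<D>2)" using \<D>1(1) \<D>2(1) by simp
    show "\<forall>d\<in>?s ` \<D>1 \<union> \<D>2. P (snd d) \<and> snd d \<subseteq> U"
      using \<D>1(2) \<D>2(2) by fastforce
    show "(\<Union>d\<in>?s ` \<D>1 \<union> \<D>2. block d) = standard U" by (rule union)
    show "\<forall>d\<in>?s ` \<D>1 \<union> \<D>2. \<forall>d'\<in>?s ` \<D>1 \<union> \<D>2. d \<noteq> d' \<longrightarrow> block d \<inter> block d' = {}"
    proof (intro ballI impI)
      fix d d' assume d: "d \<in> ?s ` \<D>1 \<union> \<D>2" "d' \<in> ?s ` \<D>1 \<union> \<D>2" "d \<noteq> d'"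
      show "block d \<inter> block d' = {}"
      proof (cases "d \<in> \<D>2"; cases "d' \<in> \<D>2")
        assume "d \<in> \<D>2" "d' \<in> \<D>2"
        then show ?thesis using \<D>2(4) d(3) by blast
      next
        assume 2: "d \<in> \<D>2" "d' \<notin> \<D>2"
        then obtain c where "d' = ?s c" using d(2) by blast
        then show ?thesis using cross[OF 2(1), of c] by (simp add: Int_commute)
      next
        assume 2: "d \<notin> \<D>2" "d' \<in> \<D>2"
        then obtain c where "d = ?s c" using d(1) by blast
        then show ?thesis using cross[OF 2(2), of c] by simp
      next
        assume "d \<notin> \<D>2" "d' \<notin> \<D>2"
        then obtain c c' where "d = ?s c" "d' = ?s c'" "c \<in> \<D>1" "c' \<in> \<D>1"
          using d(1,2) by blast
        then show ?thesis using disj1[of c c'] d(3) by simp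
      qed
    qed
  qed
qed

sublocale poly_quotient V K "J V"
  by unfold_locales (rule J_ideal)

text \<open>The Stanley space \<open>w K[A]\<close> with \<open>w\<close> a monomial is spanned
  by the monomials in \<open>w K[A]\<close>, so decompositions into such spaces reduce to
  partitions of monomials.\<close>

lemma block_span:
  assumes "snd d \<subseteq> V" "Poly_Mapping.keys (fst d) \<subseteq> V"
  shows "stanley_space M (residue (Poly_Mapping.single (fst d) 1)) (snd d) =
    residue ` {g. Poly_Mapping.keys g \<subseteq> block d}"
proof -
  have t: "Poly_Mapping.single (fst d) 1 \<in> C" using assms(2) by (simp add: carrier_poly_ring)
  have smult: "f \<odot>\<^bsub>M\<^esub> residue (Poly_Mapping.single (fst d) 1) = residue (Poly_Mapping.single (fst d) 1 * f)"
    if "f \<in> carrier (poly_ring (snd d))" for f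
  proof -
    have "f \<in> C" using that assms(1) by (auto simp: carrier_poly_ring)
    then show ?thesis using smult_M[OF _ t] by (simp add: mult.commute)
  qed
  show ?thesis
  proof (intro subset_antisym subsetI)
    fix m assume "m \<in> stanley_space M (residue (Poly_Mapping.single (fst d) 1)) (snd d)"
    then obtain f where f: "f \<in> carrier (poly_ring (snd d))" "m = residue (Poly_Mapping.single (fst d) 1 * f)"
      unfolding stanley_space_def using smult by auto
    have "Poly_Mapping.keys (Poly_Mapping.single (fst d) 1 * f) \<subseteq> block d"
      using f(1) by (auto simp: keys_single_times block_def carrier_poly_ring)
    then show "m \<in> residue ` {g. Poly_Mapping.keys g \<subseteq> block d}" using f(2) by blast
  next
    fix m assume "m \<in> residue ` {g. Poly_Mapping.keys g \<subseteq> block d}"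
    then obtain g where g: "m = residue g" "Poly_Mapping.keys g \<subseteq> block d" by blast
    then have "\<forall>s\<in>Poly_Mapping.keys g. \<exists>r. s = fst d + r" by (auto simp: block_def)
    then obtain f where f: "g = Poly_Mapping.single (fst d) 1 * f"
      "Poly_Mapping.keys f = {r. fst d + r \<in> Poly_Mapping.keys g}" by (rule monomial_quotient)
    have "f \<in> carrier (poly_ring (snd d))"
      unfolding carrier_poly_ring f(2)
    proof
      fix r assume "r \<in> {r. fst d + r \<in> Poly_Mapping.keys g}"
      then have "fst d + r \<in> block d" using g(2) by auto
      then show "Poly_Mapping.keys r \<subseteq> snd d" by (auto simp: block_def)
    qed
    then show "m \<in> stanley_space M (residue (Poly_Mapping.single (fst d) 1)) (snd d)"
      unfolding stanley_space_def using f(1) g(1) smult by (metis image_eqI)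
  qed
qed

lemma stanley_decomposition_blocks:
  fixes ds :: "(('v \<Rightarrow>\<^sub>0 nat) \<times> 'v set) list"
  assumes "distinct ds" and sub: "\<And>d. d \<in> set ds \<Longrightarrow> snd d \<subseteq> V"
    and union: "(\<Union>d\<in>set ds. block d) = standard V"
    and disj: "\<And>d d'. d \<in> set ds \<Longrightarrow> d' \<in> set ds \<Longrightarrow> d \<noteq> d' \<Longrightarrow> block d \<inter> block d' = {}"
  shows "stanley_decomposition V M (quot_grading V (J V))
    (map (\<lambda>d. (residue (Poly_Mapping.single (fst d) 1), snd d)) ds)"
proof -
  have fst_V: "Poly_Mapping.keys (fst d) \<subseteq> V" if "d \<in> set ds" for d
  proof -
    have "fst d + 0 \<in> block d" unfolding block_def by (rule CollectI) (metis empty_subsetI keys_zero)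
    then show ?thesis using union that by (auto simp: standard_def)
  qed
  have block_V: "p \<in> C" if "d \<in> set ds" "Poly_Mapping.keys p \<subseteq> block d" for p d
    using that union by (force simp: carrier_poly_ring standard_def)
  have free: "f = 0" if d: "d \<in> set ds" and f: "f \<in> carrier (poly_ring (snd d))"
    and "f \<odot>\<^bsub>M\<^esub> residue (Poly_Mapping.single (fst d) 1) = \<zero>\<^bsub>M\<^esub>" for d f
  proof -
    have "f \<in> C" using f sub[OF d] by (auto simp: carrier_poly_ring)
    moreover have "Poly_Mapping.single (fst d) 1 \<in> C"
      using fst_V[OF d] by (simp add: carrier_poly_ring)
    ultimately have "residue (Poly_Mapping.single (fst d) 1 * f) = residue 0"
      using that(3) smult_M[of f "Poly_Mapping.single (fst d) 1"] zero_M
      by (simp add: mult.commute)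
    then have "Poly_Mapping.single (fst d) 1 * f \<in> J V" by (simp add: residue_eq)
    then have "Poly_Mapping.keys (Poly_Mapping.single (fst d) 1 * f) \<inter> standard V = {}"
      by (auto simp: J_def standard_def)
    moreover have "Poly_Mapping.keys (Poly_Mapping.single (fst d) 1 * f) \<subseteq> block d"
      using f by (auto simp: keys_single_times block_def carrier_poly_ring)
    ultimately have "Poly_Mapping.keys (Poly_Mapping.single (fst d) 1 * f) = {}"
      using union d by blast
    then show "f = 0" by (simp add: keys_single_times)
  qed
  let ?S = "\<lambda>i. residue ` {g. Poly_Mapping.keys g \<subseteq> block (ds ! i)}"
  let ?n = "length ds"
  have nth: "ds ! i \<in> set ds" if "i < ?n" for i using that by simp
  have disj': "block (ds ! i) \<inter> block (ds ! j) = {}" if "i < ?n" "j < ?n" "i \<noteq> j" for i j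
    using disj[OF nth nth] that assms(1) by (simp add: nth_eq_iff_index_eq)
  have unique: "\<exists>!y. y \<in> (\<Pi>\<^sub>E i\<in>{..<?n}. ?S i) \<and> m = (\<Oplus>\<^bsub>M\<^esub>i\<in>{..<?n}. y i)"
    if m: "m \<in> carrier M" for m
  proof (rule ex_ex1I)
    obtain p where p: "m = residue p" "p \<in> C" using m by (auto simp: carrier_M)
    let ?p = "\<lambda>i. restrict_keys (block (ds ! i)) p"
    have pC: "?p i \<in> C" for i using p(2) by (auto simp: carrier_poly_ring keys_restrict_keys)
    have "p - (\<Sum>i<?n. ?p i) \<in> J V"
    proof -
      have "Poly_Mapping.lookup (p - (\<Sum>i<?n. ?p i)) t = 0" if t: "t \<in> standard V" for t
      proof -
        obtain j where j: "j < ?n" "t \<in> block (ds ! j)"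
        proof -
          have "t \<in> (\<Union>d\<in>set ds. block d)" using t union by simp
          then obtain d where "d \<in> set ds" "t \<in> block d" by blast
          then show ?thesis using that by (auto simp: in_set_conv_nth)
        qed
        have "t \<notin> block (ds ! i)" if "i < ?n" "i \<noteq> j" for i using disj'[OF that(1) j(1)] that j by blast
        then have "(\<Sum>i<?n. Poly_Mapping.lookup (?p i) t) = (\<Sum>i\<in>{j}. Poly_Mapping.lookup p t)"
          using j by (intro sum.mono_neutral_cong_right) (auto simp: lookup_restrict_keys)
        then show ?thesis by (simp add: lookup_minus lookup_sum)
      qed
      moreover have "p - (\<Sum>i<?n. ?p i) \<in> C" using p(2) pC by (intro diff_closed sum_closed)
      ultimately show ?thesis by (auto simp: J_def standard_def in_keys_iff)
    qed
    then have "m = residue (\<Sum>i<?n. ?p i)" by (simp add: p(1) residue_eq)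
    also have "\<dots> = (\<Oplus>\<^bsub>M\<^esub>i\<in>{..<?n}. (\<lambda>i\<in>{..<?n}. residue (?p i)) i)"
      by (rule finsum_M[symmetric]) (use pC in auto)
    finally show "\<exists>y. y \<in> (\<Pi>\<^sub>E i\<in>{..<?n}. ?S i) \<and> m = (\<Oplus>\<^bsub>M\<^esub>i\<in>{..<?n}. y i)"
      by (intro exI[of _ "\<lambda>i\<in>{..<?n}. residue (?p i)"]) (auto simp: keys_restrict_keys)
  next
    fix y y'
    assume y: "y \<in> (\<Pi>\<^sub>E i\<in>{..<?n}. ?S i) \<and> m = (\<Oplus>\<^bsub>M\<^esub>i\<in>{..<?n}. y i)"
      and y': "y' \<in> (\<Pi>\<^sub>E i\<in>{..<?n}. ?S i) \<and> m = (\<Oplus>\<^bsub>M\<^esub>i\<in>{..<?n}. y' i)"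
    have "\<forall>i\<in>{..<?n}. \<exists>g. Poly_Mapping.keys g \<subseteq> block (ds ! i) \<and> y i = residue g"
      using y by (auto simp: PiE_iff image_iff)
    then obtain g where g: "\<And>i. i < ?n \<Longrightarrow> Poly_Mapping.keys (g i) \<subseteq> block (ds ! i)"
      "\<And>i. i < ?n \<Longrightarrow> y i = residue (g i)" by (metis lessThan_iff)
    have "\<forall>i\<in>{..<?n}. \<exists>g. Poly_Mapping.keys g \<subseteq> block (ds ! i) \<and> y' i = residue g"
      using y' by (auto simp: PiE_iff image_iff)
    then obtain g' where g': "\<And>i. i < ?n \<Longrightarrow> Poly_Mapping.keys (g' i) \<subseteq> block (ds ! i)"
      "\<And>i. i < ?n \<Longrightarrow> y' i = residue (g' i)" by (metis lessThan_iff)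
    have "residue (\<Sum>i<?n. g i) = m"
      using y g block_V[OF nth] finsum_M[of "{..<?n}" g y] by simp
    moreover have "residue (\<Sum>i<?n. g' i) = m"
      using y' g' block_V[OF nth] finsum_M[of "{..<?n}" g' y'] by simp
    ultimately have J: "(\<Sum>i<?n. g i) - (\<Sum>i<?n. g' i) \<in> J V" by (simp add: residue_eq[symmetric])
    have "g j = g' j" if j: "j < ?n" for j
    proof (rule poly_mapping_eqI)
      fix t
      show "Poly_Mapping.lookup (g j) t = Poly_Mapping.lookup (g' j) t"
      proof (cases "t \<in> block (ds ! j)")
        case False
        then have "t \<notin> Poly_Mapping.keys (g j)" "t \<notin> Poly_Mapping.keys (g' j)"
          using g(1)[OF j] g'(1)[OF j] by auto
        then show ?thesis by (simp add: in_keys_iff)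
      next
        case True
        then have "t \<in> standard V" using union nth[OF j] by blast
        then have "Poly_Mapping.lookup ((\<Sum>i<?n. g i) - (\<Sum>i<?n. g' i)) t = 0"
          using J by (auto simp: J_def standard_def in_keys_iff)
        moreover have "(\<Sum>i<?n. Poly_Mapping.lookup (h i) t) = Poly_Mapping.lookup (h j) t"
          if h: "\<And>i. i < ?n \<Longrightarrow> Poly_Mapping.keys (h i) \<subseteq> block (ds ! i)"
          for h :: "nat \<Rightarrow> ('v, 'k) mpoly"
        proof -
          have "Poly_Mapping.lookup (h i) t = 0" if "i < ?n" "i \<noteq> j" for i
          proof -
            have "t \<notin> Poly_Mapping.keys (h i)" using h[OF that(1)] disj'[OF that(1) j that(2)] True by blast
            then show ?thesis by (simp add: in_keys_iff)
          qed
          then have "(\<Sum>i<?n. Poly_Mapping.lookup (h i) t) = (\<Sum>i\<in>{j}. Poly_Mapping.lookup (h i) t)"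
            using j by (intro sum.mono_neutral_right) auto
          then show ?thesis by simp
        qed
        from this[OF g(1)] this[OF g'(1)] calculation show ?thesis
          by (simp add: lookup_minus lookup_sum)
      qed
    qed
    then have "y i = y' i" if "i < ?n" for i using g(2) g'(2) that by simp
    then show "y = y'"
      by (intro PiE_ext[OF conjunct1[OF y] conjunct1[OF y']]) simp
  qed
  have deg: "\<exists>a. residue (Poly_Mapping.single (fst d) 1) \<in> quot_grading V (J V) a" if "d \<in> set ds" for d
    using fst_V[OF that] unfolding quot_grading_def
    by (intro exI[of _ "\<lambda>v. int (Poly_Mapping.lookup (fst d) v)"] CollectI
        exI[of _ "Poly_Mapping.single (fst d) 1"]) (simp add: carrier_poly_ring)
  have S: "stanley_space M (fst (map (\<lambda>d. (residue (Poly_Mapping.single (fst d) 1), snd d)) ds ! i))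
      (snd (map (\<lambda>d. (residue (Poly_Mapping.single (fst d) 1), snd d)) ds ! i)) = ?S i" if "i < ?n" for i
    using that block_span[OF sub[OF nth[OF that]] fst_V[OF nth[OF that]]] by simp
  have PiE: "(\<Pi>\<^sub>E i\<in>{..<length (map (\<lambda>d. (residue (Poly_Mapping.single (fst d) 1), snd d)) ds)}.
      stanley_space M (fst (map (\<lambda>d. (residue (Poly_Mapping.single (fst d) 1), snd d)) ds ! i))
      (snd (map (\<lambda>d. (residue (Poly_Mapping.single (fst d) 1), snd d)) ds ! i))) = (\<Pi>\<^sub>E i\<in>{..<?n}. ?S i)"
    by (rule PiE_cong[THEN trans]) (use S in auto)
  have carr: "residue (Poly_Mapping.single (fst d) 1) \<in> carrier M" if "d \<in> set ds" for d
    using fst_V[OF that] by (auto simp: carrier_M carrier_poly_ring)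
  show ?thesis
    unfolding stanley_decomposition_def PiE
    unfolding length_map
  proof (intro conjI)
    show "\<forall>(w, A)\<in>set (map (\<lambda>d. (residue (Poly_Mapping.single (fst d) 1), snd d)) ds).
      w \<in> carrier M \<and> (\<exists>a. w \<in> quot_grading V (J V) a) \<and> A \<subseteq> V \<and>
      (\<forall>f\<in>carrier (poly_ring A). f \<odot>\<^bsub>M\<^esub> w = \<zero>\<^bsub>M\<^esub> \<longrightarrow> f = 0)"
      using carr deg sub free by auto
    show "\<forall>m\<in>carrier M. \<exists>!y. y \<in> (\<Pi>\<^sub>E i\<in>{..<?n}. ?S i) \<and> m = (\<Oplus>\<^bsub>M\<^esub>i\<in>{..<?n}. y i)"
      by (rule ballI) (rule unique)
  qed
qed

theorem sdepth_quot_ge: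
  assumes "resolvable (\<lambda>U. k \<le> card U) V"
  shows "enat k \<le> sdepth_quot V (J V)"
proof -
  obtain \<D> where \<D>: "standard_partition (\<lambda>U. k \<le> card U) V \<D>"
    using resolvable_partition[OF assms] by blast
  then obtain ds where ds: "set ds = \<D>" "distinct ds"
    using finite_distinct_list[of \<D>] by (auto simp: standard_partition_def)
  let ?D = "map (\<lambda>d. (residue (Poly_Mapping.single (fst d) 1), snd d)) ds"
  have "stanley_decomposition V M (quot_grading V (J V)) ?D"
    using ds \<D> unfolding standard_partition_def by (intro stanley_decomposition_blocks) blast+
  moreover have "enat k \<le> sdepth_decomposition ?D"
    unfolding sdepth_decomposition_def using ds \<D>
    by (auto simp: standard_partition_def intro!: INF_greatest)
  ultimately show ?thesis
    unfolding sdepth_def by (intro Sup_upper2[of "sdepth_decomposition ?D"]) auto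
qed

end

section \<open>The strong product of a cycle and an edge\<close>

lemma edge_ideal_eq_J:
  fixes G :: "'v::linorder graph" and K :: "'k::field itself"
  assumes "finite (verts G)" and sub: "\<And>u v. {u, v} \<in> edges G \<Longrightarrow> u \<in> verts G \<and> v \<in> verts G \<and> u \<noteq> v"
  shows "edge_ring (verts G) (\<lambda>u v. {u, v} \<in> edges G)"
    and "(edge_ideal G :: ('v, 'k) mpoly set) = edge_ring.J (verts G) (\<lambda>u v. {u, v} \<in> edges G) (verts G)"
proof -
  show *: "edge_ring (verts G) (\<lambda>u v. {u, v} \<in> edges G)"
    by unfold_locales (use assms(1) sub[of v v for v] in \<open>auto simp: insert_commute\<close>)
  interpret edge_ring "verts G" K "\<lambda>u v. {u, v} \<in> edges G" by (rule *)
  interpret R: cring R by (rule cring_poly_ring)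
  let ?gens = "{var u * var v | u v. {u, v} \<in> edges G} :: ('v, 'k) mpoly set"
  have var_var: "var u * var v \<in> J (verts G)" if "{u, v} \<in> edges G" for u v
  proof -
    have "var u * var v = (Poly_Mapping.single (Poly_Mapping.single u 1 + Poly_Mapping.single v 1) 1 :: ('v, 'k) mpoly)"
      by (simp add: var_def mult_single)
    moreover have "\<not> indep {u, v}" using that by (auto simp: indep_def)
    ultimately show ?thesis
      using sub[OF that] by (simp add: J_def carrier_poly_ring keys_add_nat insert_commute)
  qed
  have gens: "?gens \<subseteq> C" using var_var ideal_subset[OF J_ideal] by blast
  have idl: "is_ideal (Idl\<^bsub>R\<^esub> ?gens)" using R.genideal_ideal[OF gens] by (simp add: ideal_iff)
  show "(edge_ideal G :: ('v, 'k) mpoly set) = J (verts G)"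
    unfolding edge_ideal_def
  proof
    show "Idl\<^bsub>R\<^esub> ?gens \<subseteq> J (verts G)"
      by (rule R.genideal_minimal) (use var_var J_ideal ideal_iff in auto)
    show "J (verts G) \<subseteq> Idl\<^bsub>R\<^esub> ?gens"
    proof
      fix p assume p: "p \<in> J (verts G)"
      have "Poly_Mapping.single t (Poly_Mapping.lookup p t) \<in> Idl\<^bsub>R\<^esub> ?gens"
        if t: "t \<in> Poly_Mapping.keys p" for t
      proof -
        have tV: "Poly_Mapping.keys t \<subseteq> verts G" and "\<not> indep (Poly_Mapping.keys t)"
          using p t by (auto simp: J_def carrier_poly_ring)
        then obtain u v where uv: "u \<in> Poly_Mapping.keys t" "v \<in> Poly_Mapping.keys t" "{u, v} \<in> edges G"
          unfolding indep_def by blast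
        obtain r where r: "t = Poly_Mapping.single u 1 + r" using dvd_monomial[OF uv(1)] ..
        have v: "v \<in> Poly_Mapping.keys r" using uv r sub[OF uv(3)] by (auto simp: keys_add_nat)
        obtain s where s: "r = Poly_Mapping.single v 1 + s" using dvd_monomial[OF v] ..
        have "Poly_Mapping.single t (Poly_Mapping.lookup p t) =
            Poly_Mapping.single s (Poly_Mapping.lookup p t) * (var u * var v)"
          by (simp add: var_def mult_single r s add_ac)
        moreover have "Poly_Mapping.single s (Poly_Mapping.lookup p t) \<in> C"
          using tV by (simp add: carrier_poly_ring r s keys_add_nat)
        moreover have "var u * var v \<in> Idl\<^bsub>R\<^esub> ?gens" using R.genideal_self[OF gens] uv(3) by blast
        ultimately show ?thesis using ideal_mult[OF idl] by simp
      qed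
      then have "(\<Sum>t\<in>Poly_Mapping.keys p. Poly_Mapping.single t (Poly_Mapping.lookup p t)) \<in> Idl\<^bsub>R\<^esub> ?gens"
        by (rule ideal_sum[OF idl])
      then show "p \<in> Idl\<^bsub>R\<^esub> ?gens" by (simp flip: poly_as_sum[OF finite_keys order_refl])
    qed
  qed
qed

text \<open>Columns that are equal or adjacent on the cycle \<open>C\<^sub>n\<close>.\<close>

definition near :: "nat \<Rightarrow> nat \<Rightarrow> nat \<Rightarrow> bool" where
  "near n i k \<longleftrightarrow> i = k \<or> k = i + 1 \<or> i = k + 1 \<or> i = 1 \<and> k = n \<or> i = n \<and> k = 1"

definition cverts :: "nat \<Rightarrow> (nat \<times> nat) set" where
  "cverts n = {1..n} \<times> {1..2}"

lemma mem_cverts [simp]: "(c, j) \<in> cverts n \<longleftrightarrow> 1 \<le> c \<and> c \<le> n \<and> (j = 1 \<or> j = 2)"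
  by (auto simp: cverts_def)

definition cadj :: "nat \<Rightarrow> nat \<times> nat \<Rightarrow> nat \<times> nat \<Rightarrow> bool" where
  "cadj n u v \<longleftrightarrow> u \<in> cverts n \<and> v \<in> cverts n \<and> u \<noteq> v \<and> near n (fst u) (fst v)"

lemma verts_strong_cycle: "verts (strong_cycle_path n 2) = cverts n"
  by (simp add: cverts_def strong_cycle_path_def strong_product_def cycle_graph_def path_graph_def)

lemma edges_strong_cycle:
  assumes "n \<ge> 3"
  shows "{u, v} \<in> edges (strong_cycle_path n 2) \<longleftrightarrow> cadj n u v"
proof -
  have cyc: "i = k \<or> {i, k} \<in> edges (cycle_graph n) \<longleftrightarrow> near n i k" if "i \<in> {1..n}" "k \<in> {1..n}" for i k
    using that by (auto simp: cycle_graph_def doubleton_eq_iff near_def)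
  have path: "j = l \<or> {j, l} \<in> edges (path_graph 2)" if "j \<in> {1..2}" "l \<in> {1..2}" for j l
  proof -
    have "j = 1 \<or> j = 2" "l = 1 \<or> l = 2" using that by auto
    then show ?thesis by (auto simp: path_graph_def doubleton_eq_iff)
  qed
  obtain i j k l where uv: "u = (i, j)" "v = (k, l)" by fastforce
  have near_sym: "near n k i \<longleftrightarrow> near n i k" for i k by (auto simp: near_def)
  show ?thesis
  proof
    assume "{u, v} \<in> edges (strong_cycle_path n 2)"
    then obtain v1 u1 v2 u2 where uv': "{u, v} = {(v1, u1), (v2, u2)}"
      and V: "v1 \<in> verts (cycle_graph n)" "v2 \<in> verts (cycle_graph n)"
        "u1 \<in> verts (path_graph 2)" "u2 \<in> verts (path_graph 2)"
      and ne: "(v1, u1) \<noteq> (v2, u2)" and c: "v1 = v2 \<or> {v1, v2} \<in> edges (cycle_graph n)"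
      unfolding strong_cycle_path_def strong_product_def graph.simps mem_Collect_eq
      by (elim exE conjE) (rule that)
    have V': "v1 \<in> {1..n}" "v2 \<in> {1..n}" "u1 \<in> {1..2}" "u2 \<in> {1..2}"
      using V by (auto simp: cycle_graph_def path_graph_def)
    have "near n v1 v2" "near n v2 v1" using cyc[OF V'(1,2)] c near_sym by blast+
    moreover have "(v1, u1) \<in> cverts n" "(v2, u2) \<in> cverts n"
      using V' unfolding cverts_def by blast+
    ultimately show "cadj n u v"
      using uv' ne by (auto simp: cadj_def doubleton_eq_iff)
  next
    assume "cadj n u v"
    then have *: "i \<in> {1..n}" "k \<in> {1..n}" "j \<in> {1..2}" "l \<in> {1..2}" "u \<noteq> v" "near n i k"
      by (auto simp: cadj_def uv)
    then have "i = k \<or> {i, k} \<in> edges (cycle_graph n)" "j = l \<or> {j, l} \<in> edges (path_graph 2)"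
      using cyc[of i k] path[of j l] by blast+
    moreover have "i \<in> verts (cycle_graph n)" "k \<in> verts (cycle_graph n)"
      "j \<in> verts (path_graph 2)" "l \<in> verts (path_graph 2)" "(i, j) \<noteq> (k, l)"
      using * by (auto simp: uv cycle_graph_def path_graph_def)
    ultimately show "{u, v} \<in> edges (strong_cycle_path n 2)"
      unfolding strong_cycle_path_def strong_product_def uv graph.simps mem_Collect_eq
      by (intro exI conjI) (rule refl | assumption)+
  qed
qed

lemma card_ge_disjoint_hits:
  assumes "finite U" "finite I"
    and "\<And>i j. i \<in> I \<Longrightarrow> j \<in> I \<Longrightarrow> i \<noteq> j \<Longrightarrow> T i \<inter> T j = {}"
    and "\<And>i. i \<in> I \<Longrightarrow> U \<inter> T i \<noteq> {}"
  shows "card I \<le> card U"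
proof -
  have "\<forall>i\<in>I. \<exists>u. u \<in> U \<inter> T i" using assms(4) by blast
  then obtain u where u: "\<And>i. i \<in> I \<Longrightarrow> u i \<in> U \<inter> T i" by metis
  have "inj_on u I" using u assms(3) by (fastforce simp: inj_on_def)
  then show ?thesis using u assms(1) by (intro card_inj_on_le[of u]) auto
qed

locale strong_cycle =
  fixes n :: nat and K :: "'k::field itself"
  assumes n3: "n \<ge> 3"
begin

abbreviation VC :: "(nat \<times> nat) set" where "VC \<equiv> cverts n"

abbreviation EC :: "nat \<times> nat \<Rightarrow> nat \<times> nat \<Rightarrow> bool" where "EC \<equiv> cadj n"

sublocale edge_ring VC K EC
  by unfold_locales (auto simp: cadj_def near_def cverts_def)

lemma edge_ideal_strong_cycle: "(edge_ideal (strong_cycle_path n 2) :: (nat \<times> nat, 'k) mpoly set) = J VC"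
proof -
  have "(\<lambda>u v. {u, v} \<in> edges (strong_cycle_path n 2)) = EC"
    using edges_strong_cycle[OF n3] by blast
  moreover have "finite (verts (strong_cycle_path n 2))"
    by (simp add: verts_strong_cycle cverts_def)
  ultimately show ?thesis
    using edge_ideal_eq_J(2)[of "strong_cycle_path n 2", where 'k = 'k]
    by (simp add: verts_strong_cycle edges_strong_cycle[OF n3] cadj_def)
qed

lemma mem_nbhd: "v \<in> nbhd u \<longleftrightarrow> EC u v"
  by (simp add: nbhd_def)

definition cols :: "nat set \<Rightarrow> (nat \<times> nat) set" where
  "cols S = S \<times> {1..2}"

text \<open>The blocks are counted from \<open>0\<close>, so the middle column of \<open>B
  i\<close> is \<open>3i + 2\<close>.\<close>

definition B :: "nat \<Rightarrow> (nat \<times> nat) set" where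
  "B i = cols {3 * i + 1..3 * i + 3}"

lemma mem_cols [simp]: "(c, j) \<in> cols S \<longleftrightarrow> c \<in> S \<and> (j = 1 \<or> j = 2)"
  by (auto simp: cols_def)

lemma cols_subset: "S \<subseteq> {1..n} \<Longrightarrow> cols S \<subseteq> VC"
  unfolding cols_def cverts_def by (rule Sigma_mono) auto

lemma cols_disjoint: "S \<inter> T = {} \<Longrightarrow> cols S \<inter> cols T = {}"
  by (auto simp: cols_def)

lemma B_disjoint: "i \<noteq> j \<Longrightarrow> B i \<inter> B j = {}"
  unfolding B_def by (rule cols_disjoint) auto

lemma B_subset: "3 * i + 3 \<le> n \<Longrightarrow> B i \<subseteq> VC"
  unfolding B_def by (rule cols_subset) auto

lemma centre_nbhd: "3 * i + 3 \<le> n \<Longrightarrow> insert (3 * i + 2, 1) (nbhd (3 * i + 2, 1)) \<subseteq> B i"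
  by (auto simp: mem_nbhd cadj_def near_def B_def)

lemma adjacent_product: "EC u v \<Longrightarrow> var u * var v \<in> J VC"
proof -
  assume E: "EC u v"
  have "var u * var v = (Poly_Mapping.single (Poly_Mapping.single u 1 + Poly_Mapping.single v 1) 1 :: (nat \<times> nat, 'k) mpoly)"
    by (simp add: var_def mult_single)
  moreover have "\<not> indep {u, v}" using E unfolding indep_def by blast
  ultimately show ?thesis
    using E by (simp add: J_def carrier_poly_ring keys_add_nat insert_commute cadj_def)
qed

lemma sum_cols: "finite S \<Longrightarrow> (\<Sum>v\<in>cols S. f v) = (\<Sum>c\<in>S. f (c, 1) + f (c, 2))"
proof -
  have two: "{1..2} = {1, 2 :: nat}" by auto
  have "(\<Sum>v\<in>cols S. f v) = (\<Sum>c\<in>S. \<Sum>j\<in>{1..2}. f (c, j))"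
    unfolding cols_def by (simp add: sum.cartesian_product)
  also have "\<dots> = (\<Sum>c\<in>S. f (c, 1) + f (c, 2))" unfolding two by simp
  finally show ?thesis .
qed

lemma var_square_nonsquarefree: "c * var v * (d * var v) \<in> nonsquarefree"
proof -
  have "var v * var v = (Poly_Mapping.single (Poly_Mapping.single v 2) 1 :: (nat \<times> nat, 'k) mpoly)"
    by (simp add: var_def mult_single numeral_2_eq_2 flip: single_add)
  then have "var v * var v \<in> nonsquarefree"
    by (simp add: nonsquarefree_def exI[of _ v] del: split_paired_Ex)
  then have "(var v * var v) * (c * d) \<in> nonsquarefree" by (rule nonsquarefree_mult)
  then show ?thesis by (simp add: mult_ac)
qed

subsection \<open>Cycles of length \<open>3k\<close> and \<open>3k + 1\<close>\<close>

definition col_sum :: "nat \<Rightarrow> (nat \<times> nat, 'k) mpoly" where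
  "col_sum c = var (c, 1) + var (c, 2)"

lemma form_cols: "finite S \<Longrightarrow> form (cols S) = (\<Sum>c\<in>S. col_sum c)"
  by (simp add: form_def sum_cols col_sum_def)

lemma col_sum_closed: "c \<in> {1..n} \<Longrightarrow> col_sum c \<in> C"
  unfolding col_sum_def by (intro add_closed var_carrier) auto

lemma var_col_sum: "(c, j) \<in> VC \<Longrightarrow> d \<in> {1..n} \<Longrightarrow> c \<noteq> d \<Longrightarrow> near n c d \<Longrightarrow> var (c, j) * col_sum d \<in> J VC"
  unfolding col_sum_def distrib_left
  by (intro ideal_add[OF J_ideal] adjacent_product) (auto simp: cadj_def)

lemma col_sum_col_sum: "c \<in> {1..n} \<Longrightarrow> d \<in> {1..n} \<Longrightarrow> c \<noteq> d \<Longrightarrow> near n c d \<Longrightarrow> col_sum c * col_sum d \<in> J VC"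
  unfolding col_sum_def[of c] distrib_right by (intro ideal_add[OF J_ideal] var_col_sum) auto

lemma B_sum: "form (B i) = col_sum (3 * i + 1) + col_sum (3 * i + 2) + col_sum (3 * i + 3)"
proof -
  have "{3 * i + 1..3 * i + 3} = {3 * i + 1, 3 * i + 2, 3 * i + 3}" by auto
  then show ?thesis by (simp add: B_def form_cols add_ac)
qed

text \<open>The vertices \<open>(3i + 2, 1)\<close> guard the blocks, so every leaf meets all
  \<open>k\<close> of them, and forms of disjoint sets that meet a leaf are regular on it. The
  socle element \<open>w\<close> is the product of the column sums \<open>x\<^bsub>c1\<^esub> +
  x\<^bsub>c2\<^esub>\<close> over the middle columns \<open>c\<close>. A variable of an outer
  column of a block kills the middle sum by adjacency; a variable of the middle column sends the
  middle sum to the same element as the form of the whole block.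

  If \<open>n = 3k + 1\<close>, the column \<open>n\<close> belongs to no block and is adjacent to
  the columns \<open>1\<close> and \<open>3k\<close> only. Modulo the form of a block, its
  middle sum is minus the sum of its two outer ones. Starting from the first block, the left
  outer sum dies against column \<open>n\<close>, or against the right outer sum already chosen
  in the previous block, so all middle sums can be traded for right outer ones; the last of
  these, column \<open>3k\<close>, is again adjacent to column \<open>n\<close>.\<close>

lemma depth_sdepth_mod3_01:
  assumes n: "n = 3 * k \<or> n = 3 * k + 1"
  shows "depth_quot VC (J VC) = enat k" and "enat k \<le> sdepth_quot VC (J VC)"
proof -
  have k: "1 \<le> k" "3 * k \<le> n" using n n3 by auto
  have ik: "3 * i + 3 \<le> n" if "i < k" for i using that k by auto
  have res: "resolvable (\<lambda>U. U \<subseteq> VC \<and> (\<forall>i\<in>{..<k}. U \<inter> B i \<noteq> {})) VC"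
  proof (rule resolvable_guards)
    show "\<exists>a\<in>VC. insert a (nbhd a \<inter> VC) \<subseteq> B i" if "i \<in> {..<k}" for i
      using centre_nbhd[of i] ik[of i] that by (intro bexI[of _ "(3 * i + 2, 1)"]) auto
  qed (use B_disjoint fin in auto)
  have "resolvable (\<lambda>U. k \<le> card U) VC"
  proof (rule resolvable_mono[OF res])
    fix U assume U: "U \<subseteq> VC \<and> (\<forall>i\<in>{..<k}. U \<inter> B i \<noteq> {})"
    have "card {..<k} \<le> card U"
      using U B_disjoint finite_subset[of U VC] fin by (intro card_ge_disjoint_hits[of U _ B]) auto
    then show "k \<le> card U" by simp
  qed
  then show "enat k \<le> sdepth_quot VC (J VC)" by (rule sdepth_quot_ge)
  define fs where "fs = map (\<lambda>i. form (B i)) [0..<k]"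
  define L where "L = foldl adjoin (J VC) fs"
  have fsC: "set fs \<subseteq> C" unfolding fs_def using ik by (auto intro!: form_closed B_subset)
  have L: "is_ideal L" unfolding L_def by (rule foldl_adjoin_ideal[OF J_ideal fsC])
  have JL: "p \<in> L" if "p \<in> J VC" for p unfolding L_def by (rule foldl_adjoin_superset[OF that])
  have BL: "form (B i) \<in> L" if "i < k" for i
    unfolding L_def using that by (intro foldl_adjoin_member[OF J_ideal fsC]) (auto simp: fs_def)
  have weakly_regular: "weakly_regular (J VC) fs"
  proof (rule resolvable_weakly_regular[OF res order_refl fsC])
    fix U assume U: "U \<subseteq> VC" "indep U" "U \<subseteq> VC \<and> (\<forall>i\<in>{..<k}. U \<inter> B i \<noteq> {})"
    have "\<forall>i\<in>{..<k}. \<exists>u. u \<in> B i \<inter> U" using U(3) by blast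
    then obtain u where "\<And>i. i < k \<Longrightarrow> u i \<in> B i \<inter> U" by (metis lessThan_iff)
    then show "weakly_regular (J U) fs"
      unfolding fs_def using U ik B_subset B_disjoint by (intro leaf_weakly_regular[of _ _ _ u]) auto
  qed
  define w where "w = (\<Prod>i<k. col_sum (3 * i + 2))"
  have zC: "col_sum (3 * i + 2) \<in> C" "col_sum (3 * i + 3) \<in> C" if "i < k" for i
    using ik[OF that] by (auto intro!: col_sum_closed)
  have wC: "w \<in> C" unfolding w_def using zC by (intro prod_closed) auto
  have factor: "p * w \<in> L" if i: "i < k" and p: "p * col_sum (3 * i + 2) \<in> L" for i p
  proof -
    have "(\<Prod>i\<in>{..<k} - {i}. col_sum (3 * i + 2)) * (p * col_sum (3 * i + 2)) \<in> L"
      using zC by (intro ideal_mult[OF L _ p] prod_closed) auto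
    then show ?thesis
      unfolding w_def using i by (simp add: prod.remove[of "{..<k}" i] mult_ac)
  qed
  have socle: "var v * w \<in> L" if v: "v \<in> VC" for v
  proof -
    obtain c j where cj: "v = (c, j)" by fastforce
    have c: "1 \<le> c" "c \<le> n" using v cj by auto
    show ?thesis
    proof (cases "c \<le> 3 * k")
      case True
      define i where "i = (c - 1) div 3"
      have i: "i < k" "c = 3 * i + 1 \<or> c = 3 * i + 2 \<or> c = 3 * i + 3"
        unfolding i_def using True c by linarith+
      show ?thesis
      proof (cases "c = 3 * i + 2")
        case False
        then have "var v * col_sum (3 * i + 2) \<in> J VC"
          unfolding cj using v cj i ik[OF i(1)] by (intro var_col_sum) (auto simp: near_def)
        then show ?thesis using factor[OF i(1)] JL by blast
      next
        case c: True
        have "var v * form (B i) \<in> L"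
          using ideal_mult[OF L var_carrier[OF v] BL[OF i(1)]] .
        moreover have "var v * col_sum (3 * i + 1) \<in> L" "var v * col_sum (3 * i + 3) \<in> L"
          unfolding cj using v cj c ik[OF i(1)] by (auto intro!: JL var_col_sum simp: near_def)
        ultimately have "var v * form (B i) - (var v * col_sum (3 * i + 1) + var v * col_sum (3 * i + 3)) \<in> L"
          by (intro ideal_diff[OF L] ideal_add[OF L])
        then have "var v * col_sum (3 * i + 2) \<in> L" by (simp add: B_sum algebra_simps)
        then show ?thesis by (rule factor[OF i(1)])
      qed
    next
      case False
      then have nk: "n = 3 * k + 1" "c = n" using n c by auto
      \<comment> \<open>\<open>Q m\<close> is the product, up to sign, after the middle sums of the
        first \<open>m\<close> blocks have been traded.\<close>
      define Q where "Q = (\<lambda>m. var v * (\<Prod>i<m. col_sum (3 * i + 3)) * (\<Prod>i\<in>{m..<k}. col_sum (3 * i + 2)))"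
      have "Q 0 \<in> L"
      proof (rule inc_induct[of 0 k "\<lambda>m. Q m \<in> L"])
        obtain k' where k': "k = Suc k'" using k by (cases k) auto
        have "var v * col_sum (3 * k' + 3) \<in> J VC"
          unfolding cj using v cj nk k' by (intro var_col_sum) (auto simp: near_def)
        then have "(\<Prod>i<k'. col_sum (3 * i + 3)) * (var v * col_sum (3 * k' + 3)) \<in> J VC"
          by (rule ideal_mult[OF J_ideal, rotated]) (use zC k' in \<open>auto intro!: prod_closed\<close>)
        then show "Q k \<in> L" by (intro JL) (simp add: Q_def k' mult_ac)
      next
        fix m assume m: "0 \<le> m" "m < k" "Q (Suc m) \<in> L"
        define p where "p = (\<Prod>i<m. col_sum (3 * i + 3))"
        define q where "q = (\<Prod>i\<in>{Suc m..<k}. col_sum (3 * i + 2))"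
        have pC: "p \<in> C" and qC: "q \<in> C"
          unfolding p_def q_def using zC m by (auto intro!: prod_closed)
        have Qm: "Q m = var v * p * (col_sum (3 * m + 2) * q)"
          using m by (simp add: Q_def p_def q_def prod.atLeast_Suc_lessThan)
        have QSm: "Q (Suc m) = var v * p * col_sum (3 * m + 3) * q"
          by (simp add: Q_def p_def q_def mult_ac)
        have vC: "var v \<in> C" using v by (rule var_carrier)
        have "var v * p * col_sum (3 * m + 1) \<in> J VC"
        proof (cases m)
          case 0
          have "var v * col_sum 1 \<in> J VC"
            unfolding cj using v cj nk n3 by (intro var_col_sum) (auto simp: near_def)
          then show ?thesis by (simp add: p_def 0)
        next
          case (Suc m')
          have "col_sum (3 * m' + 3) * col_sum (3 * m + 1) \<in> J VC"
            using Suc m ik[OF m(2)] by (intro col_sum_col_sum) (auto simp: near_def)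
          then have "(var v * (\<Prod>i<m'. col_sum (3 * i + 3))) * (col_sum (3 * m' + 3) * col_sum (3 * m + 1)) \<in> J VC"
            by (rule ideal_mult[OF J_ideal, rotated])
              (use vC zC m Suc in \<open>auto intro!: mult_closed prod_closed\<close>)
          then show ?thesis by (simp add: p_def Suc mult_ac)
        qed
        then have "q * (var v * p * col_sum (3 * m + 1)) \<in> L" by (intro JL ideal_mult[OF J_ideal qC])
        moreover have "(var v * p * q) * form (B m) \<in> L"
          using vC pC qC by (intro ideal_mult[OF L _ BL[OF m(2)]]) auto
        ultimately have "(var v * p * q) * form (B m) - q * (var v * p * col_sum (3 * m + 1)) - Q (Suc m) \<in> L"
          using m(3) by (intro ideal_diff[OF L])
        then show "Q m \<in> L" unfolding Qm QSm B_sum by (simp add: algebra_simps)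
      qed simp
      then show ?thesis by (simp add: Q_def w_def lessThan_atLeast0)
    qed
  qed
  have "w \<notin> L"
  proof -
    \<comment> \<open>Each block keeps \<open>(3i + 1, 1)\<close> and \<open>(3i + 2, 1)\<close>,
      with values that cancel. The third columns go to zero, which separates the blocks also
      across the column \<open>n\<close>.\<close>
    define \<psi> :: "nat \<times> nat \<Rightarrow> (nat \<times> nat, 'k) mpoly" where
      "\<psi> = (\<lambda>(c, j). if j = 1 \<and> c \<le> 3 * k \<and> c mod 3 = 2 then 1 * var (c, 1)
        else if j = 1 \<and> c \<le> 3 * k \<and> c mod 3 = 1 then - 1 * var (c + 1, 1) else 0 * var (0, 0))"
    have col_sum\<psi>: "subst \<psi> (col_sum c) = \<psi> (c, 1)" for c by (simp add: col_sum_def subst_add subst_var \<psi>_def)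
    have \<psi>B: "\<psi> (3 * i + 1, 1) = - var (3 * i + 2, 1)" "\<psi> (3 * i + 2, 1) = var (3 * i + 2, 1)"
      "\<psi> (3 * i + 3, 1) = 0" if "i < k" for i
    proof -
      have "(3 * i + 1) mod 3 = 1" "(3 * i + 2) mod 3 = 2" "(3 * i + 3) mod 3 = 0" by presburger+
      then show "\<psi> (3 * i + 1, 1) = - var (3 * i + 2, 1)" "\<psi> (3 * i + 2, 1) = var (3 * i + 2, 1)"
        "\<psi> (3 * i + 3, 1) = 0" using that by (auto simp: \<psi>_def)
    qed
    show ?thesis
      unfolding L_def
    proof (rule not_in_by_subst[of \<psi>])
      show "subst \<psi> f = 0" if f: "f \<in> set fs" for f
      proof -
        obtain i where i: "f = form (B i)" "i < k" using f by (auto simp: fs_def)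
        show ?thesis unfolding i(1) B_sum subst_add col_sum\<psi> \<psi>B[OF i(2)] by simp
      qed
      have "subst \<psi> w = (\<Prod>i<k. var (3 * i + 2, 1))"
      proof -
        have "subst \<psi> (\<Prod>i<m. col_sum (3 * i + 2)) = (\<Prod>i<m. var (3 * i + 2, 1))" if "m \<le> k" for m
          using that
        proof (induction m)
          case 0
          then show ?case by (simp flip: single_one add: subst_single) (simp add: monomial_value_def)
        next
          case (Suc m)
          then show ?case using \<psi>B(2)[of m] by (simp add: subst_mult col_sum\<psi>)
        qed
        then show ?thesis by (simp add: w_def)
      qed
      then show "subst \<psi> w \<notin> nonsquarefree"
        using prod_vars_not_nonsquarefree[of "\<lambda>i. (3 * i + 2, 1)" "{..<k}"] by (simp add: inj_on_def)
      show "\<psi> u * \<psi> v \<in> nonsquarefree" if "u \<in> VC" "v \<in> VC" "EC u v" for u v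
      proof -
        obtain c j d l where uv: "u = (c, j)" "v = (d, l)" by fastforce
        have zero: "0 \<in> nonsquarefree" by (simp add: nonsquarefree_def)
        have near: "c = d \<or> d = c + 1 \<or> c = d + 1 \<or> c = 1 \<and> d = n \<or> c = n \<and> d = 1"
          using that(3) by (simp add: uv cadj_def near_def)
        define act where "act = (\<lambda>c j. j = (1::nat) \<and> c \<le> 3 * k \<and> (c mod 3 = 2 \<or> c mod 3 = 1))"
        define a where "a = (\<lambda>c::nat. if c mod 3 = 2 then c else c + 1)"
        have \<psi>a: "\<exists>s. \<psi> (c, j) = s * var (a c, 1)" "\<not> act c j \<Longrightarrow> \<psi> (c, j) = 0" for c j
          by (auto simp: \<psi>_def act_def a_def intro: exI[of _ 1] exI[of _ "- 1"] exI[of _ 0])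
        show ?thesis
        proof (cases "act c j \<and> act d l")
          case False
          then show ?thesis using \<psi>a(2) zero by (auto simp: uv)
        next
          case True
          have ex: "\<exists>i<k. (c = 3 * i + 1 \<or> c = 3 * i + 2) \<and> a c = 3 * i + 2" if "act c j" for c j
          proof -
            have c: "c = 3 * (c div 3) + 1 \<or> c = 3 * (c div 3) + 2" and "c \<le> 3 * k"
              using that mult_div_mod_eq[of 3 c] unfolding act_def by linarith+
            then have "c div 3 < k" by linarith
            moreover have "a c = 3 * (c div 3) + 2"
            proof (cases "c mod 3 = 2")
              case True
              then have "c = 3 * (c div 3) + 2" using mult_div_mod_eq[of 3 c] by linarith
              then show ?thesis using True by (simp add: a_def)
            next
              case False
              then have "c = 3 * (c div 3) + 1"
                using that mult_div_mod_eq[of 3 c] unfolding act_def by linarith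
              then show ?thesis using False by (simp add: a_def)
            qed
            ultimately show ?thesis using c by blast
          qed
          obtain i where i: "i < k" "c = 3 * i + 1 \<or> c = 3 * i + 2" "a c = 3 * i + 2"
            using True ex[of c j] by blast
          obtain i' where i': "i' < k" "d = 3 * i' + 1 \<or> d = 3 * i' + 2" "a d = 3 * i' + 2"
            using True ex[of d l] by blast
          have "c < n" "d < n" using i(1,2) i'(1,2) n by linarith+
          then have "c \<le> d + 1 \<and> d \<le> c + 1" using near by linarith
          then have "i = i'" using i(2) i'(2) by linarith
          then have "a c = a d" using i(3) i'(3) by simp
          then obtain s s' where "\<psi> u = s * var (a c, 1)" "\<psi> v = s' * var (a c, 1)"
            using \<psi>a(1)[of c j] \<psi>a(1)[of d l] uv by auto
          then show ?thesis by (simp add: var_square_nonsquarefree)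
        qed
      qed
    qed
  qed
  then have "depth_quot VC (J VC) = enat (length fs)"
    using weakly_regular wC socle ik unfolding L_def
    by (intro depth_quot_eq) (auto simp: fs_def intro!: form_var_ideal B_subset)
  then show "depth_quot VC (J VC) = enat k" by (simp add: fs_def)
qed

subsection \<open>Cycles of length \<open>3k + 2\<close>\<close>

lemma not_self_nbhd: "v \<notin> nbhd v"
  by (simp add: mem_nbhd cadj_def)

text \<open>Branching on both twins of a column \<open>c\<close>: either one of them is chosen
  and becomes isolated, or both are deleted.\<close>

lemma resolvable_column:
  assumes U: "U \<subseteq> VC" and c: "(c, 1) \<in> U" "(c, 2) \<in> U"
    and incl: "\<And>W j. j \<in> {1, 2} \<Longrightarrow> W \<subseteq> U \<Longrightarrow> (c, j) \<in> W \<Longrightarrow> nbhd (c, j) \<inter> W = {} \<Longrightarrow>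
      (\<And>d l. (d, l) \<in> U \<Longrightarrow> \<not> near n c d \<Longrightarrow> (d, l) \<in> W) \<Longrightarrow> resolvable P W"
    and excl: "resolvable P (U - cols {c})"
  shows "resolvable P U"
proof (rule branch[OF c(1)])
  show "resolvable P (U - nbhd (c, 1))"
    by (rule incl[of 1]) (use c not_self_nbhd in \<open>auto simp: mem_nbhd cadj_def\<close>)
  show "resolvable P (U - {(c, 1)})"
  proof (rule branch[of "(c, 2)"])
    show "(c, 2) \<in> U - {(c, 1)}" using c by simp
    show "resolvable P (U - {(c, 1)} - nbhd (c, 2))"
      by (rule incl[of 2])
        (use c not_self_nbhd in \<open>auto simp: mem_nbhd cadj_def near_def\<close>)
    have "U - {(c, 1)} - {(c, 2)} = U - cols {c}" by auto
    then show "resolvable P (U - {(c, 1)} - {(c, 2)})" using excl by simp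
  qed
qed

text \<open>The blocks leave the last two columns uncovered. A leaf that misses those must
  contain both outer columns of some block; in either case it has at least \<open>k + 1\<close>
  vertices. Meeting all blocks would not suffice: a leaf with one vertex in each block and none
  in the last two columns has only \<open>k\<close> vertices.\<close>

definition wide_leaf :: "nat \<Rightarrow> (nat \<times> nat) set \<Rightarrow> bool" where
  "wide_leaf k U \<longleftrightarrow> U \<subseteq> VC \<and> (\<forall>i<k. U \<inter> B i \<noteq> {}) \<and> (U \<inter> cols {n - 1, n} \<noteq> {} \<or>
    (\<exists>i<k. U \<inter> cols {3 * i + 1} \<noteq> {} \<and> U \<inter> cols {3 * i + 3} \<noteq> {}))"

text \<open>The state of a sweep along the path of columns \<open>1, \<dots>, n - 1\<close> that
  remains when the column \<open>n\<close> has been deleted. The first \<open>m\<close> blocks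
  are guarded, the columns from \<open>3m + 1\<close> to \<open>n - 1\<close> are untouched, and
  column \<open>3m\<close> is empty, so that the two parts do not interact. For \<open>m =
  0\<close> there is no column \<open>3m\<close>.\<close>

definition swept :: "nat \<Rightarrow> (nat \<times> nat) set \<Rightarrow> bool" where
  "swept m U \<longleftrightarrow> U \<subseteq> VC \<and> U \<inter> cols {n, 3 * m} = {} \<and> cols {3 * m + 1..n - 1} \<subseteq> U \<and>
    (\<forall>i<m. \<exists>a\<in>U. insert a (nbhd a \<inter> U) \<subseteq> B i)"

lemma guards_wide_leaf:
  assumes n: "n = 3 * k + 2" and U: "U \<subseteq> VC"
    and "\<And>i. i < k \<Longrightarrow> \<exists>a\<in>U. insert a (nbhd a \<inter> U) \<subseteq> B i"
    and "\<exists>a\<in>U. insert a (nbhd a \<inter> U) \<subseteq> cols {n - 1, n}"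
  shows "resolvable (wide_leaf k) U"
proof -
  let ?T = "B(k := cols {n - 1, n})"
  have disj: "B i \<inter> cols {n - 1, n} = {}" if "i < k" for i
    unfolding B_def using n that by (intro cols_disjoint) auto
  have "resolvable (\<lambda>U'. U' \<subseteq> U \<and> (\<forall>i\<in>{..k}. U' \<inter> ?T i \<noteq> {})) U"
  proof (rule resolvable_guards)
    show "finite U" using U fin finite_subset by blast
    show "?T i \<inter> ?T j = {}" if "i \<in> {..k}" "j \<in> {..k}" "i \<noteq> j" for i j
      using that disj[of i] disj[of j] B_disjoint[of i j] by (auto simp: Int_commute)
    show "\<exists>a\<in>U. insert a (nbhd a \<inter> U) \<subseteq> ?T i" if "i \<in> {..k}" for i
      using that assms(3)[of i] assms(4) by (cases "i = k") auto
  qed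
  then show ?thesis
    by (rule resolvable_mono) (use U in \<open>auto simp: wide_leaf_def split: if_splits\<close>)
qed

lemma guards_outer_wide_leaf:
  assumes n: "n = 3 * k + 2" and U: "U \<subseteq> VC" and m: "m < k"
    and "\<And>i. i < k \<Longrightarrow> i \<noteq> m \<Longrightarrow> \<exists>a\<in>U. insert a (nbhd a \<inter> U) \<subseteq> B i"
    and "\<exists>a\<in>U. insert a (nbhd a \<inter> U) \<subseteq> cols {3 * m + 1}"
    and "\<exists>a\<in>U. insert a (nbhd a \<inter> U) \<subseteq> cols {3 * m + 3}"
  shows "resolvable (wide_leaf k) U"
proof -
  let ?T = "B(m := cols {3 * m + 1}, k := cols {3 * m + 3})"
  have disj: "B i \<inter> cols {3 * m + 1} = {}" "B i \<inter> cols {3 * m + 3} = {}" if "i \<noteq> m" for i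
    unfolding B_def using that by (auto intro!: cols_disjoint)
  have disj': "cols {3 * m + 1} \<inter> cols {3 * m + 3} = {}" by (rule cols_disjoint) simp
  have sub: "cols {3 * m + 1} \<subseteq> B m" unfolding B_def cols_def by auto
  have res: "resolvable (\<lambda>U'. U' \<subseteq> U \<and> (\<forall>i\<in>{..k}. U' \<inter> ?T i \<noteq> {})) U"
  proof (rule resolvable_guards)
    show "finite U" using U fin finite_subset by blast
    show "?T i \<inter> ?T j = {}" if "i \<in> {..k}" "j \<in> {..k}" "i \<noteq> j" for i j
      using that disj[of i] disj[of j] disj' B_disjoint[of i j] by (auto simp: Int_commute)
    show "\<exists>a\<in>U. insert a (nbhd a \<inter> U) \<subseteq> ?T i" if "i \<in> {..k}" for i
      using that assms(4)[of i] assms(5,6) m by (cases "i = k"; cases "i = m") auto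
  qed
  show ?thesis
  proof (rule resolvable_mono[OF res])
    fix U' assume U': "U' \<subseteq> U \<and> (\<forall>i\<in>{..k}. U' \<inter> ?T i \<noteq> {})"
    have hit: "U' \<inter> cols {3 * m + 1} \<noteq> {}" "U' \<inter> cols {3 * m + 3} \<noteq> {}"
      using U'[THEN conjunct2, rule_format, of m] U'[THEN conjunct2, rule_format, of k] m by auto
    have "U' \<inter> B i \<noteq> {}" if "i < k" for i
    proof (cases "i = m")
      case True
      then show ?thesis using hit(1) sub by blast
    next
      case False
      then show ?thesis using U'[THEN conjunct2, rule_format, of i] that by simp
    qed
    then show "wide_leaf k U'" unfolding wide_leaf_def using U' U m hit by blast
  qed
qed

text \<open>One step of the sweep. If a vertex of the middle column \<open>3m + 2\<close> is
  chosen, it guards the block \<open>m\<close>, the outer columns disappear, and the sweep moves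
  on. Otherwise the middle column is deleted, so column \<open>3m + 1\<close> is cut off from
  the rest and guards itself. If now a vertex of column \<open>3m + 3\<close> is chosen, both
  outer columns are hit, which makes the leaf wide, and the later blocks are still guarded by
  their middle vertices. If column \<open>3m + 3\<close> is deleted too, the sweep moves on with
  column \<open>3m + 1\<close> as guard of block \<open>m\<close>. At the end \<open>m =
  k\<close> the column \<open>n - 1\<close> is cut off, and it lies among the last two
  columns.\<close>

lemma resolvable_swept:
  assumes n: "n = 3 * k + 2" and "m \<le> k" and "swept m U"
  shows "resolvable (wide_leaf k) U"
  using assms(2,3)
proof (induction m arbitrary: U rule: inc_induct)
  case base
  have k: "1 \<le> k" using n n3 by simp
  have U: "U \<subseteq> VC" "U \<inter> cols {n, 3 * k} = {}" "cols {3 * k + 1..n - 1} \<subseteq> U"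
    "\<And>i. i < k \<Longrightarrow> \<exists>a\<in>U. insert a (nbhd a \<inter> U) \<subseteq> B i"
    using base unfolding swept_def by blast+
  show ?case
  proof (rule guards_wide_leaf[OF n U(1,4)])
    have "(n - 1, 1) \<in> U" using n U(3) by auto
    moreover have "nbhd (n - 1, 1) \<inter> U \<subseteq> cols {n - 1, n}"
    proof
      fix v assume v: "v \<in> nbhd (n - 1, 1) \<inter> U"
      obtain d l where dl: "v = (d, l)" by fastforce
      have "v \<notin> cols {n, 3 * k}" using U(2) v by blast
      moreover have "near n (n - 1) d" "l = 1 \<or> l = 2"
        using v by (auto simp: dl mem_nbhd cadj_def)
      ultimately show "v \<in> cols {n - 1, n}"
        using n k by (auto simp: dl near_def)
    qed
    ultimately show "\<exists>a\<in>U. insert a (nbhd a \<inter> U) \<subseteq> cols {n - 1, n}"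
      by (intro bexI[of _ "(n - 1, 1)"]) auto
  qed
next
  case (step m)
  have U: "U \<subseteq> VC" "U \<inter> cols {n, 3 * m} = {}" "cols {3 * m + 1..n - 1} \<subseteq> U"
    "\<And>i. i < m \<Longrightarrow> \<exists>a\<in>U. insert a (nbhd a \<inter> U) \<subseteq> B i"
    using step.prems unfolding swept_def by blast+
  have alive: "(d, l) \<in> U" if "3 * m + 1 \<le> d" "d < n" "l = 1 \<or> l = 2" for d l
    using that U(3) by auto
  have old: "\<exists>a\<in>W. insert a (nbhd a \<inter> W) \<subseteq> B i"
    if i: "i < m" and W: "W \<subseteq> U" "\<And>d l. (d, l) \<in> U \<Longrightarrow> d \<le> 3 * m \<Longrightarrow> (d, l) \<in> W" for i W
  proof -
    obtain a where a: "a \<in> U" "insert a (nbhd a \<inter> U) \<subseteq> B i" using U(4)[OF i] by blast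
    obtain d l where dl: "a = (d, l)" by fastforce
    have "d \<le> 3 * m" using a(2) i by (auto simp: dl B_def)
    then have "a \<in> W" using W(2) a(1) dl by blast
    then show ?thesis using a(2) W(1) by (intro bexI[of _ a]) auto
  qed
  have next_swept: "resolvable (wide_leaf k) W"
    if W: "W \<subseteq> U" "W \<inter> cols {3 * m + 3} = {}"
      "\<And>d l. (d, l) \<in> U \<Longrightarrow> d \<le> 3 * m \<or> 3 * m + 4 \<le> d \<Longrightarrow> (d, l) \<in> W"
      and guard: "\<exists>a\<in>W. insert a (nbhd a \<inter> W) \<subseteq> B m" for W
  proof (rule step.IH)
    have "\<exists>a\<in>W. insert a (nbhd a \<inter> W) \<subseteq> B i" if "i < Suc m" for i
      using that guard old[of i W] W by (cases "i = m") auto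
    moreover have "cols {3 * Suc m + 1..n - 1} \<subseteq> W"
    proof
      fix v assume v: "v \<in> cols {3 * Suc m + 1..n - 1}"
      obtain d l where "v = (d, l)" by fastforce
      then show "v \<in> W" using v alive[of d l] W(3)[of d l] n by auto
    qed
    moreover have "W \<inter> cols {n, 3 * Suc m} = {}"
    proof -
      have "cols {n, 3 * Suc m} \<subseteq> cols {n, 3 * m} \<union> cols {3 * m + 3}" by auto
      then show ?thesis using W(1,2) U(2) by blast
    qed
    ultimately show "swept (Suc m) W" unfolding swept_def using W(1) U(1) by blast
  qed
  have W_end: "(3 * m + 3) < n" "3 * m + 2 < n" using step.hyps n by auto
  show ?case
  proof (rule resolvable_column[OF U(1), of "3 * m + 2"])
    show "(3 * m + 2, 1) \<in> U" "(3 * m + 2, 2) \<in> U" using alive W_end by auto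
    fix W :: "(nat \<times> nat) set" and j :: nat
    assume j: "j \<in> {1, 2}" and W: "W \<subseteq> U" "(3 * m + 2, j) \<in> W" "nbhd (3 * m + 2, j) \<inter> W = {}"
      "\<And>d l. (d, l) \<in> U \<Longrightarrow> \<not> near n (3 * m + 2) d \<Longrightarrow> (d, l) \<in> W"
    show "resolvable (wide_leaf k) W"
    proof (rule next_swept[OF W(1)])
      have "(3 * m + 3, l) \<in> nbhd (3 * m + 2, j)" if "l = 1 \<or> l = 2" for l
        using that j W_end by (auto simp: mem_nbhd cadj_def near_def)
      then have "v \<in> nbhd (3 * m + 2, j)" if "v \<in> cols {3 * m + 3}" for v
        using that by (cases v) auto
      then show "W \<inter> cols {3 * m + 3} = {}" using W(3) by blast
      show "(d, l) \<in> W" if "(d, l) \<in> U" "d \<le> 3 * m \<or> 3 * m + 4 \<le> d" for d l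
        using that W_end by (intro W(4)) (auto simp: near_def)
      show "\<exists>a\<in>W. insert a (nbhd a \<inter> W) \<subseteq> B m"
        using W(2,3) j by (intro bexI[of _ "(3 * m + 2, j)"]) (auto simp: B_def)
    qed
  next
    let ?U = "U - cols {3 * m + 2}"
    have inner: "nbhd (3 * m + 1, 1) \<inter> ?U \<subseteq> cols {3 * m + 1}"
    proof
      fix v assume v: "v \<in> nbhd (3 * m + 1, 1) \<inter> ?U"
      obtain d l where dl: "v = (d, l)" by fastforce
      have "v \<notin> cols {n, 3 * m}" using U(2) v by blast
      then show "v \<in> cols {3 * m + 1}"
        using v W_end by (auto simp: dl mem_nbhd cadj_def near_def)
    qed
    show "resolvable (wide_leaf k) ?U"
    proof (rule resolvable_column[of ?U "3 * m + 3"])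
      show "?U \<subseteq> VC" using U(1) by blast
      show "(3 * m + 3, 1) \<in> ?U" "(3 * m + 3, 2) \<in> ?U" using alive W_end by auto
      fix W :: "(nat \<times> nat) set" and j :: nat
      assume j: "j \<in> {1, 2}" and W: "W \<subseteq> ?U" "(3 * m + 3, j) \<in> W" "nbhd (3 * m + 3, j) \<inter> W = {}"
        "\<And>d l. (d, l) \<in> ?U \<Longrightarrow> \<not> near n (3 * m + 3) d \<Longrightarrow> (d, l) \<in> W"
      have keep: "(d, l) \<in> W" if "(d, l) \<in> U" "d \<le> 3 * m + 1 \<or> 3 * m + 5 \<le> d" for d l
        using that W_end by (intro W(4)) (auto simp: near_def)
      show "resolvable (wide_leaf k) W"
      proof (rule guards_outer_wide_leaf[OF n _ step.hyps(2)])
        show "W \<subseteq> VC" using W(1) U(1) by blast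
        show "\<exists>a\<in>W. insert a (nbhd a \<inter> W) \<subseteq> B i" if i: "i < k" "i \<noteq> m" for i
        proof (cases "i < m")
          case True
          then show ?thesis using W(1) keep by (intro old) auto
        next
          case False
          then have "(3 * i + 2, 1) \<in> W" using i n by (intro keep alive) auto
          then show ?thesis
            using centre_nbhd[of i] i n by (intro bexI[of _ "(3 * i + 2, 1)"]) auto
        qed
        have "(3 * m + 1, 1) \<in> W" using W_end by (intro keep alive) auto
        then show "\<exists>a\<in>W. insert a (nbhd a \<inter> W) \<subseteq> cols {3 * m + 1}"
          using inner W(1) by (intro bexI[of _ "(3 * m + 1, 1)"]) auto
        show "\<exists>a\<in>W. insert a (nbhd a \<inter> W) \<subseteq> cols {3 * m + 3}"
          using W(2,3) j by (intro bexI[of _ "(3 * m + 3, j)"]) auto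
      qed
    next
      show "resolvable (wide_leaf k) (?U - cols {3 * m + 3})"
      proof (rule next_swept)
        show "\<exists>a\<in>?U - cols {3 * m + 3}. insert a (nbhd a \<inter> (?U - cols {3 * m + 3})) \<subseteq> B m"
        proof (rule bexI[of _ "(3 * m + 1, 1)"])
          have "cols {3 * m + 1} \<subseteq> B m" by (auto simp: cols_def B_def)
          then show "insert (3 * m + 1, 1) (nbhd (3 * m + 1, 1) \<inter> (?U - cols {3 * m + 3})) \<subseteq> B m"
            using inner by (auto simp: B_def)
          show "(3 * m + 1, 1) \<in> ?U - cols {3 * m + 3}" using alive W_end by auto
        qed
      qed auto
    qed
  qed
qed

text \<open>A vertex chosen in column \<open>n\<close> is isolated and lies among the last two
  columns, and the middle vertices still guard all blocks. If column \<open>n\<close> is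
  deleted, the sweep starts.\<close>

lemma resolvable_wide_leaf:
  assumes n: "n = 3 * k + 2"
  shows "resolvable (wide_leaf k) VC"
proof (rule resolvable_column[OF order_refl, of n])
  show "(n, 1) \<in> VC" "(n, 2) \<in> VC" using n3 by auto
  fix W :: "(nat \<times> nat) set" and j :: nat
  assume j: "j \<in> {1, 2}" and W: "W \<subseteq> VC" "(n, j) \<in> W" "nbhd (n, j) \<inter> W = {}"
    "\<And>d l. (d, l) \<in> VC \<Longrightarrow> \<not> near n n d \<Longrightarrow> (d, l) \<in> W"
  show "resolvable (wide_leaf k) W"
  proof (rule guards_wide_leaf[OF n W(1)])
    show "\<exists>a\<in>W. insert a (nbhd a \<inter> W) \<subseteq> B i" if i: "i < k" for i
    proof -
      have "(3 * i + 2, 1) \<in> W" using i n by (intro W(4)) (auto simp: near_def)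
      then show ?thesis
        using centre_nbhd[of i] i n by (intro bexI[of _ "(3 * i + 2, 1)"]) auto
    qed
    show "\<exists>a\<in>W. insert a (nbhd a \<inter> W) \<subseteq> cols {n - 1, n}"
      using W(2,3) j by (intro bexI[of _ "(n, j)"]) auto
  qed
next
  have "swept 0 (VC - cols {n})"
    unfolding swept_def by (auto simp: cols_def cverts_def)
  then show "resolvable (wide_leaf k) (VC - cols {n})" by (intro resolvable_swept[OF n, of 0]) auto
qed

lemma wide_leaf_card:
  assumes n: "n = 3 * k + 2" and U: "wide_leaf k U"
  shows "k + 1 \<le> card U"
proof -
  have finU: "finite U" using U fin finite_subset[of U VC] by (auto simp: wide_leaf_def)
  have BU: "U \<inter> B i \<noteq> {}" if "i < k" for i using U that by (auto simp: wide_leaf_def)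
  obtain T where T: "\<And>i j. i \<in> {..k} \<Longrightarrow> j \<in> {..k} \<Longrightarrow> i \<noteq> j \<Longrightarrow> T i \<inter> T j = {}"
    "\<And>i. i \<in> {..k} \<Longrightarrow> U \<inter> T i \<noteq> {}"
  proof (cases "U \<inter> cols {n - 1, n} \<noteq> {}")
    case True
    have disj: "B i \<inter> cols {n - 1, n} = {}" if "i < k" for i
      unfolding B_def using n that by (intro cols_disjoint) auto
    show ?thesis
    proof (rule that[of "B(k := cols {n - 1, n})"])
      show "(B(k := cols {n - 1, n})) i \<inter> (B(k := cols {n - 1, n})) j = {}"
        if "i \<in> {..k}" "j \<in> {..k}" "i \<noteq> j" for i j
        using that disj[of i] disj[of j] B_disjoint[of i j] by (auto simp: Int_commute)
      show "U \<inter> (B(k := cols {n - 1, n})) i \<noteq> {}" if "i \<in> {..k}" for i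
        using that True BU[of i] by auto
    qed
  next
    case False
    then obtain m where m: "m < k" "U \<inter> cols {3 * m + 1} \<noteq> {}" "U \<inter> cols {3 * m + 3} \<noteq> {}"
      using U unfolding wide_leaf_def by blast
    have disj: "B i \<inter> cols {3 * m + 1} = {}" "B i \<inter> cols {3 * m + 3} = {}" if "i \<noteq> m" for i
      unfolding B_def using that by (auto intro!: cols_disjoint)
    have disj': "cols {3 * m + 1} \<inter> cols {3 * m + 3} = {}" by (rule cols_disjoint) simp
    let ?T = "B(m := cols {3 * m + 1}, k := cols {3 * m + 3})"
    show ?thesis
    proof (rule that[of ?T])
      show "?T i \<inter> ?T j = {}" if "i \<in> {..k}" "j \<in> {..k}" "i \<noteq> j" for i j
        using that disj[of i] disj[of j] disj' B_disjoint[of i j] by (auto simp: Int_commute)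
      show "U \<inter> ?T i \<noteq> {}" if "i \<in> {..k}" for i
        using that m BU[of i] by auto
    qed
  qed
  have "card {..k} \<le> card U" by (rule card_ge_disjoint_hits[OF finU _ T]) simp_all
  then show ?thesis by simp
qed

text \<open>The columns of the last linear form. It contains the last two columns (\<open>n - 1
  = 3k + 1\<close>) and the first but not the third column of each block. A wide leaf meets the
  last two columns, which belong to no block, or both outer columns of some block, which the new
  form separates; so on the leaf the form is independent of the others.\<close>

definition extra_cols :: "nat set" where
  "extra_cols = {c \<in> {1..n}. c mod 3 = 1 \<or> c = n}"

lemma wide_leaf_weakly_regular:
  assumes n: "n = 3 * k + 2" and U: "U \<subseteq> VC" "indep U" "wide_leaf k U"
  shows "weakly_regular (J U) (map (\<lambda>i. form (B i)) [0..<k] @ [form (cols extra_cols)])"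
proof -
  have ik: "3 * i + 3 \<le> n" if "i < k" for i using that n by auto
  have "\<forall>i\<in>{..<k}. \<exists>u. u \<in> B i \<inter> U" using U(3) unfolding wide_leaf_def by blast
  then obtain u where u: "\<And>i. i < k \<Longrightarrow> u i \<in> B i \<inter> U" by (metis lessThan_iff)
  have "weakly_regular (J U) (map (\<lambda>i. form (B i)) [0..<k])"
    using U ik B_subset B_disjoint u by (intro leaf_weakly_regular[of _ _ _ u]) auto
  moreover obtain u' z where u': "\<And>i. i < k \<Longrightarrow> u' i \<in> B i \<inter> U"
    and z: "z \<in> U \<inter> cols extra_cols" "z \<notin> u' ` {..<k}"
    and zB: "\<And>i. i < k \<Longrightarrow> u' i \<in> cols extra_cols \<Longrightarrow> z \<notin> B i"
  proof (cases "U \<inter> cols {n - 1, n} = {}")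
    case False
    then obtain z where z: "z \<in> U" "z \<in> cols {n - 1, n}" by blast
    have zB: "z \<notin> B i" if "i < k" for i
    proof -
      have "B i \<inter> cols {n - 1, n} = {}" unfolding B_def using n that by (intro cols_disjoint) auto
      then show ?thesis using z by blast
    qed
    have "(n - 1) mod 3 = 1" using n by simp
    then have "cols {n - 1, n} \<subseteq> cols extra_cols"
      unfolding cols_def extra_cols_def using n3 by auto
    then show ?thesis using that[of u z] u z zB by blast
  next
    case True
    then obtain m where m: "m < k" "U \<inter> cols {3 * m + 1} \<noteq> {}" "U \<inter> cols {3 * m + 3} \<noteq> {}"
      using U(3) unfolding wide_leaf_def by blast
    then obtain p q where p: "p \<in> U" "p \<in> cols {3 * m + 1}" and q: "q \<in> U" "q \<in> cols {3 * m + 3}"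
      by blast
    have "(3 * m + 1) mod 3 = 1" "(3 * m + 3) mod 3 = 0" "3 * m + 3 \<noteq> n"
      using ik[OF m(1)] n by presburger+
    then have last: "p \<in> cols extra_cols" "q \<notin> cols extra_cols"
      using p q ik[OF m(1)] by (auto simp: cols_def extra_cols_def)
    have "cols {3 * m + 1} \<subseteq> B m" "cols {3 * m + 3} \<subseteq> B m" by (auto simp: cols_def B_def)
    then have B: "p \<in> B m" "q \<in> B m" using p q by blast+
    have pB: "p \<notin> B i" if "i \<noteq> m" for i using B(1) B_disjoint[OF that] by blast
    \<comment> \<open>The pivot of block \<open>m\<close> is moved to its third column, which the
      extra columns avoid; so the variable \<open>p\<close> of the first column keeps its
      coefficient in the last form.\<close>
    show ?thesis
    proof (rule that[of "u(m := q)" p])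
      show "(u(m := q)) i \<in> B i \<inter> U" if "i < k" for i using u[OF that] B q by auto
      show "p \<in> U \<inter> cols extra_cols" using p last by blast
      show "p \<notin> (u(m := q)) ` {..<k}"
      proof
        assume "p \<in> (u(m := q)) ` {..<k}"
        then show False
        proof (rule imageE)
          fix i assume i: "p = (u(m := q)) i" "i \<in> {..<k}"
          then show False using last pB[of i] u[of i] by (cases "i = m") auto
        qed
      qed
      show "p \<notin> B i" if "i < k" "(u(m := q)) i \<in> cols extra_cols" for i
        using that last pB[of i] by (cases "i = m") auto
    qed
  qed
  moreover have "cols extra_cols \<subseteq> VC" by (rule cols_subset) (auto simp: extra_cols_def)
  ultimately show ?thesis
    using leaf_nonzerodivisor[OF U(2,1), of k B u' "cols extra_cols" z] ik B_subset B_disjoint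
    by (simp add: weakly_regular_append)
qed

text \<open>The centres are the middle columns of the blocks and the column \<open>n\<close>.
  They are pairwise nonadjacent and dominate the cycle, so in the product \<open>w\<close> of
  the variables \<open>x\<^bsub>c1\<^esub>\<close> over the centres \<open>c\<close> every other
  variable \<open>v\<close> satisfies \<open>v w \<in> I\<close>. Each linear form contains
  exactly one of the factors of \<open>w\<close>, and thus multiplies \<open>w\<close> to the
  same element as that factor. The substitution sends the twins
  \<open>x\<^bsub>c1\<^esub>\<close> and \<open>x\<^bsub>c2\<^esub>\<close> of a centre to
  \<open>x\<^bsub>c1\<^esub>\<close> and \<open>-x\<^bsub>c1\<^esub>\<close> and all other
  variables to zero; every form is a sum over whole columns and therefore goes to zero.\<close>

lemma depth_sdepth_mod3_2:
  assumes n: "n = 3 * k + 2"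
  shows "depth_quot VC (J VC) = enat (k + 1)" and "enat (k + 1) \<le> sdepth_quot VC (J VC)"
proof -
  have ik: "3 * i + 3 \<le> n" if "i < k" for i using that n by auto
  note res = resolvable_wide_leaf[OF n]
  have "resolvable (\<lambda>U. k + 1 \<le> card U) VC"
    by (rule resolvable_mono[OF res]) (rule wide_leaf_card[OF n])
  then show "enat (k + 1) \<le> sdepth_quot VC (J VC)" by (rule sdepth_quot_ge)
  define fs where "fs = map (\<lambda>i. form (B i)) [0..<k] @ [form (cols extra_cols)]"
  define L where "L = foldl adjoin (J VC) fs"
  have last_sub: "cols extra_cols \<subseteq> VC" by (rule cols_subset) (auto simp: extra_cols_def)
  have fs_var_ideal: "set fs \<subseteq> var_ideal"
    unfolding fs_def using ik last_sub by (auto intro!: form_var_ideal B_subset)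
  then have fsC: "set fs \<subseteq> C" using var_ideal_closed by blast
  have L: "is_ideal L" unfolding L_def by (rule foldl_adjoin_ideal[OF J_ideal fsC])
  have JL: "p \<in> L" if "p \<in> J VC" for p unfolding L_def by (rule foldl_adjoin_superset[OF that])
  have fsL: "f \<in> L" if "f \<in> set fs" for f
    unfolding L_def using that by (rule foldl_adjoin_member[OF J_ideal fsC])
  have weakly_regular: "weakly_regular (J VC) fs"
    unfolding fs_def
    by (rule resolvable_weakly_regular[OF res order_refl]) (use fsC wide_leaf_weakly_regular[OF n] in \<open>auto simp: fs_def\<close>)
  define Y where "Y = insert n ((\<lambda>i. 3 * i + 2) ` {..<k})"
  have finY: "finite Y" by (simp add: Y_def)
  have Yn: "c \<in> {1..n}" if "c \<in> Y" for c using that n3 ik by (auto simp: Y_def dest: ik)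
  have Y_near: "c = d" if "c \<in> Y" "d \<in> Y" "near n c d" for c d
    using that n unfolding Y_def near_def by auto presburger+
  define w where "w = (\<Prod>c\<in>Y. var (c, 1) :: (nat \<times> nat, 'k) mpoly)"
  have wC: "w \<in> C" unfolding w_def using Yn by (intro prod_closed var_carrier) fastforce
  have off_centre: "var v * w \<in> J VC" if v: "EC v (c, 1)" "c \<in> Y" for v c
  proof -
    have "(\<Prod>c\<in>Y - {c}. var (c, 1)) * (var v * var (c, 1)) \<in> J VC"
      using Yn by (intro ideal_mult[OF J_ideal _ adjacent_product[OF v(1)]] prod_closed var_carrier)
        fastforce
    then show ?thesis
      unfolding w_def using finY v(2) by (simp add: prod.remove[of Y c] mult_ac)
  qed
  have centre: "var (c, 1) * w \<in> L"
    if c: "c \<in> Y" and S: "finite S" "c \<in> S" "S \<subseteq> {1..n}" "form (cols S) \<in> L"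
      and dom: "\<And>d. d \<in> S \<Longrightarrow> d \<noteq> c \<Longrightarrow> \<exists>e\<in>Y. d \<noteq> e \<and> near n d e" for c S
  proof -
    have "var v * w \<in> J VC" if v: "v \<in> cols S - {(c, 1)}" for v
    proof -
      obtain d l where dl: "v = (d, l)" by fastforce
      have d: "d \<in> S" "l = 1 \<or> l = 2" using v by (auto simp: dl)
      show ?thesis
      proof (cases "d = c")
        case True
        then show ?thesis
          using v d S(3) c by (intro off_centre[OF _ c]) (auto simp: dl cadj_def near_def)
      next
        case False
        then obtain e where e: "e \<in> Y" "d \<noteq> e" "near n d e" using dom d(1) by blast
        then show ?thesis
          using d S(3) Yn[OF e(1)] by (intro off_centre[OF _ e(1)]) (auto simp: dl cadj_def)
      qed
    qed
    then have "(\<Sum>v\<in>cols S - {(c, 1)}. var v * w) \<in> L" by (intro ideal_sum[OF L] JL)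
    moreover have "w * form (cols S) \<in> L" by (rule ideal_mult[OF L wC S(4)])
    ultimately have "w * form (cols S) - (\<Sum>v\<in>cols S - {(c, 1)}. var v * w) \<in> L"
      by (intro ideal_diff[OF L])
    moreover have "form (cols S) = var (c, 1) + (\<Sum>v\<in>cols S - {(c, 1)}. var v)"
      unfolding form_def using S(1,2) by (intro sum.remove) (auto simp: cols_def)
    ultimately show ?thesis by (simp add: distrib_left sum_distrib_left mult.commute[of w])
  qed
  have dominated: "\<exists>e\<in>Y. c \<noteq> e \<and> near n c e" if c: "1 \<le> c" "c \<le> n" "c \<notin> Y" for c
  proof (cases "c \<le> 3 * k")
    case True
    define i where "i = (c - 1) div 3"
    have i: "i < k" "c = 3 * i + 1 \<or> c = 3 * i + 2 \<or> c = 3 * i + 3"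
      unfolding i_def using True c by linarith+
    then have "3 * i + 2 \<in> Y" by (auto simp: Y_def)
    then show ?thesis using i(2) c(3) by (intro bexI[of _ "3 * i + 2"]) (auto simp: near_def)
  next
    case False
    then have "c = n - 1" using c n by (auto simp: Y_def)
    then show ?thesis using n3 by (intro bexI[of _ n]) (auto simp: Y_def near_def)
  qed
  have socle: "var v * w \<in> L" if v: "v \<in> VC" for v
  proof -
    obtain c j where cj: "v = (c, j)" by fastforce
    have c: "1 \<le> c" "c \<le> n" "j = 1 \<or> j = 2" using v by (auto simp: cj)
    consider "c \<notin> Y" | "c \<in> Y" "j = 2" | "c = n" "j = 1" | i where "c = 3 * i + 2" "i < k" "j = 1"
      using c(3) by (auto simp: Y_def)
    then show ?thesis
    proof cases
      case 1
      then obtain e where e: "e \<in> Y" "c \<noteq> e" "near n c e" using dominated c by blast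
      then show ?thesis
        using c Yn[OF e(1)] by (intro JL off_centre[OF _ e(1)]) (auto simp: cj cadj_def)
    next
      case 2
      then show ?thesis
        using c by (intro JL off_centre[OF _ 2(1)]) (auto simp: cj cadj_def near_def)
    next
      case 3
      have "n mod 3 = 2" using n by presburger
      have "var (n, 1) * w \<in> L"
      proof (rule centre[of n extra_cols])
        show "n \<in> Y" by (simp add: Y_def)
        show "form (cols extra_cols) \<in> L" by (rule fsL) (simp add: fs_def)
        show "\<exists>e\<in>Y. d \<noteq> e \<and> near n d e" if d: "d \<in> extra_cols" "d \<noteq> n" for d
        proof -
          have "d mod 3 = 1" using d by (auto simp: extra_cols_def)
          then have "d \<notin> Y" using d(2) by (auto simp: Y_def) presburger
          then show ?thesis using dominated d(1) by (auto simp: extra_cols_def)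
        qed
      qed (use n3 in \<open>auto simp: extra_cols_def\<close>)
      then show ?thesis by (simp add: cj 3)
    next
      case 4
      have "var (3 * i + 2, 1) * w \<in> L"
      proof (rule centre[of "3 * i + 2" "{3 * i + 1..3 * i + 3}"])
        show "3 * i + 2 \<in> Y" using 4 by (auto simp: Y_def)
        show "form (cols {3 * i + 1..3 * i + 3}) \<in> L"
          by (rule fsL) (use 4 in \<open>auto simp: fs_def B_def\<close>)
        show "\<exists>e\<in>Y. d \<noteq> e \<and> near n d e"
          if "d \<in> {3 * i + 1..3 * i + 3}" "d \<noteq> 3 * i + 2" for d
          using that 4 by (intro bexI[of _ "3 * i + 2"]) (auto simp: near_def Y_def)
      qed (use ik[OF 4(2)] in auto)
      then show ?thesis by (simp add: cj 4)
    qed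
  qed
  have "w \<notin> L"
  proof -
    define \<psi> :: "nat \<times> nat \<Rightarrow> (nat \<times> nat, 'k) mpoly" where
      "\<psi> = (\<lambda>(c, j). if c \<in> Y then (if j = 1 then 1 else - 1) * var (c, 1) else 0)"
    have cancel: "subst \<psi> (form (cols S)) = 0" if "finite S" for S
      unfolding subst_form sum_cols[OF that] by (intro sum.neutral) (auto simp: \<psi>_def)
    show ?thesis
      unfolding L_def
    proof (rule not_in_by_subst[of \<psi>])
      show "subst \<psi> f = 0" if f: "f \<in> set fs" for f
      proof -
        have "finite extra_cols" by (simp add: extra_cols_def)
        moreover have "f = form (cols extra_cols) \<or> (\<exists>i. f = form (cols {3 * i + 1..3 * i + 3}))"
          using f unfolding fs_def B_def by auto
        ultimately show ?thesis using cancel by (elim disjE exE) simp_all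
      qed
      have "subst \<psi> w = (\<Prod>c\<in>Y. var (c, 1))"
      proof -
        have one: "subst \<psi> 1 = 1"
          by (simp flip: single_one add: subst_single) (simp add: monomial_value_def)
        have "subst \<psi> (\<Prod>c\<in>X. var (c, 1)) = (\<Prod>c\<in>X. \<psi> (c, 1))" for X
          by (induction X rule: infinite_finite_induct) (simp_all add: one subst_mult subst_var)
        then show ?thesis by (simp add: w_def \<psi>_def)
      qed
      then show "subst \<psi> w \<notin> nonsquarefree"
        using prod_vars_not_nonsquarefree[of "\<lambda>c. (c, 1)" Y] by (simp add: inj_on_def)
      show "\<psi> u * \<psi> v \<in> nonsquarefree" if E: "EC u v" for u v
      proof -
        obtain c j d l where uv: "u = (c, j)" "v = (d, l)" by fastforce
        have near: "near n c d" using E by (simp add: uv cadj_def)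
        show ?thesis
        proof (cases "c \<in> Y \<and> d \<in> Y")
          case True
          then have "c = d" using Y_near near by blast
          then show ?thesis using True var_square_nonsquarefree by (simp add: uv \<psi>_def)
        next
          case False
          then have zero: "\<psi> u * \<psi> v = 0" by (auto simp: uv \<psi>_def)
          show ?thesis unfolding zero nonsquarefree_def by simp
        qed
      qed
    qed
  qed
  then have "depth_quot VC (J VC) = enat (length fs)"
    using weakly_regular wC socle fs_var_ideal unfolding L_def by (intro depth_quot_eq) auto
  then show "depth_quot VC (J VC) = enat (k + 1)" by (simp add: fs_def)
qed

end

theorem theorem3p4:
  fixes n :: nat
  assumes "n \<ge> 3"
  shows "sdepth_quot (verts (strong_cycle_path n 2))
           (edge_ideal (strong_cycle_path n 2) :: (nat \<times> nat, 'k::field) mpoly set)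
         \<ge> depth_quot (verts (strong_cycle_path n 2))
           (edge_ideal (strong_cycle_path n 2) :: (nat \<times> nat, 'k) mpoly set)
       \<and> depth_quot (verts (strong_cycle_path n 2))
           (edge_ideal (strong_cycle_path n 2) :: (nat \<times> nat, 'k) mpoly set)
         = enat (nat \<lceil>(real n - 1) / 3\<rceil>)"
proof -
  interpret strong_cycle n "TYPE('k)" by unfold_locales fact
  define k where "k = n div 3"
  consider "n = 3 * k \<or> n = 3 * k + 1" | "n = 3 * k + 2" unfolding k_def by linarith
  then show ?thesis
  proof cases
    case 1
    then have "\<lceil>(real n - 1) / 3\<rceil> = int k"
      using assms by (auto simp: ceiling_eq_iff)
    then show ?thesis
      using depth_sdepth_mod3_01[OF 1] unfolding edge_ideal_strong_cycle verts_strong_cycle by simp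
  next
    case 2
    then have "\<lceil>(real n - 1) / 3\<rceil> = int (k + 1)"
      by (simp add: ceiling_eq_iff)
    then show ?thesis
      using depth_sdepth_mod3_2[OF 2] unfolding edge_ideal_strong_cycle verts_strong_cycle
      by (simp add: nat_add_distrib)
  qed
qed

end
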